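(* Let $\mathfrak H=\mathfrak H_1\oplus\mathfrak H_2$ be a Hilbert space with a closed subspace $\mathfrak H_1$ and $\mathfrak H_2=\mathfrak H\ominus\mathfrak H_1$. Let $$T_1=\begin{pmatrix} T_{11} \\ T_{21} \end{pmatrix}:\mathfrak H_1\to\begin{pmatrix} \mathfrak H_1 \\ \mathfrak H_2 \end{pmatrix}$$ be a bounded symmetric operator with $T_{11}=T_{11}^*\in[\mathfrak H_1]$ and $\nu_-(I-T_{11}^2)=\kappa<\infty$, and let $J=\operatorname{sign}(I-T_{11}^2)$. Consider the incomplete block operators $$A_\pm^0=\begin{pmatrix} I\pm T_{11} & \pm T_{21}^* \\ \pm T_{21} & \ast \end{pmatrix}.$$ Then the completion problem for $A_\pm^0$ has a solution $I\pm T$ for some $T=T^*\in[\mathfrak H]$ with $\nu_-(I-T^2)=\kappa$ if and only if $$\nu_-(I-T_{11}^2)=\nu_-(I-T_1^*T_1).$$ If this condition is satisfied then the following facts hold: (i) The completion problems for $A_+^0$ and $A_-^0$ have minimal solutions $A_+$ and $A_-$, respectively. (ii) The operators $T_m:=A_+-I$ and $T_M:=I-A_-$ belong to $\operatorname{Ext}_{T_1,\kappa}(-1,1)$. (iii) The operators $T_m$ and $T_M$ have the block form $$T_m=\begin{pmatrix} T_{11} & D_{T_{11}}V^* \\ V D_{T_{11}} & -I+V(I-T_{11})JV^* \end{pmatrix},\qquad T_M=\begin{pmatrix} T_{11} & D_{T_{11}}V^* \\ V D_{T_{11}} & I-V(I+T_{11})JV^* \end{pmatrix},$$ where $D_{T_{11}}:=|I-T_{11}^2|^{1/2}$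 and $V:=\operatorname{clos}(T_{21}D_{T_{11}}^{[-1]})$. (iv) The operators $T_m$ and $T_M$ are extremal extensions of $T_1$: $T\in\operatorname{Ext}_{T_1,\kappa}(-1,1)$ if and only if $T=T^*\in[\mathfrak H]$ and $T_m\le T\le T_M$. (v) The operators $T_m$ and $T_M$ are connected via $(-T)_m=-T_M$ and $(-T)_M=-T_m$, where $(-T)_m$ and $(-T)_M$ denote the operators obtained as in (ii) when $T_1$ is replaced by $-T_1$.
   Context: $[\mathfrak H,\mathfrak K]$ denotes bounded everywhere defined operators, $[\mathfrak H]=[\mathfrak H,\mathfrak H]$. For bounded selfadjoint $X$, $\nu_-(X)$ is the dimension of its spectral subspace for $(-\infty,0)$, $|X|=(X^2)^{1/2}$, $\operatorname{sign}(X)$ is defined by the functional calculus with $\operatorname{sign}(t)=1$ for $t\ge0$, $-1$ for $t<0$. $D_{T_{11}}^{[-1]}$ is the (generalized) Moore–Penrose inverse of $D_{T_{11}}$ (inverse of $D_{T_{11}}\restriction(\ker D_{T_{11}})^\perp$ on $\operatorname{ran}D_{T_{11}}$, zero on $\ker D_{T_{11}}$), and $\operatorname{clos}$ denotes operator closure. The completion problem for $A_\pm^0$ is to find selfadjoint completions $\widetilde A_\pm\in[\mathfrak H]$ (choosing the entry $\ast$) under the minimal index conditions $\nu_-(\widetilde A_+)=\nu_-(I+T_{11})$, $\nu_-(\widetilde A_-)=\nu_-(I-T_{11})$; a minimal solution is the smallest such completion in the usual order of bounded selfadjoint operators. One looks for solutions of the form $\widetilde A_+=I+T$ and $\widetilde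 A_-=I-T$ with a single $T=T^*$; for such $T$ the two minimal index conditions together are equivalent to $\nu_-(I-T^2)=\nu_-(I-T_{11}^2)$. $\operatorname{Ext}_{T_1,\kappa}(-1,1)$ denotes the set of all solutions $T$ to this problem, i.e. all $T=T^*\in[\mathfrak H]$ that extend $T_1$ and satisfy $\nu_-(I-T^2)=\kappa$. *)

theory Defs
  imports "HOL-Analysis.Analysis" "HOL-Library.Extended_Nat"
begin

section \<open>Complex Hilbert spaces\<close>

text \<open>
  The distribution only has real inner product spaces.  A complex inner product space is
  rendered as a real one with a compatible complex structure; the real inner product
  (hence the norm and the topology) is the real part of the complex one, which is linear
  in the first argument.
\<close>

class complex_vector = real_vector +
  fixes scaleC :: "complex \<Rightarrow> 'a \<Rightarrow> 'a"  (infixr "*\<^sub>C" 75)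
  assumes scaleC_add_right: "a *\<^sub>C (x + y) = a *\<^sub>C x + a *\<^sub>C y"
    and scaleC_add_left: "(a + b) *\<^sub>C x = a *\<^sub>C x + b *\<^sub>C x"
    and scaleC_scaleC: "a *\<^sub>C b *\<^sub>C x = (a * b) *\<^sub>C x"
    and scaleC_of_real: "complex_of_real r *\<^sub>C x = r *\<^sub>R x"

class complex_inner = complex_vector + real_inner +
  fixes cinner :: "'a \<Rightarrow> 'a \<Rightarrow> complex"
  assumes cinner_commute: "cinner x y = cnj (cinner y x)"
    and cinner_add_left: "cinner (x + y) z = cinner x z + cinner y z"
    and cinner_scaleC_left: "cinner (a *\<^sub>C x) y = a * cinner x y"
    and Re_cinner: "Re (cinner x y) = inner x y"

class complex_hilbert = complex_inner + complete_space

global_interpretation complex_vector: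
  vector_space "scaleC :: complex \<Rightarrow> 'a \<Rightarrow> 'a::complex_vector"
proof
  fix a b :: complex and x y :: 'a
  show "a *\<^sub>C (x + y) = a *\<^sub>C x + a *\<^sub>C y" by (rule scaleC_add_right)
  show "(a + b) *\<^sub>C x = a *\<^sub>C x + b *\<^sub>C x" by (rule scaleC_add_left)
  show "a *\<^sub>C b *\<^sub>C x = (a * b) *\<^sub>C x" by (rule scaleC_scaleC)
  show "1 *\<^sub>C x = x" using scaleC_of_real[of 1 x] by simp
qed

instantiation complex :: complex_hilbert
begin

definition scaleC_complex :: "complex \<Rightarrow> complex \<Rightarrow> complex"
  where "scaleC_complex a x = a * x"

definition cinner_complex :: "complex \<Rightarrow> complex \<Rightarrow> complex"
  where "cinner_complex x y = x * cnj y"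

instance
  by standard
    (simp_all add: scaleC_complex_def cinner_complex_def inner_complex_def algebra_simps
      scaleR_conv_of_real)

end

text \<open>
  The orthogonal sum of two Hilbert spaces is the product type with its library
  topology and real inner product.
\<close>

instantiation prod :: (complex_vector, complex_vector) complex_vector
begin

definition scaleC_prod :: "complex \<Rightarrow> 'a \<times> 'b \<Rightarrow> 'a \<times> 'b"
  where "scaleC_prod a z = (a *\<^sub>C fst z, a *\<^sub>C snd z)"

instance
  by standard
    (simp_all add: scaleC_prod_def scaleC_add_right scaleC_add_left scaleC_scaleC
      scaleC_of_real scaleR_prod_def)

end

instantiation prod :: (complex_inner, complex_inner) complex_inner
begin

definition cinner_prod :: "'a \<times> 'b \<Rightarrow> 'a \<times> 'b \<Rightarrow> complex"
  where "cinner_prod z w = cinner (fst z) (fst w) + cinner (snd z) (snd w)"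

instance
proof
  fix x y z :: "'a \<times> 'b" and a :: complex
  show "cinner x y = cnj (cinner y x)"
    unfolding cinner_prod_def complex_cnj_add by (metis cinner_commute)
  show "cinner (x + y) z = cinner x z + cinner y z"
    by (simp add: cinner_prod_def cinner_add_left)
  show "cinner (a *\<^sub>C x) y = a * cinner x y"
    by (simp add: cinner_prod_def scaleC_prod_def cinner_scaleC_left distrib_left)
  show "Re (cinner x y) = inner x y"
    by (simp add: cinner_prod_def Re_cinner inner_prod_def)
qed

end

instance prod :: (complex_hilbert, complex_hilbert) complex_hilbert ..


section \<open>Bounded operators\<close>

definition bounded_clinear :: "('a::complex_hilbert \<Rightarrow> 'b::complex_hilbert) \<Rightarrow> bool"
  where "bounded_clinear A \<longleftrightarrow> bounded_linear A \<and> (\<forall>c x. A (c *\<^sub>C x) = c *\<^sub>C A x)"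

definition cadjoint :: "('a::complex_hilbert \<Rightarrow> 'b::complex_hilbert) \<Rightarrow> 'b \<Rightarrow> 'a"
  where "cadjoint A = (THE B. \<forall>x y. cinner (A x) y = cinner x (B y))"

definition selfadjoint :: "('a::complex_hilbert \<Rightarrow> 'a) \<Rightarrow> bool"
  where "selfadjoint A \<longleftrightarrow>
    bounded_clinear A \<and> (\<forall>x y. cinner (A x) y = cinner x (A y))"

definition op_le :: "('a::complex_hilbert \<Rightarrow> 'a) \<Rightarrow> ('a \<Rightarrow> 'a) \<Rightarrow> bool"
  where "op_le A B \<longleftrightarrow> (\<forall>x. Re (cinner (A x) x) \<le> Re (cinner (B x) x))"

definition orth_projection :: "('a::complex_hilbert \<Rightarrow> 'a) \<Rightarrow> bool"
  where "orth_projection P \<longleftrightarrow> selfadjoint P \<and> (\<forall>x. P (P x) = P x)"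

definition block_op ::
    "('a \<Rightarrow> 'a) \<Rightarrow> ('b \<Rightarrow> 'a) \<Rightarrow> ('a \<Rightarrow> 'b) \<Rightarrow> ('b \<Rightarrow> 'b) \<Rightarrow>
     'a::complex_hilbert \<times> 'b::complex_hilbert \<Rightarrow> 'a \<times> 'b"
  where "block_op A11 A12 A21 A22 = (\<lambda>(x, y). (A11 x + A12 y, A21 x + A22 y))"

definition column_op ::
    "('a::complex_hilbert \<Rightarrow> 'a) \<Rightarrow> ('a \<Rightarrow> 'b::complex_hilbert) \<Rightarrow> 'a \<Rightarrow> 'a \<times> 'b"
  where "column_op T11 T21 = (\<lambda>x. (T11 x, T21 x))"


section \<open>Functional calculus of bounded selfadjoint operators\<close>

text \<open>
  The measure \<open>d\<parallel>E\<^sub>t x\<parallel>\<^sup>2\<close>: the Lebesgue--Stieltjes measure of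
  \<open>t \<mapsto> \<parallel>E\<^sub>t x\<parallel>\<^sup>2 = \<langle>E\<^sub>t x, x\<rangle>\<close>, which gives \<open>(s, t]\<close>
  the mass \<open>\<parallel>E\<^sub>t x\<parallel>\<^sup>2 - \<parallel>E\<^sub>s x\<parallel>\<^sup>2\<close>.
\<close>

definition spectral_measure :: "(real \<Rightarrow> 'a::complex_hilbert \<Rightarrow> 'a) \<Rightarrow> 'a \<Rightarrow> real measure"
  where "spectral_measure E x = interval_measure (\<lambda>t. (norm (E t x))\<^sup>2)"

text \<open>
  \<open>E\<close> is the right-continuous resolution of the identity of \<open>X\<close>, that is
  \<open>X = \<integral> t dE\<^sub>t\<close> in the weak sense.
\<close>

definition is_spectral_family ::
    "('a::complex_hilbert \<Rightarrow> 'a) \<Rightarrow> (real \<Rightarrow> 'a \<Rightarrow> 'a) \<Rightarrow> bool"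
  where "is_spectral_family X E \<longleftrightarrow>
    (\<forall>t. orth_projection (E t)) \<and>
    (\<forall>s t x. s \<le> t \<longrightarrow> E s (E t x) = E s x \<and> E t (E s x) = E s x) \<and>
    (\<forall>t x. ((\<lambda>s. E s x) \<longlongrightarrow> E t x) (at_right t)) \<and>
    (\<exists>a b. (\<forall>t<a. \<forall>x. E t x = 0) \<and> (\<forall>t\<ge>b. \<forall>x. E t x = x)) \<and>
    (\<forall>x. cinner (X x) x = (LINT t|spectral_measure E x. complex_of_real t))"

text \<open>
  By the spectral theorem the choice is unique for bounded selfadjoint \<open>X\<close>.
\<close>

definition spectral_family :: "('a::complex_hilbert \<Rightarrow> 'a) \<Rightarrow> real \<Rightarrow> 'a \<Rightarrow> 'a"
  where "spectral_family X = (SOME E. is_spectral_family X E)"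

text \<open>
  \<open>f(X) = \<integral> f dE\<close> for bounded Borel functions \<open>f\<close>; on a complex space the quadratic
  form determines the operator.
\<close>

definition fun_calculus ::
    "(real \<Rightarrow> real) \<Rightarrow> ('a::complex_hilbert \<Rightarrow> 'a) \<Rightarrow> 'a \<Rightarrow> 'a"
  where "fun_calculus f X = (THE B. bounded_clinear B \<and>
    (\<forall>x. cinner (B x) x =
      (LINT t|spectral_measure (spectral_family X) x. complex_of_real (f t))))"

definition spectral_subspace :: "('a::complex_hilbert \<Rightarrow> 'a) \<Rightarrow> real set \<Rightarrow> 'a set"
  where "spectral_subspace X S = range (fun_calculus (indicator S) X)"

definition cdim :: "'a::complex_hilbert set \<Rightarrow> enat"
  where "cdim S = (if \<exists>B. finite B \<and> S \<subseteq> complex_vector.span B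
                   then enat (complex_vector.dim S) else \<infinity>)"

definition neg_index :: "('a::complex_hilbert \<Rightarrow> 'a) \<Rightarrow> enat"  (\<open>\<nu>\<^sub>-\<close>)
  where "\<nu>\<^sub>- X = cdim (spectral_subspace X {..<0})"

text \<open>Unlike the library's \<open>sgn\<close>, this takes the value \<open>1\<close> at \<open>0\<close>.\<close>

definition sign_op :: "('a::complex_hilbert \<Rightarrow> 'a) \<Rightarrow> 'a \<Rightarrow> 'a"
  where "sign_op X = fun_calculus (\<lambda>t. if t \<ge> 0 then 1 else -1) X"

text \<open>The nonnegative square root of a nonnegative operator.\<close>

definition sqrt_op :: "('a::complex_hilbert \<Rightarrow> 'a) \<Rightarrow> 'a \<Rightarrow> 'a"
  where "sqrt_op A = (THE B. selfadjoint B \<and> op_le (\<lambda>x. 0) B \<and> B \<circ> B = A)"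

definition abs_op :: "('a::complex_hilbert \<Rightarrow> 'a) \<Rightarrow> 'a \<Rightarrow> 'a"
  where "abs_op X = sqrt_op (X \<circ> X)"


section \<open>Closed operators as graphs\<close>

definition graph_of :: "('a \<Rightarrow> 'b) \<Rightarrow> ('a \<times> 'b) set"
  where "graph_of A = {(x, A x) | x. True}"

text \<open>
  Graph of the Moore--Penrose inverse \<open>D\<^bsup>[-1]\<^esup>\<close> of a selfadjoint \<open>D\<close>, an in general unbounded
  operator with domain \<open>ran D \<oplus> ker D\<close>.
\<close>

definition mp_inverse_graph :: "('a::complex_hilbert \<Rightarrow> 'a) \<Rightarrow> ('a \<times> 'a) set"
  where "mp_inverse_graph D =
    {(D x + z, x) | x z. (\<forall>w. D w = 0 \<longrightarrow> cinner x w = 0) \<and> D z = 0}"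

text \<open>
  \<open>V = clos (S D\<^bsup>[-1]\<^esup>)\<close>, including the claim that this closure is a bounded everywhere
  defined operator.
\<close>

definition is_clos_mp_quotient ::
    "('a::complex_hilbert \<Rightarrow> 'b::complex_hilbert) \<Rightarrow> ('a \<Rightarrow> 'a) \<Rightarrow> ('a \<Rightarrow> 'b) \<Rightarrow> bool"
  where "is_clos_mp_quotient S D V \<longleftrightarrow>
    bounded_clinear V \<and> graph_of V = closure {(u, S x) | u x. (u, x) \<in> mp_inverse_graph D}"


section \<open>The completion problem\<close>

text \<open>
  Selfadjoint completions of the incomplete block operator with first column
  \<open>(A11, A21)\<close>, first row \<open>(A11, A21\<^sup>*)\<close> and free lower right entry, with minimal negative
  index.
\<close>

definition completions ::
    "('a::complex_hilbert \<Rightarrow> 'a) \<Rightarrow> ('a \<Rightarrow> 'b::complex_hilbert) \<Rightarrow> ('a \<times> 'b \<Rightarrow> 'a \<times> 'b) set"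
  where "completions A11 A21 =
    {A. selfadjoint A \<and> (\<exists>A22. A = block_op A11 (cadjoint A21) A21 A22) \<and>
        \<nu>\<^sub>- A = \<nu>\<^sub>- A11}"

definition is_minimal_completion ::
    "('a::complex_hilbert \<Rightarrow> 'a) \<Rightarrow> ('a \<Rightarrow> 'b::complex_hilbert) \<Rightarrow>
     ('a \<times> 'b \<Rightarrow> 'a \<times> 'b) \<Rightarrow> bool"
  where "is_minimal_completion A11 A21 A \<longleftrightarrow>
    A \<in> completions A11 A21 \<and> (\<forall>B \<in> completions A11 A21. op_le A B)"

definition minimal_completion ::
    "('a::complex_hilbert \<Rightarrow> 'a) \<Rightarrow> ('a \<Rightarrow> 'b::complex_hilbert) \<Rightarrow> 'a \<times> 'b \<Rightarrow> 'a \<times> 'b"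
  where "minimal_completion A11 A21 = (THE A. is_minimal_completion A11 A21 A)"

definition T_min ::
    "('a::complex_hilbert \<Rightarrow> 'a) \<Rightarrow> ('a \<Rightarrow> 'b::complex_hilbert) \<Rightarrow> 'a \<times> 'b \<Rightarrow> 'a \<times> 'b"
  where "T_min T11 T21 = (\<lambda>z. minimal_completion (\<lambda>x. x + T11 x) T21 z - z)"

definition T_max ::
    "('a::complex_hilbert \<Rightarrow> 'a) \<Rightarrow> ('a \<Rightarrow> 'b::complex_hilbert) \<Rightarrow> 'a \<times> 'b \<Rightarrow> 'a \<times> 'b"
  where "T_max T11 T21 = (\<lambda>z. z - minimal_completion (\<lambda>x. x - T11 x) (\<lambda>x. - T21 x) z)"

definition Ext ::
    "('a::complex_hilbert \<Rightarrow> 'a \<times> 'b::complex_hilbert) \<Rightarrow> enat \<Rightarrow> ('a \<times> 'b \<Rightarrow> 'a \<times> 'b) set"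
  where "Ext T1 \<kappa> =
    {T. selfadjoint T \<and> (\<forall>x. T (x, 0) = T1 x) \<and> \<nu>\<^sub>- (\<lambda>z. z - T (T z)) = \<kappa>}"

end

theory Submission
  imports Defs "HOL-Probability.Distribution_Functions"
begin

text \<open>
  Put \<open>D = \<bar>1 - T\<^sub>1\<^sub>1\<^sup>2\<bar>\<^sup>1\<^sup>/\<^sup>2\<close> and \<open>J = sign (1 - T\<^sub>1\<^sub>1\<^sup>2)\<close>, so that
  \<open>1 - T\<^sub>1\<^sup>* T\<^sub>1 = D J D - T\<^sub>2\<^sub>1\<^sup>* T\<^sub>2\<^sub>1\<close>.  If this operator has no more negative squares than
  \<open>D J D\<close>, then \<open>\<parallel>T\<^sub>2\<^sub>1 x\<parallel> \<le> c \<parallel>D x\<parallel>\<close>, hence \<open>T\<^sub>2\<^sub>1 = V D\<close>, and moreover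
  \<open>V J V\<^sup>* \<le> 1\<close>: a violation of either would enlarge a maximal negative subspace.

  With \<open>J\<^sub>\<plusminus> = sign (1 \<plusminus> T\<^sub>1\<^sub>1)\<close> and \<open>D\<^sub>\<plusminus> = \<bar>1 \<plusminus> T\<^sub>1\<^sub>1\<bar>\<^sup>1\<^sup>/\<^sup>2\<close> one has \<open>J = J\<^sub>+ J\<^sub>-\<close> and
  \<open>D = D\<^sub>+ D\<^sub>-\<close>, and the completion \<open>A\<^sub>+\<close> of the theorem is \<open>L\<^sup>* J\<^sub>+ L\<close> with
  \<open>L (x, y) = D\<^sub>+ x + J\<^sub>+ D\<^sub>- V\<^sup>* y\<close>.  For given \<open>y\<close> the vector \<open>L (x, y)\<close> can be made
  arbitrarily small, so the completions with minimal negative index are exactly those above \<open>A\<^sub>+\<close>.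
  The statement for \<open>A\<^sub>-\<close> is the one for \<open>- T\<^sub>1\<close>, and \<open>V J V\<^sup>* \<le> 1\<close> says that the two extremal
  extensions are ordered.  The extensions are then characterised by
  \<open>\<nu>\<^sub>- (1 - T\<^sup>2) = \<nu>\<^sub>- (1 + T) + \<nu>\<^sub>- (1 - T)\<close>.
\<close>

section \<open>Operators on complex Hilbert spaces\<close>

text \<open>Index and sign are defined by the functional calculus of a chosen spectral family, so a
  spectral theorem has to be available. In the end only one spectral object matters, the projection
  \<open>N\<close> for (-infinity, 0): its rank is the index and \<open>1 - 2 N\<close> is the sign.
  It is built directly from the modulus and recognised by signs of the quadratic form; spectral
  measures identify it with the defined notions. Indices are then compared by inertia: a linear map
  injective on a negative subspace bounds its dimension.

  Two obstacles shape the rest. A uniform constant in the domination by \<open>D\<close> needs a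
  spectral gap below 0, which finiteness of the index supplies. And \<open>D\<close> need have
  neither closed range nor trivial kernel, so the vectors at which a square would be completed
  exactly need not be attained; they are approached through \<open>D\<close>, and the error is
  absorbed by the strict excess assumed for contradiction. Keeping \<open>V\<^sup>*\<close> inside
  the closure of ran \<open>D\<close> makes the approximation possible and makes \<open>V\<close>
  vanish on ker \<open>D\<close>.\<close>

lemma cinner_scaleC_right: "cinner x (a *\<^sub>C y) = cnj a * cinner x (y :: 'a::complex_inner)"
  by (metis cinner_commute cinner_scaleC_left complex_cnj_mult)

text \<open>Recovers the complex inner product from the real one, so that adjointness and
  orthogonality can be checked on \<open>inner\<close> together with compatibility with
  \<open>\<i>\<close>.\<close>

lemma cinner_eq_Complex:
  "cinner x y = Complex (inner x y) (- inner (\<i> *\<^sub>C x) (y :: 'a::complex_inner))"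
proof -
  have "Re (cinner (\<i> *\<^sub>C x) y) = - Im (cinner x y)"
    by (simp add: cinner_scaleC_left)
  then show ?thesis
    by (simp add: complex_eq_iff Re_cinner)
qed

lemma inner_ii_ii: "inner (\<i> *\<^sub>C x) (\<i> *\<^sub>C y) = inner x (y :: 'a::complex_inner)"
proof -
  have "cinner (\<i> *\<^sub>C x) (\<i> *\<^sub>C y) = cinner x y"
    by (simp add: cinner_scaleC_left cinner_scaleC_right flip: mult.assoc)
  then show ?thesis by (metis Re_cinner)
qed

lemma scaleC_ii_ii: "\<i> *\<^sub>C \<i> *\<^sub>C x = - (x :: 'a::complex_vector)"
  using scaleC_of_real[of "-1" x] by (simp add: scaleC_scaleC)

lemma inner_ii_right: "inner x (\<i> *\<^sub>C y) = - inner (\<i> *\<^sub>C x) (y :: 'a::complex_inner)"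
  using inner_ii_ii[of x "\<i> *\<^sub>C y"] by (simp add: scaleC_ii_ii)

lemma norm_scaleC: "norm (c *\<^sub>C x) = cmod c * norm (x :: 'a::complex_inner)"
proof -
  have "cinner (c *\<^sub>C x) (c *\<^sub>C x) = (c * cnj c) * cinner x x"
    by (simp add: cinner_scaleC_left cinner_scaleC_right)
  also have "\<dots> = complex_of_real ((cmod c)\<^sup>2) * cinner x x"
    by (simp only: complex_norm_square)
  finally have "Re (cinner (c *\<^sub>C x) (c *\<^sub>C x)) = (cmod c)\<^sup>2 * Re (cinner x x)"
    by simp
  then have "inner (c *\<^sub>C x) (c *\<^sub>C x) = (cmod c)\<^sup>2 * inner x x"
    by (simp only: Re_cinner)
  then have "(norm (c *\<^sub>C x))\<^sup>2 = (cmod c * norm x)\<^sup>2"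
    by (simp add: power2_norm_eq_inner power_mult_distrib)
  then show ?thesis by (simp add: power2_eq_iff_nonneg)
qed

lemma bounded_linear_scaleC: "bounded_linear (\<lambda>x::'a::complex_inner. c *\<^sub>C x)"
proof (rule bounded_linear_intro[where K = "cmod c"])
  show "c *\<^sub>C (r *\<^sub>R x) = r *\<^sub>R c *\<^sub>C x" for r and x :: 'a
    by (metis scaleC_of_real scaleC_scaleC mult.commute)
qed (auto simp: scaleC_add_right norm_scaleC)

lemma scaleC_minus_right: "c *\<^sub>C (- x) = - (c *\<^sub>C (x :: 'a::complex_vector))"
  by (rule complex_vector.scale_minus_right)

lemma scaleC_diff_right: "c *\<^sub>C (x - y) = c *\<^sub>C x - c *\<^sub>C (y :: 'a::complex_vector)"
  by (rule complex_vector.scale_right_diff_distrib)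

lemma bounded_clinear_bounded_linear: "bounded_clinear A \<Longrightarrow> bounded_linear A"
  by (simp add: bounded_clinear_def)

lemma bounded_clinear_scaleC: "bounded_clinear A \<Longrightarrow> A (c *\<^sub>C x) = c *\<^sub>C A x"
  by (simp add: bounded_clinear_def)

lemma bounded_clinear_ident: "bounded_clinear (\<lambda>x. x)"
  by (simp add: bounded_clinear_def bounded_linear_ident)

lemma bounded_clinear_zero: "bounded_clinear (\<lambda>x. 0)"
  by (simp add: bounded_clinear_def bounded_linear_zero)

lemma bounded_clinear_compose:
  "bounded_clinear A \<Longrightarrow> bounded_clinear B \<Longrightarrow> bounded_clinear (\<lambda>x. A (B x))"
  by (simp add: bounded_clinear_def bounded_linear_compose)

lemma bounded_clinear_add:
  "bounded_clinear A \<Longrightarrow> bounded_clinear B \<Longrightarrow> bounded_clinear (\<lambda>x. A x + B x)"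
  by (simp add: bounded_clinear_def bounded_linear_add scaleC_add_right)

lemma bounded_clinear_sub:
  "bounded_clinear A \<Longrightarrow> bounded_clinear B \<Longrightarrow> bounded_clinear (\<lambda>x. A x - B x)"
  by (simp add: bounded_clinear_def bounded_linear_sub scaleC_diff_right)

lemma bounded_clinear_minus:
  "bounded_clinear A \<Longrightarrow> bounded_clinear (\<lambda>x. - A x)"
  by (simp add: bounded_clinear_def bounded_linear_minus scaleC_minus_right)

lemma bounded_clinear_scaleR:
  "bounded_clinear A \<Longrightarrow> bounded_clinear (\<lambda>x. r *\<^sub>R A x)"
  by (simp add: bounded_clinear_def bounded_linear_const_scaleR)
    (metis scaleC_of_real scaleC_scaleC mult.commute)

lemmas bounded_clinear_intros = bounded_clinear_ident bounded_clinear_zero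
  bounded_clinear_compose bounded_clinear_add bounded_clinear_sub bounded_clinear_minus
  bounded_clinear_scaleR

lemma
  assumes "bounded_clinear A"
  shows bounded_clinear_map_add: "A (x + y) = A x + A y"
    and bounded_clinear_map_diff: "A (x - y) = A x - A y"
    and bounded_clinear_map_minus: "A (- x) = - A x"
    and bounded_clinear_map_0: "A 0 = 0"
    and bounded_clinear_map_scaleR: "A (r *\<^sub>R x) = r *\<^sub>R A x"
proof -
  interpret bounded_linear A by (rule bounded_clinear_bounded_linear[OF assms])
  show "A (x + y) = A x + A y" "A (x - y) = A x - A y" "A (- x) = - A x" "A 0 = 0"
    "A (r *\<^sub>R x) = r *\<^sub>R A x"
    by (simp_all add: add diff neg zero scaleR)
qed

lemmas bounded_clinear_maps = bounded_clinear_map_add bounded_clinear_map_diff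
  bounded_clinear_map_minus bounded_clinear_map_0 bounded_clinear_map_scaleR

lemma bounded_clinearI_ii:
  assumes B: "bounded_linear B" and ii: "\<And>x. B (\<i> *\<^sub>C x) = \<i> *\<^sub>C B x"
  shows "bounded_clinear B"
proof -
  interpret B: bounded_linear B by fact
  have c: "c *\<^sub>C v = Re c *\<^sub>R v + Im c *\<^sub>R \<i> *\<^sub>C v" for c and v :: "'d::complex_vector"
  proof -
    have "c *\<^sub>C v = (complex_of_real (Re c) + complex_of_real (Im c) * \<i>) *\<^sub>C v"
      by (simp add: complex_eq_iff)
    then show ?thesis
      by (simp only: scaleC_add_left scaleC_of_real flip: scaleC_scaleC)
  qed
  have "B (c *\<^sub>C x) = c *\<^sub>C B x" for c x
    by (simp only: c[of c x] c[of c "B x"] B.add B.scaleR ii)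
  with B show ?thesis by (simp add: bounded_clinear_def)
qed

lemma bounded_clinear_cinnerI:
  assumes "bounded_clinear A" "bounded_clinear B"
    and "\<And>x y. inner (A x) y = inner x (B y)"
  shows "cinner (A x) y = cinner x (B y)"
  by (simp add: cinner_eq_Complex assms(3) flip: bounded_clinear_scaleC[OF assms(1)])

lemma selfadjoint_iff:
  "selfadjoint A \<longleftrightarrow> bounded_clinear A \<and> (\<forall>x y. inner (A x) y = inner x (A y))"
proof
  assume "selfadjoint A"
  then show "bounded_clinear A \<and> (\<forall>x y. inner (A x) y = inner x (A y))"
    unfolding selfadjoint_def by (metis Re_cinner)
next
  assume "bounded_clinear A \<and> (\<forall>x y. inner (A x) y = inner x (A y))"
  then show "selfadjoint A"
    unfolding selfadjoint_def using bounded_clinear_cinnerI by blast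
qed

lemma selfadjoint_bounded_clinear: "selfadjoint A \<Longrightarrow> bounded_clinear A"
  by (simp add: selfadjoint_def)

lemma selfadjoint_bounded_linear: "selfadjoint A \<Longrightarrow> bounded_linear A"
  by (simp add: selfadjoint_def bounded_clinear_def)

lemma selfadjoint_inner: "selfadjoint A \<Longrightarrow> inner (A x) y = inner x (A y)"
  by (simp add: selfadjoint_iff)

lemma selfadjoint_cinner_self:
  assumes "selfadjoint A"
  shows "cinner (A x) x = complex_of_real (inner (A x) x)"
proof -
  have "inner (\<i> *\<^sub>C A x) x = inner (A (\<i> *\<^sub>C x)) x"
    by (metis assms selfadjoint_bounded_clinear bounded_clinear_scaleC)
  also have "\<dots> = - inner (\<i> *\<^sub>C A x) x"
    by (metis assms inner_commute inner_ii_right selfadjoint_inner)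
  finally show ?thesis
    by (simp add: cinner_eq_Complex complex_eq_iff)
qed

lemma selfadjoint_ident: "selfadjoint (\<lambda>x. x)"
  by (simp add: selfadjoint_iff bounded_clinear_ident)

lemma selfadjoint_zero: "selfadjoint (\<lambda>x. 0)"
  by (simp add: selfadjoint_iff bounded_clinear_zero)

lemma selfadjoint_add:
  "selfadjoint A \<Longrightarrow> selfadjoint B \<Longrightarrow> selfadjoint (\<lambda>x. A x + B x)"
  by (simp add: selfadjoint_iff bounded_clinear_add inner_add_left inner_add_right)

lemma selfadjoint_sub:
  "selfadjoint A \<Longrightarrow> selfadjoint B \<Longrightarrow> selfadjoint (\<lambda>x. A x - B x)"
  by (simp add: selfadjoint_iff bounded_clinear_sub inner_diff_left inner_diff_right)

lemma selfadjoint_minus: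
  "selfadjoint A \<Longrightarrow> selfadjoint (\<lambda>x. - A x)"
  by (simp add: selfadjoint_iff bounded_clinear_minus)

lemma selfadjoint_scaleR:
  "selfadjoint A \<Longrightarrow> selfadjoint (\<lambda>x. r *\<^sub>R A x)"
  by (simp add: selfadjoint_iff bounded_clinear_scaleR)

lemma selfadjoint_square:
  "selfadjoint A \<Longrightarrow> selfadjoint (\<lambda>x. A (A x))"
  by (simp add: selfadjoint_iff bounded_clinear_compose)

lemmas selfadjoint_intros = selfadjoint_ident selfadjoint_zero selfadjoint_add selfadjoint_sub
  selfadjoint_minus selfadjoint_scaleR selfadjoint_square

lemma selfadjoint_compose:
  assumes "selfadjoint A" "selfadjoint B" "\<And>x. A (B x) = B (A x)"
  shows "selfadjoint (\<lambda>x. A (B x))"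
  using assms by (simp add: selfadjoint_iff bounded_clinear_compose)

text \<open>Fails on real spaces: a rotation by a right angle has zero quadratic form.\<close>

lemma bounded_clinear_eq_0_if_form_0:
  assumes C: "bounded_clinear C" and z: "\<And>x. cinner (C x) x = 0"
  shows "C x = 0"
proof -
  have 1: "inner (C x) y + inner (C y) x = 0" for x y
  proof -
    have "inner (C u) u = 0" for u
      using z[of u] by (metis Re_cinner zero_complex.sel(1))
    from this[of "x + y"] this[of x] this[of y] show ?thesis
      by (simp add: bounded_clinear_map_add[OF C] inner_add_left inner_add_right)
  qed
  have 2: "inner (\<i> *\<^sub>C C x) y + inner (\<i> *\<^sub>C C y) x = 0" for x y
  proof -
    have "inner (\<i> *\<^sub>C C u) u = 0" for u
      using z[of u] by (simp add: cinner_eq_Complex complex_eq_iff)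
    from this[of "x + y"] this[of x] this[of y] show ?thesis
      by (simp add: bounded_clinear_map_add[OF C] inner_add_left inner_add_right scaleC_add_right)
  qed
  \<comment> \<open>The real-part identity taken at \<open>\<i> x\<close> and the imaginary-part
    identity differ only in the sign of their second term, which cancels on adding.\<close>
  have "inner (\<i> *\<^sub>C C x) y = 0" for x y
    using 1[of "\<i> *\<^sub>C x" y] 2[of x y]
    by (simp add: bounded_clinear_scaleC[OF C] inner_ii_right)
  then have "\<i> *\<^sub>C C x = 0" by (metis inner_eq_zero_iff)
  then show ?thesis by simp
qed

lemma bounded_clinear_eqI_form:
  assumes "bounded_clinear A" "bounded_clinear B" and "\<And>x. cinner (A x) x = cinner (B x) x"
  shows "A = B"
proof
  fix x
  have "cinner (A x - B x) x = 0" for x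
    using cinner_add_left[of "A x - B x" "B x" x] assms(3) by simp
  from bounded_clinear_eq_0_if_form_0[OF bounded_clinear_sub[OF assms(1,2)] this, of x]
  show "A x = B x" by simp
qed

lemma selfadjoint_eqI_form:
  assumes "selfadjoint A" "selfadjoint B" and "\<And>x. inner (A x) x = inner (B x) x"
  shows "A = B"
  using assms by (intro bounded_clinear_eqI_form)
    (simp_all add: selfadjoint_bounded_clinear selfadjoint_cinner_self)

lemma op_le_iff: "op_le A B \<longleftrightarrow> (\<forall>x. inner (A x) x \<le> inner (B x) x)"
  by (simp add: op_le_def Re_cinner)

lemma op_le_antisym:
  "op_le A B \<Longrightarrow> op_le B A \<Longrightarrow> selfadjoint A \<Longrightarrow> selfadjoint B \<Longrightarrow> A = B"
  by (rule selfadjoint_eqI_form) (auto simp: op_le_iff intro: antisym)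


section \<open>Minimisation and adjoints\<close>

lemma discriminant_le_if_nonneg:
  fixes a b c :: real
  assumes nonneg: "\<And>t. 0 \<le> a + 2 * t * b + t\<^sup>2 * c"
  shows "b\<^sup>2 \<le> a * c"
proof (cases "c = 0")
  case True
  have "b = 0"
  proof (rule ccontr)
    assume "b \<noteq> 0"
    then show False
      \<comment> \<open>With c = 0 this value of \<open>t\<close> makes the affine expression equal
        to -1.\<close>
      using nonneg[of "- (a + 1) / (2 * b)"] True by (simp add: field_simps)
  qed
  then show ?thesis using True by simp
next
  case False
  have "0 \<le> c"
  proof (rule ccontr)
    assume "\<not> 0 \<le> c"
    then have c: "c < 0" by simp
    \<comment> \<open>Chosen so that t |c| = |c| + |a| + 2 |b|: multiplied by t \<ge> 1, the
      quadratic term then outweighs the other two.\<close>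
    define t where "t = 1 + \<bar>a\<bar> / \<bar>c\<bar> + 2 * \<bar>b\<bar> / \<bar>c\<bar>"
    have t: "1 \<le> t" by (simp add: t_def)
    have ct: "\<bar>c\<bar> * t = \<bar>c\<bar> + \<bar>a\<bar> + 2 * \<bar>b\<bar>"
      using False by (simp add: t_def field_simps)
    have "t\<^sup>2 * \<bar>c\<bar> = t * (\<bar>c\<bar> + \<bar>a\<bar> + 2 * \<bar>b\<bar>)"
      unfolding ct[symmetric] by (simp add: power2_eq_square)
    also have "\<dots> \<ge> \<bar>c\<bar> + \<bar>a\<bar> + 2 * t * \<bar>b\<bar>"
      using mult_right_mono[OF t, of "\<bar>c\<bar> + \<bar>a\<bar>"] by (simp add: algebra_simps)
    finally have "\<bar>c\<bar> + \<bar>a\<bar> + 2 * t * \<bar>b\<bar> \<le> t\<^sup>2 * \<bar>c\<bar>" .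
    moreover have "2 * t * b \<le> 2 * t * \<bar>b\<bar>"
      using t by (intro mult_left_mono) auto
    moreover have "t\<^sup>2 * \<bar>c\<bar> = - (t\<^sup>2 * c)" using c by simp
    ultimately have "a + 2 * t * b + t\<^sup>2 * c < 0"
      using c by linarith
    then show False using nonneg[of t] by simp
  qed
  then have "0 < c" using False by simp
  then show ?thesis
    using nonneg[of "- b / c"] by (simp add: field_simps power2_eq_square)
qed

text \<open>
  Minimising \<open>\<parallel>L x\<parallel>\<^sup>2 - 2 f x\<close>. Special cases are the Riesz representation theorem, the orthogonal
  projection onto the closure of \<open>range L\<close>, and factorisations through \<open>L\<close>.
\<close>

lemma functional_through_range:
  fixes L :: "'c::real_vector \<Rightarrow> 'a::{real_inner,complete_space}" and f :: "'c \<Rightarrow> real"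
  assumes L: "linear L" and f: "linear f" and b: "\<And>x. \<bar>f x\<bar> \<le> c * norm (L x)"
  shows "\<exists>w\<in>closure (range L). \<forall>x. inner w (L x) = f x"
proof -
  define F where "F x = (norm (L x))\<^sup>2 - 2 * f x" for x
  have F_lower: "- c\<^sup>2 \<le> F x" for x
  proof -
    have "0 \<le> (norm (L x) - c)\<^sup>2" by simp
    then show ?thesis
      using b[of x] unfolding F_def power2_diff by (simp add: algebra_simps)
  qed
  define m where "m = Inf (range F)"
  have bdd: "bdd_below (range F)" using F_lower by (meson bdd_belowI2)
  have m_le: "m \<le> F x" for x
    unfolding m_def by (rule cInf_lower[OF _ bdd]) simp
  have "\<exists>x. F x < m + 1 / real (Suc n)" for n
    using cInf_lessD[of "range F" "m + 1 / real (Suc n)"] unfolding m_def by auto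
  then obtain X where X: "\<And>n. F (X n) < m + 1 / real (Suc n)" by metis
  \<comment> \<open>Parallelogram law: the linear terms cancel at the midpoint, so near-minimisers
    have nearby images. Only \<open>L (X n)\<close> is claimed to converge, since \<open>X n\<close>
    itself need not.\<close>
  have par: "(norm (L x - L y))\<^sup>2 = 2 * F x + 2 * F y - 4 * F ((1/2) *\<^sub>R (x + y))" for x y
    by (simp add: F_def linear_scale[OF L] linear_scale[OF f] linear_add[OF L] linear_add[OF f]
        power2_norm_eq_inner inner_add_left inner_add_right inner_diff_left inner_diff_right
        inner_commute algebra_simps)
  have close: "(norm (L (X n) - L (X k)))\<^sup>2 \<le> 2 / real (Suc n) + 2 / real (Suc k)" for n k
    using par[of "X n" "X k"] m_le[of "(1/2) *\<^sub>R (X n + X k)"] X[of n] X[of k] by simp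
  have "Cauchy (\<lambda>n. L (X n))"
  proof (rule metric_CauchyI)
    fix e :: real assume e: "0 < e"
    obtain N where N: "4 / e\<^sup>2 < real N" using reals_Archimedean2 by blast
    have "dist (L (X n)) (L (X k)) < e" if "n \<ge> N" "k \<ge> N" for n k
    proof -
      have Npos: "0 < real N" using N e by (smt (verit) divide_pos_pos zero_less_power)
      have "2 / real (Suc n) \<le> 2 / real (Suc N)" "2 / real (Suc k) \<le> 2 / real (Suc N)"
        using that by (simp_all add: frac_le)
      moreover have "4 / real (Suc N) < e\<^sup>2"
        using N e Npos by (simp add: field_simps) (smt (verit) zero_less_power)
      ultimately have "(norm (L (X n) - L (X k)))\<^sup>2 < e\<^sup>2" using close[of n k] by simp
      then show ?thesis unfolding dist_norm by (rule power2_less_imp_less) (use e in simp)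
    qed
    then show "\<exists>M. \<forall>m\<ge>M. \<forall>n\<ge>M. dist (L (X m)) (L (X n)) < e" by blast
  qed
  then obtain w where w: "(\<lambda>n. L (X n)) \<longlonglongrightarrow> w"
    using convergent_eq_Cauchy by blast
  have wcl: "w \<in> closure (range L)"
    unfolding closure_sequential by (rule exI[of _ "\<lambda>n. L (X n)"]) (use w in auto)
  have FX: "(\<lambda>n. F (X n)) \<longlonglongrightarrow> m"
  proof (rule tendsto_sandwich[OF _ _ tendsto_const])
    show "(\<lambda>n. m + 1 / real (Suc n)) \<longlonglongrightarrow> m"
      using tendsto_add[OF tendsto_const[of m] LIMSEQ_inverse_real_of_nat]
      by (simp add: inverse_eq_divide)
  qed (use m_le X in \<open>auto intro!: always_eventually less_imp_le\<close>)
  have "inner w (L v) = f v" for v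
  proof -
    define d where "d = inner w (L v) - f v"
    define q where "q = (norm (L v))\<^sup>2"
    \<comment> \<open>First variation: \<open>X n\<close> is compared with its shift by
      \<open>t v\<close> and \<open>n\<close> tends to infinity. An expression without constant term
      that is nonnegative for all real t has no linear term.\<close>
    have ineq: "0 \<le> 2 * t * d + t\<^sup>2 * q" for t
    proof -
      have "m \<le> F (X n) + 2 * t * (inner (L (X n)) (L v) - f v) + t\<^sup>2 * q" for n
      proof -
        have "F (X n + t *\<^sub>R v) = F (X n) + 2 * t * (inner (L (X n)) (L v) - f v) + t\<^sup>2 * q"
          unfolding F_def q_def power2_norm_eq_inner
          by (simp add: linear_scale[OF L] linear_scale[OF f] linear_add[OF L]
              linear_add[OF f] inner_add_left inner_add_right inner_commute[of "L v" "L (X n)"]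
              algebra_simps power2_eq_square)
        then show ?thesis using m_le[of "X n + t *\<^sub>R v"] by simp
      qed
      moreover have "(\<lambda>n. F (X n) + 2 * t * (inner (L (X n)) (L v) - f v) + t\<^sup>2 * q)
          \<longlonglongrightarrow> m + 2 * t * d + t\<^sup>2 * q"
        unfolding d_def by (intro tendsto_intros FX w)
      ultimately have "m \<le> m + 2 * t * d + t\<^sup>2 * q"
        by (meson LIMSEQ_le_const)
      then show ?thesis by simp
    qed
    then have "d\<^sup>2 \<le> 0 * q"
      by (intro discriminant_le_if_nonneg) simp
    then show ?thesis by (simp add: d_def)
  qed
  with wcl show ?thesis by blast
qed

text \<open>The difference is orthogonal to the closure of the range, hence to both vectors and to
  itself. This is the uniqueness that goes with \<open>functional_through_range\<close>.\<close>

lemma inner_closure_eqI: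
  fixes w w' :: "'a::real_inner"
  assumes "w \<in> closure (range L)" "w' \<in> closure (range L)"
    and "\<And>x. inner w (L x) = inner w' (L x)"
  shows "w = w'"
proof -
  have "closed {v. inner (w - w') v = 0}"
    by (rule closed_hyperplane)
  then have "closure (range L) \<subseteq> {v. inner (w - w') v = 0}"
    using assms(3) by (intro closure_minimal) (auto simp: inner_diff_left)
  then have "inner (w - w') w = 0" "inner (w - w') w' = 0" using assms(1,2) by blast+
  then have "inner (w - w') (w - w') = 0" by (simp add: inner_diff_right)
  then show ?thesis by simp
qed

lemma bounded_clinear_adjoint_exists:
  assumes A: "bounded_clinear (A :: 'a::complex_hilbert \<Rightarrow> 'b::complex_hilbert)"
  shows "\<exists>B. bounded_clinear B \<and> (\<forall>x y. cinner (A x) y = cinner x (B y))"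
proof -
  interpret A: bounded_linear A by (rule bounded_clinear_bounded_linear[OF A])
  obtain K where K: "\<And>x. norm (A x) \<le> norm x * K" "K > 0" using A.pos_bounded by blast
  have "\<exists>w. \<forall>x. inner (A x) y = inner x w" for y
  proof -
    have "\<exists>w\<in>closure (range (\<lambda>x::'a. x)). \<forall>x. inner w x = inner (A x) y"
    proof (rule functional_through_range[where c = "K * norm y"])
      show "linear (\<lambda>x. inner (A x) y)"
        by (rule linearI) (simp_all add: A.add A.scaleR inner_add_left)
      show "\<bar>inner (A x) y\<bar> \<le> K * norm y * norm x" for x
        using Cauchy_Schwarz_ineq2[of "A x" y] mult_right_mono[OF K(1)[of x], of "norm y"]
        by (simp add: mult_ac)
    qed (simp add: linear_id[unfolded id_def])
    then show ?thesis by (metis inner_commute)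
  qed
  then obtain B where B: "\<And>x y. inner (A x) y = inner x (B y)" by metis
  have eqI: "u = v" if "\<And>x. inner x u = inner x v" for u v :: 'a
    using that[of "u - v"] by (metis inner_eq_zero_iff inner_diff_right right_minus_eq)
  have "bounded_linear B"
  proof (rule bounded_linear_intro[where K = K])
    show "B (x + y) = B x + B y" for x y
      by (rule eqI) (simp add: inner_add_right flip: B)
    show "B (r *\<^sub>R x) = r *\<^sub>R B x" for r x
      by (rule eqI) (simp flip: B)
    show "norm (B y) \<le> norm y * K" for y
    proof (cases "B y = 0")
      case False
      have "(norm (B y))\<^sup>2 = inner (A (B y)) y" by (simp add: B power2_norm_eq_inner)
      also have "\<dots> \<le> norm (A (B y)) * norm y" by (rule norm_cauchy_schwarz)
      also have "\<dots> \<le> norm (B y) * K * norm y" by (simp add: K(1) mult_right_mono)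
      finally show ?thesis using False by (simp add: power2_eq_square mult_ac)
    qed (use K in simp)
  qed
  moreover have "B (\<i> *\<^sub>C y) = \<i> *\<^sub>C B y" for y
    by (rule eqI) (simp add: inner_ii_right bounded_clinear_scaleC[OF A] flip: B)
  ultimately have "bounded_clinear B" by (rule bounded_clinearI_ii)
  then show ?thesis
    using bounded_clinear_cinnerI[OF A _ B] by blast
qed

lemma cadjoint_eqI:
  assumes "\<And>x y. cinner (A x) y = cinner x (B y)"
  shows "cadjoint A = B"
  unfolding cadjoint_def
proof (rule the_equality)
  fix C assume C: "\<forall>x y. cinner (A x) y = cinner x (C y)"
  show "C = B"
  proof
    fix y
    have "inner x (C y) = inner x (B y)" for x
      using C assms by (metis Re_cinner)
    from this[of "C y - B y"] show "C y = B y"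
      by (metis inner_eq_zero_iff inner_diff_right right_minus_eq)
  qed
qed (use assms in blast)

lemma
  assumes A: "bounded_clinear A"
  shows bounded_clinear_cadjoint: "bounded_clinear (cadjoint A)"
    and cinner_cadjoint: "cinner (A x) y = cinner x (cadjoint A y)"
  using bounded_clinear_adjoint_exists[OF A] cadjoint_eqI by metis+

lemma inner_cadjoint: "bounded_clinear A \<Longrightarrow> inner (A x) y = inner x (cadjoint A y)"
  by (metis cinner_cadjoint Re_cinner)

lemma cadjoint_eqI_inner:
  assumes "bounded_clinear A" "bounded_clinear B" "\<And>x y. inner (A x) y = inner x (B y)"
  shows "cadjoint A = B"
  using bounded_clinear_cinnerI[OF assms] by (rule cadjoint_eqI)

text \<open>Then \<open>u = w + (u - w)\<close> splits \<open>u\<close> along \<open>clos (ran C) \<oplus> ker C\<close>.\<close>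

lemma range_kernel_decomposition:
  assumes C: "selfadjoint C"
  shows "\<exists>w. w \<in> closure (range C) \<and> C w = C u"
proof -
  interpret C: bounded_linear C by (rule selfadjoint_bounded_linear[OF C])
  have "\<exists>w\<in>closure (range C). \<forall>x. inner w (C x) = inner u (C x)"
  proof (rule functional_through_range[where c = "norm u"])
    show "linear (\<lambda>x. inner u (C x))"
      by (rule linearI) (simp_all add: C.add C.scaleR inner_add_right)
    show "\<bar>inner u (C x)\<bar> \<le> norm u * norm (C x)" for x
      by (rule Cauchy_Schwarz_ineq2)
  qed (rule C.linear_axioms)
  then obtain w where w: "w \<in> closure (range C)" "\<And>x. inner w (C x) = inner u (C x)" by blast
  have "inner (C w) x = inner (C u) x" for x
    using w(2) by (simp add: selfadjoint_inner[OF C])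
  from this[of "C w - C u"] have "C w = C u"
    by (metis inner_eq_zero_iff inner_commute inner_diff_right right_minus_eq)
  with w(1) show ?thesis by blast
qed

lemma range_orthogonal_kernel:
  assumes C: "selfadjoint C" and w: "w \<in> closure (range C)" and z: "C z = 0"
  shows "inner w z = 0"
proof -
  have "closed {v. inner z v = 0}" by (rule closed_hyperplane)
  then have "closure (range C) \<subseteq> {v. inner z v = 0}"
    by (rule closure_minimal[rotated]) (auto simp: z selfadjoint_inner[OF C, symmetric])
  then show ?thesis using w by (auto simp: inner_commute)
qed

section \<open>Positive operators and their square roots\<close>

definition positive :: "('a::complex_hilbert \<Rightarrow> 'a) \<Rightarrow> bool"
  where "positive A \<longleftrightarrow> selfadjoint A \<and> (\<forall>x. 0 \<le> inner (A x) x)"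

lemma positive_selfadjoint: "positive A \<Longrightarrow> selfadjoint A"
  by (simp add: positive_def)

lemma positive_form: "positive A \<Longrightarrow> 0 \<le> inner (A x) x"
  by (simp add: positive_def)

lemma positive_square: "selfadjoint A \<Longrightarrow> positive (\<lambda>x. A (A x))"
  by (simp add: positive_def selfadjoint_square) (metis inner_ge_zero selfadjoint_inner)

lemma positive_Cauchy_Schwarz:
  assumes "positive A"
  shows "(inner (A x) y)\<^sup>2 \<le> inner (A x) x * inner (A y) y"
proof -
  interpret bounded_linear A
    by (rule selfadjoint_bounded_linear[OF positive_selfadjoint[OF assms]])
  have sym: "inner (A y) x = inner (A x) y"
    by (metis assms inner_commute positive_selfadjoint selfadjoint_inner)
  show ?thesis
  proof (rule discriminant_le_if_nonneg)
    fix t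
    have "0 \<le> inner (A (x + t *\<^sub>R y)) (x + t *\<^sub>R y)"
      by (rule positive_form[OF assms])
    then show "0 \<le> inner (A x) x + 2 * t * inner (A x) y + t\<^sup>2 * inner (A y) y"
      by (simp add: add scaleR inner_add_left inner_add_right sym power2_eq_square algebra_simps)
  qed
qed

text \<open>Cauchy-Schwarz for the form of \<open>A\<close> at \<open>x\<close> and
  \<open>A x\<close>, after cancelling one factor (norm (A x))^2. It turns a bound on the form into
  a bound on the operator.\<close>

lemma positive_norm_le:
  assumes A: "positive A" and K: "\<And>u. inner (A u) u \<le> K * (norm u)\<^sup>2"
  shows "(norm (A x))\<^sup>2 \<le> K * inner (A x) x"
proof (cases "A x = 0")
  case False
  have "(norm (A x))\<^sup>2 * (norm (A x))\<^sup>2 \<le> inner (A x) x * inner (A (A x)) (A x)"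
    unfolding power2_norm_eq_inner using positive_Cauchy_Schwarz[OF A, of x "A x"]
    by (simp only: power2_eq_square)
  also have "\<dots> \<le> inner (A x) x * (K * (norm (A x))\<^sup>2)"
    by (rule mult_left_mono[OF K positive_form[OF A]])
  finally have "(norm (A x))\<^sup>2 * (norm (A x))\<^sup>2 \<le> (K * inner (A x) x) * (norm (A x))\<^sup>2"
    by (simp only: mult_ac)
  then show ?thesis
    by (rule mult_right_le_imp_le) (simp add: False)
qed simp

lemma positive_eq_0_if_form_0:
  assumes "positive A" "inner (A x) x = 0"
  shows "A x = 0"
  using positive_Cauchy_Schwarz[OF assms(1), of x "A x"] assms(2) by simp

text \<open>
  With \<open>C = 1 - A\<close> the fixed points \<open>Y = (C + Y\<^sup>2) / 2\<close> are the solutions of \<open>(1 - Y)\<^sup>2 = A\<close>.  The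
  same iteration for the scalar \<open>1\<close> dominates the increments in norm.
\<close>

primrec sqrt_iter :: "('a::real_normed_vector \<Rightarrow>\<^sub>L 'a) \<Rightarrow> nat \<Rightarrow> 'a \<Rightarrow>\<^sub>L 'a" where
  "sqrt_iter C 0 = 0"
| "sqrt_iter C (Suc n) = (1/2) *\<^sub>R (C + (sqrt_iter C n o\<^sub>L sqrt_iter C n))"

primrec sqrt_iter_bound :: "nat \<Rightarrow> real" where
  "sqrt_iter_bound 0 = 0"
| "sqrt_iter_bound (Suc n) = (1 + (sqrt_iter_bound n)\<^sup>2) / 2"

lemma sqrt_iter_bound_le: "0 \<le> sqrt_iter_bound n \<and> sqrt_iter_bound n \<le> 1"
proof (induction n)
  case (Suc n)
  then have "(sqrt_iter_bound n)\<^sup>2 \<le> 1" by (simp add: power_le_one)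
  then show ?case by simp
qed simp

lemma incseq_sqrt_iter_bound: "incseq sqrt_iter_bound"
proof (rule incseq_SucI)
  fix n
  have "0 \<le> (1 - sqrt_iter_bound n)\<^sup>2" by simp
  then show "sqrt_iter_bound n \<le> sqrt_iter_bound (Suc n)" by (simp add: power2_diff)
qed

text \<open>Every iterate is a polynomial in \<open>C\<close>. Used with \<open>Z = C\<close> to
  make the iterates commute with each other, and with general \<open>Z\<close> for the commutation
  property of the limit.\<close>

lemma sqrt_iter_commute:
  assumes "Z o\<^sub>L C = C o\<^sub>L Z"
  shows "Z o\<^sub>L sqrt_iter C n = sqrt_iter C n o\<^sub>L Z"
proof (induction n)
  case (Suc n)
  have C: "Z (C x) = C (Z x)" for x
    using assms by (metis blinfun_apply_blinfun_compose)
  have Y: "Z (sqrt_iter C n x) = sqrt_iter C n (Z x)" for x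
    using Suc by (metis blinfun_apply_blinfun_compose)
  show ?case
    by (rule blinfun_eqI) (simp add: blinfun.bilinear_simps C Y)
qed simp

lemma sqrt_iter_norm:
  assumes "norm C \<le> 1"
  shows "norm (sqrt_iter C n) \<le> sqrt_iter_bound n"
proof (induction n)
  case (Suc n)
  have "norm (sqrt_iter C n o\<^sub>L sqrt_iter C n) \<le> norm (sqrt_iter C n) * norm (sqrt_iter C n)"
    by (rule norm_blinfun_compose)
  also have "\<dots> \<le> (sqrt_iter_bound n)\<^sup>2"
    unfolding power2_eq_square by (intro mult_mono Suc) (use sqrt_iter_bound_le in auto)
  finally have "norm (C + (sqrt_iter C n o\<^sub>L sqrt_iter C n)) \<le> 1 + (sqrt_iter_bound n)\<^sup>2"
    using assms norm_triangle_ineq[of C "sqrt_iter C n o\<^sub>L sqrt_iter C n"] by linarith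
  then show ?case by simp
qed simp

lemma sqrt_iter_step:
  assumes C: "norm C \<le> 1"
  shows "norm (sqrt_iter C (Suc n) - sqrt_iter C n) \<le> sqrt_iter_bound (Suc n) - sqrt_iter_bound n"
proof (induction n)
  case 0
  then show ?case using C by simp
next
  case (Suc n)
  define Y Y' where "Y = sqrt_iter C n" and "Y' = sqrt_iter C (Suc n)"
  define b b' where "b = sqrt_iter_bound n" and "b' = sqrt_iter_bound (Suc n)"
  have "Y o\<^sub>L Y' = Y' o\<^sub>L Y"
    unfolding Y_def Y'_def
    by (rule sqrt_iter_commute, rule sqrt_iter_commute[where C = C and Z = C, symmetric]) (rule refl)
  then have comm: "Y (Y' x) = Y' (Y x)" for x
    by (metis blinfun_apply_blinfun_compose)
  \<comment> \<open>A difference of squares, which factors because consecutive iterates commute. The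
    scalar bounds satisfy the same identity, so the domination is inherited.\<close>
  have "sqrt_iter C (Suc (Suc n)) - sqrt_iter C (Suc n)
      = (1/2) *\<^sub>R (C + (Y' o\<^sub>L Y')) - (1/2) *\<^sub>R (C + (Y o\<^sub>L Y))"
    by (simp only: sqrt_iter.simps(2) Y_def Y'_def)
  also have "\<dots> = (1/2) *\<^sub>R ((Y' + Y) o\<^sub>L (Y' - Y))"
    by (rule blinfun_eqI)
      (simp add: blinfun.bilinear_simps comm scaleR_add_right scaleR_diff_right)
  finally have eq: "sqrt_iter C (Suc (Suc n)) - sqrt_iter C (Suc n)
      = (1/2) *\<^sub>R ((Y' + Y) o\<^sub>L (Y' - Y))" .
  have "norm ((Y' + Y) o\<^sub>L (Y' - Y)) \<le> norm (Y' + Y) * norm (Y' - Y)"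
    by (rule norm_blinfun_compose)
  also have "\<dots> \<le> (b' + b) * (b' - b)"
  proof (rule mult_mono)
    show "norm (Y' + Y) \<le> b' + b"
      unfolding Y_def Y'_def b_def b'_def by (intro norm_triangle_mono sqrt_iter_norm C)
    show "norm (Y' - Y) \<le> b' - b"
      unfolding Y_def Y'_def b_def b'_def by (rule Suc)
    show "0 \<le> b' + b" unfolding b_def b'_def using sqrt_iter_bound_le by (meson add_nonneg_nonneg)
  qed simp
  also have "\<dots> = 2 * (sqrt_iter_bound (Suc (Suc n)) - sqrt_iter_bound (Suc n))"
  proof -
    have "b' = (1 + b\<^sup>2) / 2" "sqrt_iter_bound (Suc (Suc n)) = (1 + b'\<^sup>2) / 2"
      by (simp_all only: b_def b'_def sqrt_iter_bound.simps(2))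
    then show ?thesis
      unfolding b'_def[symmetric] by (simp add: power2_eq_square field_simps)
  qed
  finally have "norm ((Y' + Y) o\<^sub>L (Y' - Y))
      \<le> 2 * (sqrt_iter_bound (Suc (Suc n)) - sqrt_iter_bound (Suc n))" .
  then show ?case unfolding eq by (simp del: sqrt_iter_bound.simps)
qed

lemma sqrt_iter_dist:
  assumes C: "norm C \<le> 1"
  shows "norm (sqrt_iter C (n + k) - sqrt_iter C n) \<le> sqrt_iter_bound (n + k) - sqrt_iter_bound n"
proof (induction k)
  case (Suc k)
  have "norm (sqrt_iter C (n + Suc k) - sqrt_iter C n)
      \<le> norm (sqrt_iter C (Suc (n + k)) - sqrt_iter C (n + k))
        + norm (sqrt_iter C (n + k) - sqrt_iter C n)"
    using norm_triangle_ineq[of "sqrt_iter C (Suc (n + k)) - sqrt_iter C (n + k)"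
        "sqrt_iter C (n + k) - sqrt_iter C n"] by simp
  then show ?case
    using Suc sqrt_iter_step[OF C, of "n + k"] by (simp del: sqrt_iter.simps sqrt_iter_bound.simps)
qed simp

lemma sqrt_iter_convergent:
  assumes C: "norm (C :: 'a::banach \<Rightarrow>\<^sub>L 'a) \<le> 1"
  shows "convergent (sqrt_iter C)"
proof -
  obtain l where "sqrt_iter_bound \<longlonglongrightarrow> l"
    using incseq_convergent[OF incseq_sqrt_iter_bound, of 1] sqrt_iter_bound_le by blast
  then have Cb: "Cauchy sqrt_iter_bound" by (rule LIMSEQ_imp_Cauchy)
  have "Cauchy (sqrt_iter C)"
  proof (rule CauchyI')
    fix e :: real assume "0 < e"
    then obtain M where M: "\<And>m n. m \<ge> M \<Longrightarrow> n \<ge> M \<Longrightarrow> norm (sqrt_iter_bound m - sqrt_iter_bound n) < e"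
      using Cb CauchyD by blast
    have "norm (sqrt_iter C n - sqrt_iter C m) < e" if "n \<ge> M" "n < m" for m n
    proof -
      have "norm (sqrt_iter C n - sqrt_iter C m) \<le> sqrt_iter_bound m - sqrt_iter_bound n"
        using sqrt_iter_dist[OF C, of n "m - n"] that by (simp add: norm_minus_commute)
      also have "\<dots> < e" using M[of m n] that by simp
      finally show ?thesis .
    qed
    then show "\<exists>M. \<forall>n\<ge>M. \<forall>m>n. dist (sqrt_iter C n) (sqrt_iter C m) < e"
      unfolding dist_norm by blast
  qed
  then show ?thesis by (simp add: Cauchy_convergent_iff)
qed

lemma contraction_if_form_le:
  assumes "positive C" "\<And>x. inner (C x) x \<le> (norm x)\<^sup>2"
  shows "norm (C x) \<le> norm x"
proof -
  have "(norm (C x))\<^sup>2 \<le> 1 * inner (C x) x"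
    by (rule positive_norm_le[OF assms(1)]) (simp add: assms(2))
  also have "\<dots> \<le> (norm x)\<^sup>2" using assms(2) by simp
  finally show ?thesis by (rule power2_le_imp_le) simp
qed

section \<open>Existence, uniqueness and commutation of positive square roots\<close>

instance complex_hilbert \<subseteq> banach ..

text \<open>The commutation clause is part of the notion because uniqueness rests on it: a second
  root commutes with its own square \<open>A\<close>, hence with \<open>B\<close>. It also makes the
  roots of commuting operators commute.\<close>

definition is_sqrt :: "('a::complex_hilbert \<Rightarrow> 'a) \<Rightarrow> ('a \<Rightarrow> 'a) \<Rightarrow> bool" where
  "is_sqrt A B \<longleftrightarrow> positive B \<and> (\<forall>x. B (B x) = A x) \<and>
    (\<forall>Z. bounded_linear Z \<longrightarrow> (\<forall>x. Z (A x) = A (Z x)) \<longrightarrow> (\<forall>x. Z (B x) = B (Z x)))"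

lemma is_sqrt_exists_contraction:
  assumes A: "positive A" and le: "\<And>x. inner (A x) x \<le> (norm x)\<^sup>2"
  shows "\<exists>B. is_sqrt A B"
proof -
  define C' where "C' = (\<lambda>x. x - A x)"
  have C': "positive C'"
    unfolding positive_def C'_def
    using le by (simp add: inner_diff_left power2_norm_eq_inner
        selfadjoint_sub[OF selfadjoint_ident positive_selfadjoint[OF A]])
  have C'_norm: "norm (C' x) \<le> norm x" for x
  proof (rule contraction_if_form_le[OF C'])
    show "inner (C' x) x \<le> (norm x)\<^sup>2" for x
      using positive_form[OF A, of x] by (simp add: C'_def inner_diff_left power2_norm_eq_inner)
  qed
  have blC': "bounded_linear C'"
    by (rule selfadjoint_bounded_linear[OF positive_selfadjoint[OF C']])
  define C where "C = Blinfun C'"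
  have C_apply: "blinfun_apply C = C'"
    unfolding C_def by (rule bounded_linear_Blinfun_apply[OF blC'])
  have C: "norm C \<le> 1"
    by (rule norm_blinfun_bound) (simp_all add: C_apply C'_norm)
  obtain Y where Y: "sqrt_iter C \<longlonglongrightarrow> Y"
    using sqrt_iter_convergent[OF C] by (auto simp: convergent_def)
  note tendsto_comp = bounded_bilinear.tendsto[OF bounded_bilinear_blinfun_compose]
  have lim: "(\<lambda>n. sqrt_iter C n x) \<longlonglongrightarrow> Y x" for x
    by (intro blinfun.tendsto Y tendsto_const)
  have "(\<lambda>n. sqrt_iter C (Suc n)) \<longlonglongrightarrow> (1/2) *\<^sub>R (C + (Y o\<^sub>L Y))"
    unfolding sqrt_iter.simps by (intro tendsto_intros tendsto_comp Y)
  then have fp: "Y = (1/2) *\<^sub>R (C + (Y o\<^sub>L Y))"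
    using Y LIMSEQ_Suc LIMSEQ_unique by blast
  have fp_apply: "2 *\<^sub>R Y x = C' x + Y (Y x)" for x
  proof -
    have "2 *\<^sub>R Y x = 2 *\<^sub>R ((1/2) *\<^sub>R (C + (Y o\<^sub>L Y))) x"
      by (rule arg_cong[OF fp, of "\<lambda>b. 2 *\<^sub>R blinfun_apply b x"])
    also have "\<dots> = C' x + Y (Y x)" by (simp add: blinfun.bilinear_simps C_apply)
    finally show ?thesis .
  qed
  have Y_norm: "norm (Y x) \<le> norm x" for x
  proof (rule Lim_bounded[OF tendsto_norm[OF lim]])
    show "\<forall>n\<ge>0. norm (sqrt_iter C n x) \<le> norm x"
    proof (intro allI impI)
      fix n
      have "norm (sqrt_iter C n x) \<le> norm (sqrt_iter C n) * norm x" by (rule norm_blinfun)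
      also have "\<dots> \<le> 1 * norm x"
        using sqrt_iter_norm[OF C, of n] sqrt_iter_bound_le[of n]
        by (intro mult_right_mono) auto
      finally show "norm (sqrt_iter C n x) \<le> norm x" by simp
    qed
  qed
  have Y_sym: "inner (Y x) y = inner x (Y y)" for x y
  proof -
    have "inner (sqrt_iter C n x) y = inner x (sqrt_iter C n y)" for n x y
    proof (induction n arbitrary: x y)
      case (Suc n)
      then show ?case
        by (simp add: blinfun.bilinear_simps C_apply inner_add_left inner_add_right
            selfadjoint_inner[OF positive_selfadjoint[OF C']])
    qed simp
    then have "(\<lambda>n. inner (sqrt_iter C n x) y) \<longlonglongrightarrow> inner x (Y y)"
      by (simp add: tendsto_inner[OF tendsto_const lim])
    moreover have "(\<lambda>n. inner (sqrt_iter C n x) y) \<longlonglongrightarrow> inner (Y x) y"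
      by (intro tendsto_inner lim tendsto_const)
    ultimately show ?thesis by (rule LIMSEQ_unique[rotated])
  qed
  have Y_comm: "Z (Y x) = Y (Z x)" if Z: "bounded_linear Z" and ZA: "\<And>x. Z (A x) = A (Z x)" for Z x
  proof -
    interpret Z: bounded_linear Z by fact
    have "Blinfun Z o\<^sub>L C = C o\<^sub>L Blinfun Z"
      by (rule blinfun_eqI)
        (simp add: C_apply bounded_linear_Blinfun_apply[OF Z] C'_def Z.diff ZA)
    from sqrt_iter_commute[OF this] have "Z (sqrt_iter C n x) = sqrt_iter C n (Z x)" for n
      by (metis blinfun_apply_blinfun_compose bounded_linear_Blinfun_apply[OF Z])
    then have "(\<lambda>n. Z (sqrt_iter C n x)) \<longlonglongrightarrow> Y (Z x)"
      by (simp add: lim)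
    moreover have "(\<lambda>n. Z (sqrt_iter C n x)) \<longlonglongrightarrow> Z (Y x)"
      by (intro Z.tendsto lim)
    ultimately show ?thesis by (rule LIMSEQ_unique[rotated])
  qed
  have Y_cl: "bounded_clinear (\<lambda>x. Y x)"
    unfolding bounded_clinear_def
  proof (intro conjI allI)
    show "Y (c *\<^sub>C x) = c *\<^sub>C Y x" for c x
      \<comment> \<open>Multiplication by a complex scalar is a bounded real-linear map commuting
        with \<open>A\<close>, so complex linearity is an instance of the commutation
        property.\<close>
      using Y_comm[OF bounded_linear_scaleC[of c], of x]
      by (simp add: bounded_clinear_scaleC[OF selfadjoint_bounded_clinear[OF positive_selfadjoint[OF A]]])
  qed (rule blinfun.bounded_linear_right)
  define B where "B = (\<lambda>x. x - Y x)"
  have "positive B"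
    unfolding positive_def selfadjoint_iff B_def
  proof (intro conjI allI)
    show "0 \<le> inner (x - Y x) x" for x
    proof -
      have "inner (Y x) x \<le> norm (Y x) * norm x" by (rule norm_cauchy_schwarz)
      also have "\<dots> \<le> norm x * norm x" by (intro mult_right_mono Y_norm) simp
      finally show ?thesis by (simp add: inner_diff_left power2_eq_square flip: power2_norm_eq_inner)
    qed
  qed (simp_all add: Y_cl bounded_clinear_intros Y_sym inner_diff_left inner_diff_right)
  moreover have "B (B x) = A x" for x
  proof -
    have "B (B x) = x - 2 *\<^sub>R Y x + Y (Y x)"
      by (simp add: B_def blinfun.bilinear_simps scaleR_2)
    then show ?thesis by (simp add: fp_apply C'_def)
  qed
  moreover have "Z (B x) = B (Z x)"
    if "bounded_linear Z" "\<forall>x. Z (A x) = A (Z x)" for Z x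
    using that Y_comm[of Z x] by (simp add: B_def linear_diff bounded_linear.linear)
  ultimately show ?thesis unfolding is_sqrt_def by blast
qed

lemma is_sqrt_exists:
  assumes A: "positive A"
  shows "\<exists>B. is_sqrt A B"
proof -
  interpret A: bounded_linear A
    by (rule selfadjoint_bounded_linear[OF positive_selfadjoint[OF A]])
  obtain K where K: "\<And>x. norm (A x) \<le> norm x * K" "K > 0" using A.pos_bounded by blast
  define A' where "A' = (\<lambda>x. (1/K) *\<^sub>R A x)"
  have A': "positive A'"
    using A K(2) by (auto simp: A'_def positive_def intro!: selfadjoint_scaleR)
  have le: "inner (A' x) x \<le> (norm x)\<^sup>2" for x
  proof -
    have "inner (A x) x \<le> norm (A x) * norm x" by (rule norm_cauchy_schwarz)
    also have "\<dots> \<le> norm x * K * norm x" by (intro mult_right_mono K) simp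
    finally show ?thesis using K(2) by (simp add: A'_def field_simps power2_eq_square)
  qed
  obtain B where B: "is_sqrt A' B" using is_sqrt_exists_contraction[OF A' le] by blast
  then have Bpos: "positive B" and BB: "\<And>x. B (B x) = A' x"
    and Bcomm: "\<And>Z x. bounded_linear Z \<Longrightarrow> \<forall>x. Z (A' x) = A' (Z x) \<Longrightarrow> Z (B x) = B (Z x)"
    unfolding is_sqrt_def by blast+
  interpret B: bounded_linear B
    by (rule selfadjoint_bounded_linear[OF positive_selfadjoint[OF Bpos]])
  have "is_sqrt A (\<lambda>x. sqrt K *\<^sub>R B x)"
    unfolding is_sqrt_def
  proof (intro conjI allI impI)
    show "positive (\<lambda>x. sqrt K *\<^sub>R B x)"
      using Bpos K(2) by (auto simp: positive_def intro!: selfadjoint_scaleR)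
    show "sqrt K *\<^sub>R B (sqrt K *\<^sub>R B x) = A x" for x
      using K(2) by (simp add: B.scaleR BB A'_def)
    fix Z x assume Z: "bounded_linear Z" "\<forall>x. Z (A x) = A (Z x)"
    then show "Z (sqrt K *\<^sub>R B x) = sqrt K *\<^sub>R B (Z x)"
      using Bcomm[of Z x] by (simp add: A'_def linear_scale bounded_linear.linear)
  qed
  then show ?thesis by blast
qed

text \<open>The roots commute, so \<open>B + B'\<close> maps \<open>y = B x - B' x\<close> to
  \<open>A x - A x = 0\<close>. Both nonnegative forms therefore vanish at \<open>y\<close>, whence
  \<open>B y = B' y = 0\<close>, and by symmetry \<open>y\<close> is orthogonal to itself.\<close>

lemma square_root_unique:
  assumes B: "is_sqrt A B" and B': "positive B'" "\<And>x. B' (B' x) = A x"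
  shows "B' = B"
proof
  fix x
  have Bpos: "positive B" and BB: "\<And>x. B (B x) = A x" using B by (auto simp: is_sqrt_def)
  interpret B: bounded_linear B
    by (rule selfadjoint_bounded_linear[OF positive_selfadjoint[OF Bpos]])
  interpret B': bounded_linear B'
    by (rule selfadjoint_bounded_linear[OF positive_selfadjoint[OF B'(1)]])
  have comm: "B' (B x) = B (B' x)" for x
    using B B' B'.bounded_linear_axioms unfolding is_sqrt_def by metis
  define y where "y = B x - B' x"
  have "B y + B' y = 0"
    by (simp add: y_def B.diff B'.diff comm BB B'(2))
  then have "inner (B y) y + inner (B' y) y = 0"
    by (metis inner_add_left inner_zero_left)
  then have "inner (B y) y = 0" "inner (B' y) y = 0"
    using positive_form[OF Bpos, of y] positive_form[OF B'(1), of y] by linarith+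
  then have "B y = 0" "B' y = 0"
    using positive_eq_0_if_form_0 Bpos B'(1) by blast+
  then have "inner y (B x) = 0" "inner y (B' x) = 0"
    using selfadjoint_inner[OF positive_selfadjoint[OF Bpos], of y x]
      selfadjoint_inner[OF positive_selfadjoint[OF B'(1)], of y x] by simp_all
  then have "inner y y = 0"
    by (simp add: y_def inner_diff_right)
  then show "B' x = B x" by (simp add: y_def)
qed

lemma positive_iff_op_le: "positive B \<longleftrightarrow> selfadjoint B \<and> op_le (\<lambda>x. 0) B"
  by (simp add: positive_def op_le_iff)

lemma is_sqrt_sqrt_op:
  assumes "positive A"
  shows "is_sqrt A (sqrt_op A)"
proof -
  obtain B where B: "is_sqrt A B" using is_sqrt_exists[OF assms] by blast
  have "sqrt_op A = B"
    unfolding sqrt_op_def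
  proof (rule the_equality)
    show "selfadjoint B \<and> op_le (\<lambda>x. 0) B \<and> B \<circ> B = A"
      using B by (auto simp: is_sqrt_def positive_iff_op_le)
    show "B' = B" if "selfadjoint B' \<and> op_le (\<lambda>x. 0) B' \<and> B' \<circ> B' = A" for B'
      using that by (intro square_root_unique[OF B]) (auto simp: positive_iff_op_le)
  qed
  then show ?thesis using B by simp
qed

lemma
  assumes "positive A"
  shows positive_sqrt_op: "positive (sqrt_op A)"
    and sqrt_op_sqrt_op: "sqrt_op A (sqrt_op A x) = A x"
    and sqrt_op_commute:
      "bounded_linear Z \<Longrightarrow> (\<And>x. Z (A x) = A (Z x)) \<Longrightarrow> Z (sqrt_op A x) = sqrt_op A (Z x)"
  using is_sqrt_sqrt_op[OF assms] by (auto simp: is_sqrt_def)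

lemma sqrt_op_eqI:
  assumes "positive A" "positive B" "\<And>x. B (B x) = A x"
  shows "sqrt_op A = B"
  using square_root_unique[OF is_sqrt_sqrt_op assms(2,3)] assms(1) by simp

section \<open>The modulus of a selfadjoint operator and products of commuting operators\<close>

lemma
  assumes X: "selfadjoint X"
  shows positive_abs_op: "positive (abs_op X)"
    and abs_op_abs_op: "abs_op X (abs_op X x) = X (X x)"
    and abs_op_commute:
      "bounded_linear Z \<Longrightarrow> (\<And>x. Z (X x) = X (Z x)) \<Longrightarrow> Z (abs_op X x) = abs_op X (Z x)"
proof -
  have XX: "positive (X \<circ> X)"
    using positive_square[OF X] by (simp add: comp_def)
  show "positive (abs_op X)" "abs_op X (abs_op X x) = X (X x)"
    using positive_sqrt_op[OF XX] sqrt_op_sqrt_op[OF XX] by (simp_all add: abs_op_def)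
  show "Z (abs_op X x) = abs_op X (Z x)" if "bounded_linear Z" "\<And>x. Z (X x) = X (Z x)"
    unfolding abs_op_def by (rule sqrt_op_commute[OF XX]) (simp_all add: that)
qed

lemma abs_op_eqI:
  assumes "selfadjoint X" "positive B" "\<And>x. B (B x) = X (X x)"
  shows "abs_op X = B"
  unfolding abs_op_def using positive_square[OF assms(1)] assms(2,3)
  by (intro sqrt_op_eqI) (simp_all add: comp_def)

text \<open>With \<open>R\<close> the root of \<open>A\<close> the product is \<open>R B R\<close>,
  because \<open>R\<close> commutes with whatever commutes with \<open>A\<close>.\<close>

lemma positive_compose:
  assumes A: "positive A" and B: "positive B" and comm: "\<And>x. A (B x) = B (A x)"
  shows "positive (\<lambda>x. A (B x))"
proof -
  let ?R = "sqrt_op A"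
  have R: "positive ?R" by (rule positive_sqrt_op[OF A])
  have "B (?R x) = ?R (B x)" for x
    using B comm by (intro sqrt_op_commute[OF A] selfadjoint_bounded_linear) (auto simp: positive_def)
  then have "inner (B (?R x)) (?R x) = inner (?R (?R (B x))) x" for x
    by (simp add: selfadjoint_inner[OF positive_selfadjoint[OF R]])
  then have "inner (A (B x)) x = inner (B (?R x)) (?R x)" for x
    by (simp add: sqrt_op_sqrt_op[OF A])
  then show ?thesis
    using A B comm by (simp add: positive_def selfadjoint_compose)
qed

lemma sqrt_op_compose:
  assumes A: "positive A" and B: "positive B" and comm: "\<And>x. A (B x) = B (A x)"
  shows "sqrt_op (\<lambda>x. A (B x)) = (\<lambda>x. sqrt_op A (sqrt_op B x))"
proof (rule sqrt_op_eqI[OF positive_compose[OF assms]])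
  have 1: "B (sqrt_op A x) = sqrt_op A (B x)" for x
    using B comm by (intro sqrt_op_commute[OF A] selfadjoint_bounded_linear) (auto simp: positive_def)
  have 2: "sqrt_op A (sqrt_op B x) = sqrt_op B (sqrt_op A x)" for x
    using positive_sqrt_op[OF A] 1
    by (intro sqrt_op_commute[OF B] selfadjoint_bounded_linear) (auto simp: positive_def)
  show "positive (\<lambda>x. sqrt_op A (sqrt_op B x))"
    by (rule positive_compose[OF positive_sqrt_op[OF A] positive_sqrt_op[OF B] 2])
  show "sqrt_op A (sqrt_op B (sqrt_op A (sqrt_op B x))) = A (B x)" for x
    by (simp add: comm sqrt_op_sqrt_op[OF A] sqrt_op_sqrt_op[OF B] flip: 1 2)
qed

text \<open>The product of the moduli is positive by commutation and has the right square. This is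
  what will split |1 - T^2| into |1 + T| |1 - T|.\<close>

lemma abs_op_compose:
  assumes A: "selfadjoint A" and B: "selfadjoint B" and comm: "\<And>x. A (B x) = B (A x)"
  shows "abs_op (\<lambda>x. A (B x)) = (\<lambda>x. abs_op A (abs_op B x))"
proof (rule abs_op_eqI[OF selfadjoint_compose[OF assms]])
  have 1: "B (abs_op A x) = abs_op A (B x)" for x
    using B comm by (intro abs_op_commute[OF A] selfadjoint_bounded_linear) auto
  have 2: "abs_op A (abs_op B x) = abs_op B (abs_op A x)" for x
    using positive_abs_op[OF A] 1
    by (intro abs_op_commute[OF B] selfadjoint_bounded_linear) (auto simp: positive_def)
  show "positive (\<lambda>x. abs_op A (abs_op B x))"
    by (rule positive_compose[OF positive_abs_op[OF A] positive_abs_op[OF B] 2])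
  show "abs_op A (abs_op B (abs_op A (abs_op B x))) = A (B (A (B x)))" for x
    by (simp add: abs_op_abs_op[OF A] abs_op_abs_op[OF B] comm flip: 2)
qed

section \<open>Orthogonal projections\<close>

lemma
  assumes "orth_projection P"
  shows orth_projection_selfadjoint: "selfadjoint P"
    and orth_projection_idem: "P (P x) = P x"
  using assms by (auto simp: orth_projection_def)

lemma orth_projection_bounded_linear: "orth_projection P \<Longrightarrow> bounded_linear P"
  by (simp add: orth_projection_def selfadjoint_bounded_linear)

lemma orth_projection_bounded_clinear: "orth_projection P \<Longrightarrow> bounded_clinear P"
  by (simp add: orth_projection_def selfadjoint_bounded_clinear)

lemmas orth_projection_maps = bounded_clinear_maps[OF orth_projection_bounded_clinear]

lemma orth_projection_form: "orth_projection P \<Longrightarrow> inner (P x) x = (norm (P x))\<^sup>2"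
  by (metis orth_projection_idem orth_projection_selfadjoint power2_norm_eq_inner selfadjoint_inner)

lemma orth_projection_complement:
  "orth_projection P \<Longrightarrow> orth_projection (\<lambda>x. x - P x)"
  by (simp add: orth_projection_def selfadjoint_intros bounded_clinear_maps
      selfadjoint_bounded_clinear)

lemma orth_projection_orthogonal:
  "orth_projection P \<Longrightarrow> P x = x \<Longrightarrow> P y = 0 \<Longrightarrow> inner x y = 0"
  by (metis inner_zero_right orth_projection_selfadjoint selfadjoint_inner)

lemma orth_projection_pythagoras:
  assumes P: "orth_projection P"
  shows "(norm x)\<^sup>2 = (norm (P x))\<^sup>2 + (norm (x - P x))\<^sup>2"
proof -
  have "inner (P x) (x - P x) = 0"
    by (rule orth_projection_orthogonal[OF P])
      (simp_all add: orth_projection_idem[OF P] orth_projection_maps[OF P])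
  then show ?thesis
    by (simp add: power2_norm_eq_inner inner_diff_left inner_diff_right inner_commute)
qed

lemma orth_projection_norm_le: "orth_projection P \<Longrightarrow> norm (P x) \<le> norm x"
  by (rule power2_le_imp_le) (simp_all add: orth_projection_pythagoras[of P x])

lemma orth_projection_absorb:
  assumes P: "orth_projection P" and Q: "orth_projection Q" and PQ: "\<And>x. P (Q x) = P x"
  shows "Q (P x) = P x"
proof -
  have "inner (Q (P x)) y = inner (P x) y" for y
    using PQ by (metis P Q orth_projection_selfadjoint selfadjoint_inner)
  from this[of "Q (P x) - P x"] show ?thesis
    by (metis inner_diff_left inner_eq_zero_iff right_minus_eq)
qed

text \<open>By Pythagoras the squared distance of two members at \<open>x\<close> is the difference
  of their squared norms, and these form a decreasing nonnegative sequence.\<close>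

lemma decreasing_orth_projections_converge:
  assumes Q: "\<And>n. orth_projection (Q n)" and dec: "\<And>m n x. n \<le> m \<Longrightarrow> Q n (Q m x) = Q m x"
  shows "convergent (\<lambda>n. Q (n::nat) (x :: 'a::complex_hilbert))"
proof -
  have dec': "Q m (Q n x) = Q m x" if "n \<le> m" for m n x
  proof -
    have "inner (Q m (Q n x)) y = inner (Q m x) y" for y
      using dec[OF that] by (metis Q orth_projection_selfadjoint selfadjoint_inner)
    from this[of "Q m (Q n x) - Q m x"] show ?thesis
      by (metis inner_diff_left inner_eq_zero_iff right_minus_eq)
  qed
  have diff: "(norm (Q n x - Q m x))\<^sup>2 = (norm (Q n x))\<^sup>2 - (norm (Q m x))\<^sup>2" if "n \<le> m" for m n
    using orth_projection_pythagoras[OF Q, of "Q n x" m] by (simp add: dec'[OF that])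
  have "decseq (\<lambda>n. (norm (Q n x))\<^sup>2)"
    unfolding decseq_def using diff by (smt (verit) zero_le_power2)
  then obtain l where "(\<lambda>n. (norm (Q n x))\<^sup>2) \<longlonglongrightarrow> l"
    by (rule decseq_convergent[where B = 0]) auto
  then have C: "Cauchy (\<lambda>n. (norm (Q n x))\<^sup>2)" by (rule LIMSEQ_imp_Cauchy)
  have "Cauchy (\<lambda>n. Q n x)"
  proof (rule CauchyI')
    fix e :: real assume e: "0 < e"
    then obtain M where M: "\<And>m n. m \<ge> M \<Longrightarrow> n \<ge> M
        \<Longrightarrow> norm ((norm (Q m x))\<^sup>2 - (norm (Q n x))\<^sup>2) < e\<^sup>2"
      using CauchyD[OF C, of "e\<^sup>2"] by auto
    have "norm (Q n x - Q m x) < e" if "n \<ge> M" "n < m" for m n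
    proof -
      have "(norm (Q n x - Q m x))\<^sup>2 < e\<^sup>2"
        using M[of n m] that by (simp add: diff)
      then show ?thesis by (rule power2_less_imp_less) (use e in simp)
    qed
    then show "\<exists>M. \<forall>n\<ge>M. \<forall>m>n. dist (Q n x) (Q m x) < e"
      unfolding dist_norm by blast
  qed
  then show ?thesis by (simp add: Cauchy_convergent_iff)
qed

text \<open>A selfadjoint \<open>C\<close> is injective on the closure of its range, so the value
  \<open>C u\<close> singles out the component of \<open>u\<close> in that closure, which is its
  orthogonal projection.\<close>

definition range_projection :: "('a::complex_hilbert \<Rightarrow> 'a) \<Rightarrow> 'a \<Rightarrow> 'a"
  where "range_projection C u = (THE w. w \<in> closure (range C) \<and> C w = C u)"

lemma closure_range_iff:
  assumes C: "selfadjoint C"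
  shows "u \<in> closure (range C) \<longleftrightarrow> (\<forall>z. C z = 0 \<longrightarrow> inner u z = 0)"
proof
  assume u: "\<forall>z. C z = 0 \<longrightarrow> inner u z = 0"
  obtain w where w: "w \<in> closure (range C)" "C w = C u"
    using range_kernel_decomposition[OF C] by blast
  have z: "C (u - w) = 0"
    using w(2) by (simp add: bounded_clinear_maps[OF selfadjoint_bounded_clinear[OF C]])
  have "inner (u - w) (u - w) = 0"
    using u z range_orthogonal_kernel[OF C w(1) z] by (simp add: inner_diff_left)
  then show "u \<in> closure (range C)" using w(1) by simp
qed (use range_orthogonal_kernel[OF C] in blast)

lemma range_projection_eqI:
  assumes C: "selfadjoint C" and w: "w \<in> closure (range C)" "C w = C u"
  shows "range_projection C u = w"
  unfolding range_projection_def
proof (rule the_equality)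
  fix w' assume w': "w' \<in> closure (range C) \<and> C w' = C u"
  show "w' = w"
  proof (rule inner_closure_eqI)
    show "inner w' (C x) = inner w (C x)" for x
      using w w' by (metis C selfadjoint_inner)
  qed (use w w' in auto)
qed (use w in blast)

lemma
  assumes C: "selfadjoint C"
  shows range_projection_in: "range_projection C u \<in> closure (range C)"
    and range_projection_map: "C (range_projection C u) = C u"
  using range_kernel_decomposition[OF C, of u] range_projection_eqI[OF C] by metis+

lemma range_projection_commute:
  assumes C: "selfadjoint C" and Z: "bounded_linear Z" and comm: "\<And>x. Z (C x) = C (Z x)"
  shows "Z (range_projection C u) = range_projection C (Z u)"
proof (rule range_projection_eqI[OF C, symmetric])
  have "Z ` closure (range C) \<subseteq> closure (Z ` range C)"
    by (rule closure_bounded_linear_image_subset[OF Z])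
  also have "\<dots> \<subseteq> closure (range C)"
    by (rule closure_mono) (auto simp: comm)
  finally show "Z (range_projection C u) \<in> closure (range C)"
    using range_projection_in[OF C] by blast
  show "C (Z (range_projection C u)) = C (Z u)"
    by (metis comm range_projection_map[OF C])
qed

lemma orth_projection_range_projection:
  assumes C: "selfadjoint C"
  shows "orth_projection (range_projection C)"
proof -
  let ?P = "range_projection C"
  note maps = bounded_clinear_maps[OF selfadjoint_bounded_clinear[OF C]]
  have orth: "inner (?P u) (v - ?P v) = 0" for u v
    by (rule range_orthogonal_kernel[OF C range_projection_in[OF C]])
      (simp add: maps range_projection_map[OF C])
  have add: "?P (x + y) = ?P x + ?P y" for x y
    using range_projection_in[OF C]
    by (intro range_projection_eqI[OF C])
      (simp_all add: closure_range_iff[OF C] inner_add_left maps range_projection_map[OF C])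
  have scale: "?P (r *\<^sub>R x) = r *\<^sub>R ?P x" for r x
    using range_projection_in[OF C]
    by (intro range_projection_eqI[OF C])
      (simp_all add: closure_range_iff[OF C] maps range_projection_map[OF C])
  have sym: "inner (?P u) v = inner u (?P v)" for u v
    using orth[of u v] orth[of v u] by (simp add: inner_diff_right inner_commute)
  have norm: "norm (?P u) \<le> norm u" for u
  proof (cases "?P u = 0")
    case False
    have "(norm (?P u))\<^sup>2 = inner (?P u) u"
      using orth[of u u] by (simp add: inner_diff_right power2_norm_eq_inner)
    also have "\<dots> \<le> norm (?P u) * norm u" by (rule norm_cauchy_schwarz)
    finally show ?thesis using False by (simp add: power2_eq_square)
  qed simp
  have "bounded_linear ?P"
    by (rule bounded_linear_intro[where K = 1]) (simp_all add: add scale norm)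
  moreover have "?P (c *\<^sub>C x) = c *\<^sub>C ?P x" for c x
    by (rule range_projection_commute[OF C bounded_linear_scaleC, symmetric])
      (simp add: bounded_clinear_scaleC[OF selfadjoint_bounded_clinear[OF C]])
  moreover have "?P (?P x) = ?P x" for x
    by (rule range_projection_eqI[OF C range_projection_in[OF C] refl])
  ultimately show ?thesis
    by (simp add: orth_projection_def selfadjoint_iff bounded_clinear_def sym)
qed


section \<open>The negative spectral projection\<close>

text \<open>Strict negativity on the range places the kernel of \<open>X\<close> in the complement,
  in agreement with the open half-line and with sign 1 at 0. Together with commutation it leaves
  only one such projection.\<close>

definition is_neg_projection :: "('a::complex_hilbert \<Rightarrow> 'a) \<Rightarrow> ('a \<Rightarrow> 'a) \<Rightarrow> bool"
  where "is_neg_projection X P \<longleftrightarrow> orth_projection P \<and> (\<forall>x. P (X x) = X (P x)) \<and>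
    (\<forall>x. P x = x \<longrightarrow> x \<noteq> 0 \<longrightarrow> inner (X x) x < 0) \<and> (\<forall>x. P x = 0 \<longrightarrow> 0 \<le> inner (X x) x)"

text \<open>\<open>\<bar>X\<bar> - X\<close> is twice the negative part of \<open>X\<close>.\<close>

definition neg_projection :: "('a::complex_hilbert \<Rightarrow> 'a) \<Rightarrow> 'a \<Rightarrow> 'a"
  where "neg_projection X = range_projection (\<lambda>x. abs_op X x - X x)"

lemma
  assumes X: "selfadjoint X"
  shows selfadjoint_abs_op_minus: "selfadjoint (\<lambda>x. abs_op X x - X x)"
    and selfadjoint_abs_op: "selfadjoint (abs_op X)"
    and abs_op_self_commute: "X (abs_op X x) = abs_op X (X x)"
  using positive_abs_op[OF X] selfadjoint_sub[OF positive_selfadjoint X]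
    abs_op_commute[OF X selfadjoint_bounded_linear[OF X]]
  by (auto simp: positive_selfadjoint)

lemma neg_projection_commute:
  assumes X: "selfadjoint X" and Z: "bounded_linear Z" and comm: "\<And>x. Z (X x) = X (Z x)"
  shows "Z (neg_projection X x) = neg_projection X (Z x)"
proof -
  interpret Z: bounded_linear Z by fact
  show ?thesis
    unfolding neg_projection_def
    by (rule range_projection_commute[OF selfadjoint_abs_op_minus[OF X] Z])
      (simp add: Z.diff comm abs_op_commute[OF X Z comm])
qed

lemma orth_projection_neg_projection: "selfadjoint X \<Longrightarrow> orth_projection (neg_projection X)"
  unfolding neg_projection_def
  by (rule orth_projection_range_projection[OF selfadjoint_abs_op_minus])

text \<open>(|X| + X)(|X| - X) = |X|^2 - X^2 = 0, so by continuity |X| + X vanishes on the closure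
  of the range of |X| - X. The complement is the kernel of |X| - X.\<close>

lemma
  assumes X: "selfadjoint X"
  shows abs_op_neg_projection: "neg_projection X x = x \<Longrightarrow> abs_op X x = - X x"
    and abs_op_neg_projection_0: "neg_projection X x = 0 \<Longrightarrow> abs_op X x = X x"
proof -
  define C where "C = (\<lambda>x. abs_op X x - X x)"
  have C: "selfadjoint C" unfolding C_def by (rule selfadjoint_abs_op_minus[OF X])
  note maps = bounded_clinear_maps[OF selfadjoint_bounded_clinear[OF selfadjoint_abs_op[OF X]]]
    bounded_clinear_maps[OF selfadjoint_bounded_clinear[OF X]]
  show "abs_op X x = - X x" if "neg_projection X x = x"
  proof -
    have "bounded_linear (\<lambda>x. abs_op X x + X x)"
      by (intro selfadjoint_bounded_linear selfadjoint_add selfadjoint_abs_op X)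
    then have "closed ((\<lambda>x. abs_op X x + X x) -` {0})"
      by (intro continuous_closed_vimage) (auto simp: linear_continuous_at)
    moreover have "abs_op X (C y) + X (C y) = 0" for y
      by (simp add: C_def maps abs_op_abs_op[OF X] abs_op_self_commute[OF X])
    ultimately have "closure (range C) \<subseteq> (\<lambda>x. abs_op X x + X x) -` {0}"
      by (intro closure_minimal) auto
    moreover have "x \<in> closure (range C)"
      using range_projection_in[OF C, of x] that by (simp add: neg_projection_def C_def)
    ultimately have "abs_op X x + X x = 0" by blast
    then show ?thesis by (rule eq_neg_iff_add_eq_0[THEN iffD2])
  qed
  show "abs_op X x = X x" if "neg_projection X x = 0"
    using range_projection_map[OF C, of x] that
    by (simp add: neg_projection_def C_def maps)
qed

lemma is_neg_projection_neg_projection: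
  assumes X: "selfadjoint X"
  shows "is_neg_projection X (neg_projection X)"
  unfolding is_neg_projection_def
proof (intro conjI allI impI)
  note maps = bounded_clinear_maps[OF selfadjoint_bounded_clinear[OF selfadjoint_abs_op[OF X]]]
    bounded_clinear_maps[OF selfadjoint_bounded_clinear[OF X]]
  show "orth_projection (neg_projection X)" by (rule orth_projection_neg_projection[OF X])
  show "neg_projection X (X x) = X (neg_projection X x)" for x
    by (rule neg_projection_commute[OF X selfadjoint_bounded_linear[OF X], symmetric]) simp
  show "0 \<le> inner (X x) x" if "neg_projection X x = 0" for x
    using abs_op_neg_projection_0[OF X that] positive_form[OF positive_abs_op[OF X], of x] by simp
  show "inner (X x) x < 0" if x: "neg_projection X x = x" "x \<noteq> 0" for x
  proof (rule ccontr)
    assume "\<not> inner (X x) x < 0"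
    then have "inner (abs_op X x) x = 0"
      using abs_op_neg_projection[OF X x(1)] positive_form[OF positive_abs_op[OF X], of x] by simp
    then have "abs_op X x = 0" by (rule positive_eq_0_if_form_0[OF positive_abs_op[OF X]])
    \<comment> \<open>Thus \<open>x\<close> lies both in the kernel and in the closed range of |X| -
      X, which are orthogonal.\<close>
    then have "abs_op X x - X x = 0" using abs_op_neg_projection[OF X x(1)] by simp
    moreover have "x \<in> closure (range (\<lambda>x. abs_op X x - X x))"
      using range_projection_in[OF selfadjoint_abs_op_minus[OF X], of x] x(1)
      by (simp add: neg_projection_def)
    ultimately have "inner x x = 0"
      using range_orthogonal_kernel[OF selfadjoint_abs_op_minus[OF X]] by blast
    then show False using x(2) by simp
  qed
qed

lemma
  assumes X: "selfadjoint X"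
  shows neg_projection_neg: "neg_projection X x = x \<Longrightarrow> x \<noteq> 0 \<Longrightarrow> inner (X x) x < 0"
    and neg_projection_nonneg: "neg_projection X x = 0 \<Longrightarrow> 0 \<le> inner (X x) x"
  using is_neg_projection_neg_projection[OF X] by (auto simp: is_neg_projection_def)

text \<open>The two projections commute, so on the range of their product \<open>N (1 - P)\<close>
  the form is strictly negative off 0 by one description and nonnegative by the other; likewise for
  \<open>P (1 - N)\<close>. Both products vanish.\<close>

lemma neg_projection_eqI:
  assumes X: "selfadjoint X" and P: "is_neg_projection X P"
  shows "neg_projection X = P"
proof
  fix u
  let ?N = "neg_projection X"
  have Po: "orth_projection P" and comm: "\<And>x. P (X x) = X (P x)"
    and neg: "\<And>x. P x = x \<Longrightarrow> x \<noteq> 0 \<Longrightarrow> inner (X x) x < 0"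
    and nonneg: "\<And>x. P x = 0 \<Longrightarrow> 0 \<le> inner (X x) x"
    using P by (auto simp: is_neg_projection_def)
  note No = orth_projection_neg_projection[OF X]
  note maps = orth_projection_maps[OF Po] orth_projection_maps[OF No]
  note idem = orth_projection_idem[OF Po] orth_projection_idem[OF No]
  have PN: "P (?N x) = ?N (P x)" for x
    by (rule neg_projection_commute[OF X orth_projection_bounded_linear[OF Po] comm])
  have 1: "?N (u - P u) = 0"
  proof (rule ccontr)
    assume nz: "?N (u - P u) \<noteq> 0"
    have "P (?N (u - P u)) = 0" by (simp add: maps idem PN)
    from nonneg[OF this] neg_projection_neg[OF X _ nz] show False
      by (simp add: idem)
  qed
  have 2: "P (u - ?N u) = 0"
  proof (rule ccontr)
    assume nz: "P (u - ?N u) \<noteq> 0"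
    have "?N (P (u - ?N u)) = 0" by (simp add: maps idem flip: PN)
    from neg_projection_nonneg[OF X this] neg[OF _ nz] show False
      by (simp add: idem)
  qed
  show "?N u = P u" using 1 2 by (simp add: maps PN idem)
qed

text \<open>Here \<open>R n\<close> stands for the spectral projection of \<open>X\<close> for the half-line up to \<open>- eps n\<close>.\<close>

lemma neg_projection_limit:
  assumes X: "selfadjoint X" and R: "\<And>n. orth_projection (R n)"
    and comm: "\<And>n x. R n (X x) = X (R n x)"
    and inc: "\<And>m n x. n \<le> m \<Longrightarrow> R n (R m x) = R n x"
    and eps: "\<And>n. 0 < eps n" "eps \<longlonglongrightarrow> 0"
    and below: "\<And>n y. R n y = y \<Longrightarrow> inner (X y) y \<le> - eps n * (norm y)\<^sup>2"
    and above: "\<And>n y. R n y = 0 \<Longrightarrow> - eps n * (norm y)\<^sup>2 \<le> inner (X y) y"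
  shows "R (n::nat) (neg_projection X x) = R n x"
    and "(\<lambda>n. R n x) \<longlonglongrightarrow> neg_projection X x"
proof -
  let ?N = "neg_projection X"
  note No = orth_projection_neg_projection[OF X]
  note maps = orth_projection_maps[OF R] orth_projection_maps[OF No]
  note idem = orth_projection_idem[OF R] orth_projection_idem[OF No]
  have RN: "R n (?N x) = ?N (R n x)" for n x
    by (rule neg_projection_commute[OF X orth_projection_bounded_linear[OF R[of n]] comm[of n]])
  show abs: "R n (?N x) = R n x" for n x
  proof -
    define y where "y = R n (x - ?N x)"
    have "?N y = 0" by (simp add: y_def maps idem flip: RN)
    then have "0 \<le> inner (X y) y" by (rule neg_projection_nonneg[OF X])
    moreover have "inner (X y) y \<le> - eps n * (norm y)\<^sup>2"
      by (rule below) (simp add: y_def idem)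
    ultimately have "eps n * (norm y)\<^sup>2 \<le> 0" by simp
    then have "y = 0" using eps(1)[of n] by (simp add: mult_le_0_iff)
    then show ?thesis by (simp add: y_def maps)
  qed
  \<comment> \<open>The defect at \<open>?N x\<close> converges by monotonicity. Its limit
    \<open>z\<close> is in the range of \<open>?N\<close>, where the form is negative off 0; but the
    form of the defects is at least \<open>- eps n\<close> times their squared norm, so it is
    nonnegative in the limit and \<open>z = 0\<close>.\<close>
  have "convergent (\<lambda>n. (\<lambda>n x. x - R n x) n (?N x))"
  proof (rule decreasing_orth_projections_converge)
    show "orth_projection (\<lambda>x. x - R n x)" for n by (rule orth_projection_complement[OF R])
    fix m n :: nat and x :: 'a assume "n \<le> m"
    then have "R n (R m x) = R n x" by (rule inc)
    then show "(x - R m x) - R n (x - R m x) = x - R m x" by (simp add: maps)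
  qed
  then obtain z where z: "(\<lambda>n. ?N x - R n (?N x)) \<longlonglongrightarrow> z"
    by (auto simp: convergent_def)
  have blX: "bounded_linear X" by (rule selfadjoint_bounded_linear[OF X])
  have "(\<lambda>n. ?N (?N x - R n (?N x))) \<longlonglongrightarrow> ?N z"
    by (rule bounded_linear.tendsto[OF orth_projection_bounded_linear[OF No] z])
  then have Nz: "?N z = z"
    using z by (simp add: maps idem flip: RN) (metis LIMSEQ_unique)
  have "0 \<le> inner (X z) z"
  proof (rule LIMSEQ_le)
    let ?y = "\<lambda>n. ?N x - R n (?N x)"
    show "(\<lambda>n. - eps n * (norm (?y n))\<^sup>2) \<longlonglongrightarrow> 0"
    proof -
      have "(\<lambda>n. - eps n * (norm (?y n))\<^sup>2) \<longlonglongrightarrow> - 0 * (norm z)\<^sup>2"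
        by (intro tendsto_intros eps z)
      then show ?thesis by simp
    qed
    show "(\<lambda>n. inner (X (?y n)) (?y n)) \<longlonglongrightarrow> inner (X z) z"
      by (intro tendsto_inner bounded_linear.tendsto[OF blX] z)
    have "- eps n * (norm (?y n))\<^sup>2 \<le> inner (X (?y n)) (?y n)" for n
      by (rule above) (simp add: maps idem)
    then show "\<exists>N. \<forall>n\<ge>N. - eps n * (norm (?y n))\<^sup>2 \<le> inner (X (?y n)) (?y n)" by blast
  qed
  then have "z = 0" using neg_projection_neg[OF X Nz] by force
  then have "(\<lambda>n. ?N x - (?N x - R n (?N x))) \<longlonglongrightarrow> ?N x - 0"
    using z by (intro tendsto_intros) simp
  then show "(\<lambda>n. R n x) \<longlonglongrightarrow> ?N x" by (simp add: abs)
qed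

section \<open>The spectral theorem\<close>

locale resolution_of_identity =
  fixes E :: "real \<Rightarrow> 'a::complex_hilbert \<Rightarrow> 'a"
  assumes proj: "orth_projection (E t)"
    and mult: "s \<le> t \<Longrightarrow> E s (E t x) = E s x" "s \<le> t \<Longrightarrow> E t (E s x) = E s x"
    and right_cont: "((\<lambda>s. E s x) \<longlongrightarrow> E t x) (at_right t)"
    and bounds: "\<exists>a b. (\<forall>t<a. \<forall>x. E t x = 0) \<and> (\<forall>t\<ge>b. \<forall>x. E t x = x)"
begin

lemma norm_mono:
  assumes "s \<le> t"
  shows "(norm (E s x))\<^sup>2 \<le> (norm (E t x))\<^sup>2"
proof -
  have "norm (E s x) = norm (E s (E t x))" by (simp add: mult(1)[OF assms])
  also have "\<dots> \<le> norm (E t x)" by (rule orth_projection_norm_le[OF proj])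
  finally show ?thesis by (simp add: power_mono)
qed

lemma norm_right_cont: "continuous (at_right t) (\<lambda>t. (norm (E t x))\<^sup>2)"
  unfolding continuous_within by (intro tendsto_intros right_cont)

lemma norm_at_bot: "((\<lambda>t. (norm (E t x))\<^sup>2) \<longlongrightarrow> 0) at_bot"
proof (rule tendsto_eventually)
  obtain a where "\<And>t x. t < a \<Longrightarrow> E t x = 0" using bounds by blast
  then show "\<forall>\<^sub>F t in at_bot. (norm (E t x))\<^sup>2 = 0"
    unfolding eventually_at_bot_dense by (intro exI[of _ a]) simp
qed

lemma norm_at_top: "((\<lambda>t. (norm (E t x))\<^sup>2) \<longlongrightarrow> (norm x)\<^sup>2) at_top"
proof (rule tendsto_eventually)
  obtain b where "\<And>t x. t \<ge> b \<Longrightarrow> E t x = x" using bounds by blast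
  then show "\<forall>\<^sub>F t in at_top. (norm (E t x))\<^sup>2 = (norm x)\<^sup>2"
    unfolding eventually_at_top_linorder by (intro exI[of _ b]) simp
qed

abbreviation M :: "'a \<Rightarrow> real measure" where "M x \<equiv> spectral_measure E x"

lemma sets_M [simp, measurable_cong]: "sets (M x) = sets borel"
  and space_M [simp]: "space (M x) = UNIV"
  by (simp_all add: spectral_measure_def)

lemma finite_measure_M: "finite_measure (M x)"
  using finite_borel_measure_interval_measure[OF norm_mono norm_right_cont norm_at_bot norm_at_top]
  by (simp add: spectral_measure_def finite_borel_measure_def)

lemma measure_UNIV: "measure (M x) UNIV = (norm x)\<^sup>2"
  unfolding spectral_measure_def measure_def
  by (subst interval_measure_UNIV[OF norm_mono norm_right_cont norm_at_bot norm_at_top]) simp_all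

lemma measure_Iic: "measure (M x) {..t} = (norm (E t x))\<^sup>2"
  unfolding spectral_measure_def
  by (rule measure_interval_measure_Iic[OF norm_mono norm_right_cont norm_at_bot])

lemma AE_le:
  assumes "E b x = x"
  shows "AE t in M x. t \<le> b"
proof (rule AE_I')
  interpret finite_measure "M x" by (rule finite_measure_M)
  have "measure (M x) (space (M x) - {..b}) = 0"
    by (subst finite_measure_compl) (simp_all add: measure_UNIV measure_Iic assms)
  then show "space (M x) - {..b} \<in> null_sets (M x)"
    by (intro null_setsI) (simp_all add: emeasure_eq_measure)
qed auto

lemma AE_gt:
  assumes "E a x = 0"
  shows "AE t in M x. a < t"
proof (rule AE_I')
  interpret finite_measure "M x" by (rule finite_measure_M)
  show "{..a} \<in> null_sets (M x)"
    by (rule null_setsI) (simp_all add: emeasure_eq_measure measure_Iic assms)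
qed auto

lemma AE_bounded: "\<exists>a b. AE t in M x. a < t \<and> t \<le> b"
proof -
  obtain a b where ab: "\<And>t x. t < a \<Longrightarrow> E t x = 0" "\<And>t x. t \<ge> b \<Longrightarrow> E t x = x"
    using bounds by blast
  \<comment> \<open>\<open>E\<close> is known to vanish strictly below \<open>a\<close> only, hence
    the shift by one.\<close>
  have "AE t in M x. a - 1 < t" by (rule AE_gt) (simp add: ab)
  moreover have "AE t in M x. t \<le> b" by (rule AE_le) (simp add: ab)
  ultimately have "AE t in M x. a - 1 < t \<and> t \<le> b" by eventually_elim simp
  then show ?thesis by blast
qed

lemma integrable_bounded_times:
  assumes [measurable]: "f \<in> borel_measurable borel" and f: "\<And>t. \<bar>f t\<bar> \<le> \<bar>t\<bar>"
  shows "integrable (M x) (f :: real \<Rightarrow> real)"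
proof -
  interpret finite_measure "M x" by (rule finite_measure_M)
  obtain a b where ab: "AE t in M x. a < t \<and> t \<le> b" using AE_bounded by blast
  show ?thesis
  proof (rule integrable_const_bound[where B = "\<bar>a\<bar> + \<bar>b\<bar>"])
    show "AE t in M x. norm (f t) \<le> \<bar>a\<bar> + \<bar>b\<bar>"
      using ab
    proof eventually_elim
      case (elim t)
      then show ?case using f[of t] unfolding real_norm_def by linarith
    qed
  qed simp
qed

lemma integrable_ident: "integrable (M x) (\<lambda>t. t)"
  by (rule integrable_bounded_times) simp_all

lemma integral_le:
  assumes "E b x = x"
  shows "(LINT t|M x. t) \<le> b * (norm x)\<^sup>2"
proof -
  interpret finite_measure "M x" by (rule finite_measure_M)
  have "(LINT t|M x. t) \<le> (LINT t|M x. b)"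
    by (intro integral_mono_AE integrable_ident integrable_const AE_le[OF assms])
  then show ?thesis by (simp add: measure_UNIV mult.commute)
qed

lemma integral_ge:
  assumes "E a x = 0"
  shows "a * (norm x)\<^sup>2 \<le> (LINT t|M x. t)"
proof -
  interpret finite_measure "M x" by (rule finite_measure_M)
  have "AE t in M x. a \<le> t" using AE_gt[OF assms] by eventually_elim simp
  then have "(LINT t|M x. a) \<le> (LINT t|M x. t)"
    by (intro integral_mono_AE integrable_ident integrable_const)
  then show ?thesis by (simp add: measure_UNIV mult.commute)
qed

text \<open>The family gives the mass of closed half-lines directly, so the open one is exhausted
  from inside.\<close>

lemma measure_Iio_0: "(\<lambda>n. (norm (E (- inverse (real (Suc n))) x))\<^sup>2) \<longlonglongrightarrow> measure (M x) {..<0}"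
proof -
  interpret finite_measure "M x" by (rule finite_measure_M)
  have "(\<lambda>n. measure (M x) {..- inverse (real (Suc n))})
      \<longlonglongrightarrow> measure (M x) (\<Union>n. {..- inverse (real (Suc n))})"
    by (rule finite_Lim_measure_incseq)
      (auto simp: incseq_def elim!: order_trans intro!: le_imp_inverse_le)
  moreover have "(\<Union>n. {..- inverse (real (Suc n))}) = {..<0}"
  proof safe
    fix t :: real assume "t < 0"
    then obtain n where "inverse (real (Suc n)) < - t" using reals_Archimedean[of "- t"] by auto
    then show "t \<in> (\<Union>n. {..- inverse (real (Suc n))})" by (intro UN_I[of n]) auto
  next
    fix t :: real and n assume "t \<le> - inverse (real (Suc n))"
    moreover have "0 < inverse (real (Suc n))" by simp
    ultimately show "t < 0" by linarith
  qed
  ultimately show ?thesis by (simp add: measure_Iic)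
qed

end

lemma is_spectral_family_iff:
  "is_spectral_family X E \<longleftrightarrow> resolution_of_identity E \<and>
    (\<forall>x. cinner (X x) x = complex_of_real (LINT t|spectral_measure E x. t))"
  unfolding is_spectral_family_def resolution_of_identity_def by auto

text \<open>Over n + 1 equal steps the errors add up to (b - a) (F b - F a) / (n + 1), which tends
  to 0. It stands in for Riemann-Stieltjes sums in the spectral theorem.\<close>

lemma eq_if_increments_small:
  fixes G F :: "real \<Rightarrow> real"
  assumes ab: "a \<le> b" and G: "\<And>s t. a \<le> s \<Longrightarrow> s \<le> t \<Longrightarrow> \<bar>G t - G s\<bar> \<le> (t - s) * (F t - F s)"
  shows "G b = G a"
proof -
  have bound: "\<bar>G b - G a\<bar> \<le> (b - a) * (F b - F a) / real (Suc n)" for n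
  proof -
    define d where "d = (b - a) / real (Suc n)"
    have d: "0 \<le> d" using ab by (simp add: d_def)
    have "\<bar>G (a + real k * d) - G a\<bar> \<le> d * (F (a + real k * d) - F a)" for k
    proof (induction k)
      case (Suc k)
      have "\<bar>G (a + real (Suc k) * d) - G (a + real k * d)\<bar>
          \<le> (a + real (Suc k) * d - (a + real k * d))
            * (F (a + real (Suc k) * d) - F (a + real k * d))"
        using d by (intro G) (simp_all add: distrib_right)
      also have "a + real (Suc k) * d - (a + real k * d) = d" by (simp add: distrib_right)
      finally show ?case using Suc by (simp add: right_diff_distrib)
    qed simp
    from this[of "Suc n"] have "\<bar>G b - G a\<bar> \<le> d * (F b - F a)"
      by (simp add: d_def del: of_nat_Suc)
    then show ?thesis by (simp add: d_def)
  qed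
  have "(\<lambda>n. (b - a) * (F b - F a) * inverse (real (Suc n))) \<longlonglongrightarrow> (b - a) * (F b - F a) * 0"
    by (intro tendsto_intros LIMSEQ_inverse_real_of_nat)
  then have "\<bar>G b - G a\<bar> \<le> (b - a) * (F b - F a) * 0"
    by (rule LIMSEQ_le_const) (use bound in \<open>auto simp: divide_inverse\<close>)
  then show ?thesis by simp
qed

text \<open>The negative part of \<open>t - X\<close> is where \<open>X\<close> exceeds
  \<open>t\<close>. The kernel of \<open>t - X\<close> stays in the complement, which is what makes
  the family continuous from the right.\<close>

definition canonical_family :: "('a::complex_hilbert \<Rightarrow> 'a) \<Rightarrow> real \<Rightarrow> 'a \<Rightarrow> 'a"
  where "canonical_family X t = (\<lambda>x. x - neg_projection (\<lambda>y. t *\<^sub>R y - X y) x)"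

lemma
  assumes X: "selfadjoint X"
  shows orth_projection_canonical_family: "orth_projection (canonical_family X t)"
    and canonical_family_commute: "bounded_linear Z \<Longrightarrow> (\<And>x. Z (X x) = X (Z x)) \<Longrightarrow>
      Z (canonical_family X t x) = canonical_family X t (Z x)"
    and canonical_family_le: "canonical_family X t x = x \<Longrightarrow> inner (X x) x \<le> t * (norm x)\<^sup>2"
    and canonical_family_gt:
      "canonical_family X t x = 0 \<Longrightarrow> x \<noteq> 0 \<Longrightarrow> t * (norm x)\<^sup>2 < inner (X x) x"
proof -
  let ?Y = "\<lambda>y. t *\<^sub>R y - X y"
  have Y: "selfadjoint ?Y"
    by (intro selfadjoint_sub selfadjoint_scaleR selfadjoint_ident X)
  show "orth_projection (canonical_family X t)"
    unfolding canonical_family_def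
    by (rule orth_projection_complement[OF orth_projection_neg_projection[OF Y]])
  show "Z (canonical_family X t x) = canonical_family X t (Z x)"
    if Z: "bounded_linear Z" and comm: "\<And>x. Z (X x) = X (Z x)"
  proof -
    interpret Z: bounded_linear Z by fact
    show ?thesis
      unfolding canonical_family_def
      by (simp add: Z.diff Z.scaleR comm neg_projection_commute[OF Y Z])
  qed
  show "inner (X x) x \<le> t * (norm x)\<^sup>2" if "canonical_family X t x = x"
    using that neg_projection_nonneg[OF Y, of x]
    by (simp add: canonical_family_def inner_diff_left power2_norm_eq_inner)
  show "t * (norm x)\<^sup>2 < inner (X x) x" if "canonical_family X t x = 0" "x \<noteq> 0"
    using that neg_projection_neg[OF Y, of x]
    by (simp add: canonical_family_def inner_diff_left power2_norm_eq_inner)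
qed

text \<open>All members commute. A nonzero vector in the range for \<open>s\<close> and in the
  kernel for \<open>t\<close> would have a form at most \<open>s\<close> and yet more than
  \<open>t\<close> times its squared norm.\<close>

lemma canonical_family_mult:
  assumes X: "selfadjoint X" and st: "s \<le> t"
  shows "canonical_family X s (canonical_family X t x) = canonical_family X s x"
    and "canonical_family X t (canonical_family X s x) = canonical_family X s x"
proof -
  let ?E = "canonical_family X"
  note E = orth_projection_canonical_family[OF X]
  note maps = orth_projection_maps[OF E]
  note idem = orth_projection_idem[OF E]
  have EX: "?E t (X x) = X (?E t x)" for t x
    by (rule canonical_family_commute[OF X selfadjoint_bounded_linear[OF X], symmetric]) simp
  have comm: "?E t (?E s x) = ?E s (?E t x)" for x
    by (rule canonical_family_commute[OF X orth_projection_bounded_linear[OF E[of t]] EX[of t]])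
  show 2: "?E t (?E s x) = ?E s x" for x
  proof (rule ccontr)
    define y where "y = ?E s (x - ?E t x)"
    assume "?E t (?E s x) \<noteq> ?E s x"
    then have y: "y \<noteq> 0" by (simp add: y_def maps comm)
    have "?E t y = 0" by (simp add: y_def maps comm idem)
    from canonical_family_gt[OF X this y] have "t * (norm y)\<^sup>2 < inner (X y) y" .
    also have "\<dots> \<le> s * (norm y)\<^sup>2"
      by (rule canonical_family_le[OF X]) (simp add: y_def idem)
    also have "\<dots> \<le> t * (norm y)\<^sup>2" by (rule mult_right_mono[OF st]) simp
    finally show False by simp
  qed
  show "?E s (?E t x) = ?E s x" using 2 comm by simp
qed

lemma canonical_family_right_continuous:
  assumes X: "selfadjoint X"
  shows "((\<lambda>s. canonical_family X s x) \<longlongrightarrow> canonical_family X t x) (at_right t)"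
proof -
  let ?E = "canonical_family X" and ?s = "\<lambda>n. t + inverse (real (Suc n))"
  note E = orth_projection_canonical_family[OF X]
  note maps = orth_projection_maps[OF E]
  note idem = orth_projection_idem[OF E]
  have s: "t \<le> ?s n" for n by simp
  have "convergent (\<lambda>n. (\<lambda>n. ?E (?s n)) n x)"
  proof (rule decreasing_orth_projections_converge)
    fix m n :: nat and y :: 'a
    assume "n \<le> m"
    then have "?s m \<le> ?s n" by (simp add: le_imp_inverse_le)
    then show "?E (?s n) (?E (?s m) y) = ?E (?s m) y"
      by (rule canonical_family_mult(2)[OF X])
  qed (rule E)
  then obtain w where w: "(\<lambda>n. ?E (?s n) x) \<longlonglongrightarrow> w"
    by (auto simp: convergent_def)
  define y where "y n = ?E (?s n) x - ?E t x" for n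
  define z where "z = w - ?E t x"
  have yz: "y \<longlonglongrightarrow> z"
    unfolding y_def z_def by (intro tendsto_intros w)
  have s_lim: "?s \<longlonglongrightarrow> t"
    using tendsto_add[OF tendsto_const LIMSEQ_inverse_real_of_nat, of t] by simp
  have "?E t (y n) = 0" for n
    by (simp add: y_def maps idem canonical_family_mult(1)[OF X s] del: of_nat_Suc)
  then have Ez: "?E t z = 0"
    using bounded_linear.tendsto[OF orth_projection_bounded_linear[OF E] yz, of t]
    by (simp add: LIMSEQ_const_iff)
  \<comment> \<open>Each \<open>y n\<close> is in the range of the projection for
    \<open>?s n\<close>, and these bounds pass to the limit. Since \<open>z\<close> is in the kernel
    for \<open>t\<close>, where the reverse strict inequality holds off 0, it must vanish.\<close>
  have "inner (X z) z \<le> t * (norm z)\<^sup>2"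
  proof (rule LIMSEQ_le)
    show "(\<lambda>n. inner (X (y n)) (y n)) \<longlonglongrightarrow> inner (X z) z"
      by (intro tendsto_inner bounded_linear.tendsto[OF selfadjoint_bounded_linear[OF X]] yz)
    show "(\<lambda>n. ?s n * (norm (y n))\<^sup>2) \<longlonglongrightarrow> t * (norm z)\<^sup>2"
      by (intro tendsto_mult s_lim tendsto_power tendsto_norm yz)
    have "inner (X (y n)) (y n) \<le> ?s n * (norm (y n))\<^sup>2" for n
      by (rule canonical_family_le[OF X])
        (simp add: y_def maps idem canonical_family_mult(2)[OF X s] del: of_nat_Suc)
    then show "\<exists>N. \<forall>n\<ge>N. inner (X (y n)) (y n) \<le> ?s n * (norm (y n))\<^sup>2" by blast
  qed
  then have "z = 0" using canonical_family_gt[OF X Ez] by force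
  then have "y \<longlonglongrightarrow> 0" using yz by simp
  show ?thesis
    unfolding tendsto_iff
  proof (intro allI impI)
    fix e :: real assume "0 < e"
    then obtain n where n: "norm (y n) < e"
      using \<open>y \<longlonglongrightarrow> 0\<close> by (auto simp: LIMSEQ_iff)
    have "dist (?E s x) (?E t x) < e" if "t < s" "s < ?s n" for s
    proof -
      \<comment> \<open>Every difference closer to \<open>t\<close> is a projection of the one at
        \<open>?s n\<close>, so the sequence controls the full one-sided limit.\<close>
      have "?E s x - ?E t x = ?E s (y n)"
        using that by (simp add: y_def maps canonical_family_mult[OF X])
      then have "norm (?E s x - ?E t x) \<le> norm (y n)"
        by (simp add: orth_projection_norm_le[OF E])
      then show ?thesis using n by (simp add: dist_norm)
    qed
    then show "\<forall>\<^sub>F s in at_right t. dist (?E s x) (?E t x) < e"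
      unfolding eventually_at_right_field by (intro exI[of _ "?s n"]) simp
  qed
qed

lemma resolution_canonical_family:
  assumes X: "selfadjoint X"
  shows "resolution_of_identity (canonical_family X)"
proof
  let ?E = "canonical_family X"
  note E = orth_projection_canonical_family[OF X]
  note maps = orth_projection_maps[OF E]
  note idem = orth_projection_idem[OF E]
  show "\<exists>a b. (\<forall>t<a. \<forall>x. ?E t x = 0) \<and> (\<forall>t\<ge>b. \<forall>x. ?E t x = x)"
  proof -
    interpret X: bounded_linear X by (rule selfadjoint_bounded_linear[OF X])
    obtain K where K: "\<And>x. norm (X x) \<le> norm x * K" using X.bounded by blast
    have form: "\<bar>inner (X x) x\<bar> \<le> K * (norm x)\<^sup>2" for x
    proof -
      have "\<bar>inner (X x) x\<bar> \<le> norm (X x) * norm x" by (rule Cauchy_Schwarz_ineq2)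
      also have "\<dots> \<le> norm x * K * norm x" by (intro mult_right_mono K) simp
      finally show ?thesis by (simp add: power2_eq_square mult_ac)
    qed
    have "?E t x = 0" if "t < - K" for t x
    proof (rule ccontr)
      assume "?E t x \<noteq> 0"
      then have "t * (norm (?E t x))\<^sup>2 < - K * (norm (?E t x))\<^sup>2"
        using that by (intro mult_strict_right_mono) simp_all
      then show False
        using canonical_family_le[OF X idem, of t x] form[of "?E t x"] by linarith
    qed
    moreover have "?E t x = x" if "K \<le> t" for t x
    proof (rule ccontr)
      assume "?E t x \<noteq> x"
      then have "t * (norm (x - ?E t x))\<^sup>2 < inner (X (x - ?E t x)) (x - ?E t x)"
        by (intro canonical_family_gt[OF X]) (simp_all add: maps idem)
      moreover have "K * (norm (x - ?E t x))\<^sup>2 \<le> t * (norm (x - ?E t x))\<^sup>2"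
        by (rule mult_right_mono[OF that]) simp
      ultimately show False using form[of "x - ?E t x"] by linarith
    qed
    ultimately show ?thesis by blast
  qed
qed (simp_all add: orth_projection_canonical_family[OF X] canonical_family_mult[OF X]
    canonical_family_right_continuous[OF X])

lemma is_spectral_family_canonical_family:
  assumes X: "selfadjoint X"
  shows "is_spectral_family X (canonical_family X)"
proof -
  let ?E = "canonical_family X"
  interpret R: resolution_of_identity ?E by (rule resolution_canonical_family[OF X])
  note E = orth_projection_canonical_family[OF X]
  note maps = orth_projection_maps[OF E]
  note idem = orth_projection_idem[OF E]
  have "inner (X x) x = (LINT t|R.M x. t)" for x
  proof -
    interpret finite_measure "R.M x" by (rule R.finite_measure_M)
    \<comment> \<open>Over (s, t] both terms grow by an amount between s and t times the mass of the
      interval, so \<open>G\<close> moves by at most (t - s) times that mass. Refinement then shows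
      that \<open>G\<close> takes the same value at both ends of the spectrum.\<close>
    define G where "G t = (LINT u|R.M x. indicator {..t} u * u) - inner (X (?E t x)) x" for t
    have int: "integrable (R.M x) (\<lambda>u. indicator A u * u)" if "A \<in> sets borel" for A
    proof (rule R.integrable_bounded_times)
      show "(\<lambda>u. indicator A u * u) \<in> borel_measurable borel" using that by measurable
    qed (simp add: indicator_def)
    have "\<bar>G t - G s\<bar> \<le> (t - s) * ((norm (?E t x))\<^sup>2 - (norm (?E s x))\<^sup>2)" if st: "s \<le> t" for s t
    proof -
      let ?m = "(norm (?E t x))\<^sup>2 - (norm (?E s x))\<^sup>2"
      let ?I = "LINT u|R.M x. indicator {s<..t} u * u"
      define y where "y = ?E t x - ?E s x"
      have y: "?E t y = y" "?E s y = 0"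
        by (simp_all add: y_def maps idem canonical_family_mult[OF X st])
      have m: "(norm y)\<^sup>2 = ?m"
        using orth_projection_pythagoras[OF E, of "?E t x" s]
        by (simp add: y_def canonical_family_mult[OF X st])
      have "measure (R.M x) {s<..t} = measure (R.M x) ({..t} - {..s})"
        by (rule arg_cong[where f = "measure (R.M x)"]) auto
      also have "\<dots> = ?m"
        using st by (subst finite_measure_Diff) (simp_all add: R.measure_Iic)
      finally have meas: "measure (R.M x) {s<..t} = ?m" .
      have const: "(LINT u|R.M x. indicator {s<..t} u * c) = c * ?m" for c :: real
        by (simp add: meas)
      have intc: "integrable (R.M x) (\<lambda>u. indicator {s<..t} u * c)" for c :: real
        by (intro integrable_mult_left) (simp add: emeasure_eq_measure)
      have "(LINT u|R.M x. indicator {s<..t} u * s) \<le> ?I" "?I \<le> (LINT u|R.M x. indicator {s<..t} u * t)"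
        by (intro integral_mono int intc; simp add: indicator_def)+
      then have I: "s * ?m \<le> ?I" "?I \<le> t * ?m"
        unfolding const by simp_all
      have "inner (X (?E t x)) x - inner (X (?E s x)) x = inner (X y) x"
        by (simp add: y_def bounded_clinear_maps[OF selfadjoint_bounded_clinear[OF X]] inner_diff_left)
      also have "\<dots> = inner (X y) y"
      proof -
        have EX: "?E r (X z) = X (?E r z)" for r z
          by (rule canonical_family_commute[OF X selfadjoint_bounded_linear[OF X], symmetric]) simp
        have "inner (X y) x = inner (?E t (X y)) x - inner (?E s (X y)) x"
          by (simp add: EX y bounded_clinear_maps[OF selfadjoint_bounded_clinear[OF X]])
        also have "\<dots> = inner (X y) y"
          by (simp add: selfadjoint_inner[OF orth_projection_selfadjoint[OF E]] y_def inner_diff_right)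
        finally show ?thesis .
      qed
      finally have XE: "inner (X (?E t x)) x - inner (X (?E s x)) x = inner (X y) y" .
      have form: "inner (X y) y \<le> t * ?m" "s * ?m \<le> inner (X y) y"
        using canonical_family_le[OF X y(1)] canonical_family_gt[OF X y(2)]
        unfolding m[symmetric] by (cases "y = 0"; simp add: bounded_clinear_maps[OF selfadjoint_bounded_clinear[OF X]])+
      have "(LINT u|R.M x. indicator {..t} u * u) - (LINT u|R.M x. indicator {..s} u * u)
          = (LINT u|R.M x. indicator {..t} u * u - indicator {..s} u * u)"
        by (rule Bochner_Integration.integral_diff[symmetric]) (simp_all add: int)
      also have "\<dots> = ?I"
        using st by (intro Bochner_Integration.integral_cong) (auto simp: indicator_def)
      finally have "G t - G s = ?I - inner (X y) y"
        unfolding G_def using XE by linarith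
      then show ?thesis using I form by (simp add: abs_le_iff left_diff_distrib)
    qed
    note step = this
    obtain a b where ab: "\<And>t x. t < a \<Longrightarrow> ?E t x = 0" "\<And>t x. t \<ge> b \<Longrightarrow> ?E t x = x"
      using R.bounds by blast
    \<comment> \<open>The shift is needed because \<open>?E\<close> vanishes strictly below
      \<open>a\<close>; the maximum ensures \<open>a' \<le> b'\<close>.\<close>
    define a' b' where "a' = a - 1" and "b' = max b a'"
    have a': "?E a' x = 0" and b': "?E b' x = x" by (simp_all add: a'_def b'_def ab)
    have "G b' = G a'"
      by (rule eq_if_increments_small[where F = "\<lambda>t. (norm (?E t x))\<^sup>2"]) (auto simp: b'_def step)
    moreover have "G a' = 0"
    proof -
      have "(LINT u|R.M x. indicator {..a'} u * u) = (LINT u|R.M x. 0)"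
        by (intro integral_cong_AE)
          (use R.AE_gt[OF a'] in \<open>auto elim!: eventually_mono simp: indicator_def\<close>)
      then show ?thesis
        by (simp add: G_def a' bounded_clinear_maps[OF selfadjoint_bounded_clinear[OF X]])
    qed
    moreover have "G b' = (LINT u|R.M x. u) - inner (X x) x"
    proof -
      have "(LINT u|R.M x. indicator {..b'} u * u) = (LINT u|R.M x. u)"
        by (intro integral_cong_AE)
          (use R.AE_le[OF b'] in \<open>auto elim!: eventually_mono simp: indicator_def\<close>)
      then show ?thesis by (simp add: G_def b')
    qed
    ultimately show ?thesis by simp
  qed
  then show ?thesis
    unfolding is_spectral_family_iff
    by (simp add: R.resolution_of_identity_axioms selfadjoint_cinner_self[OF X])
qed

lemma is_spectral_family_spectral_family:
  "selfadjoint X \<Longrightarrow> is_spectral_family X (spectral_family X)"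
  unfolding spectral_family_def
  by (rule someI[of "is_spectral_family X"]) (rule is_spectral_family_canonical_family)

text \<open>\<open>spectral_family\<close> is an arbitrary choice, so its properties are derived for
  every resolution that represents the form of \<open>X\<close>; this makes the functional calculus
  independent of the choice.\<close>

locale spectral_resolution = resolution_of_identity E
  for E :: "real \<Rightarrow> 'a::complex_hilbert \<Rightarrow> 'a" +
  fixes X :: "'a \<Rightarrow> 'a"
  assumes X: "selfadjoint X"
    and form: "inner (X x) x = (LINT t|spectral_measure E x. t)"
begin

lemma form_le: "E t x = x \<Longrightarrow> inner (X x) x \<le> t * (norm x)\<^sup>2"
  unfolding form by (rule integral_le)

lemma form_ge: "E t x = 0 \<Longrightarrow> t * (norm x)\<^sup>2 \<le> inner (X x) x"
  unfolding form by (rule integral_ge)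

text \<open>
  The unitary \<open>U = 1 - 2 E\<^sub>s\<close> commutes with the family, so \<open>x\<close> and \<open>U x\<close> have the same spectral
  measure and \<open>U X U = X\<close>.
\<close>

lemma commute: "E s (X x) = X (E s x)"
proof -
  define U where "U x = x - 2 *\<^sub>R E s x" for x
  note maps = orth_projection_maps[OF proj] bounded_clinear_maps[OF selfadjoint_bounded_clinear[OF X]]
  note idem = orth_projection_idem[OF proj]
  have U: "selfadjoint U"
    unfolding U_def
    by (intro selfadjoint_sub selfadjoint_ident selfadjoint_scaleR orth_projection_selfadjoint proj)
  have UU: "U (U x) = x" for x
    by (simp add: U_def maps idem scaleR_2)
  have norm_U: "norm (U x) = norm x" for x
    using selfadjoint_inner[OF U, of x "U x"] by (simp add: UU norm_eq_sqrt_inner)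
  have "E t (E s x) = E s (E t x)" for t x
    using mult[of s t] mult[of t s] by (cases "s \<le> t") simp_all
  then have EU: "E t (U x) = U (E t x)" for t x
    by (simp add: U_def maps)
  have "spectral_measure E (U x) = spectral_measure E x" for x
    by (simp add: spectral_measure_def EU norm_U)
  then have "inner (X (U x)) (U x) = inner (X x) x" for x
    unfolding form by simp
  then have "inner (U (X (U x))) x = inner (X x) x" for x
    by (simp add: selfadjoint_inner[OF U])
  moreover have "selfadjoint (\<lambda>x. U (X (U x)))"
    using U X by (simp add: selfadjoint_iff bounded_clinear_compose[of U] bounded_clinear_compose[of X])
  ultimately have "(\<lambda>x. U (X (U x))) = X"
    by (intro selfadjoint_eqI_form X) simp_all
  then have "U (X (U x)) = X x" for x by metis
  then have "X (U x) = U (X x)" for x using UU by metis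
  from this[of x] have "2 *\<^sub>R X (E s x) = 2 *\<^sub>R E s (X x)" by (simp add: U_def maps)
  then show ?thesis by simp
qed

lemma
  shows cutoff_neg_projection:
      "E (- inverse (real (Suc n))) (neg_projection X x) = E (- inverse (real (Suc n))) x"
    and cutoff_tendsto:
      "(\<lambda>n. E (- inverse (real (Suc n))) x) \<longlonglongrightarrow> neg_projection X x"
proof -
  define e where "e n = inverse (real (Suc n))" for n
  define R where "R n = E (- e n)" for n
  have inc: "R n (R m x) = R n x" if "n \<le> m" for m n x
    unfolding R_def e_def by (rule mult) (use that in \<open>simp add: le_imp_inverse_le\<close>)
  have e: "0 < e n" "e \<longlonglongrightarrow> 0" for n
    unfolding e_def by (simp, rule LIMSEQ_inverse_real_of_nat)
  have below: "inner (X y) y \<le> - e n * (norm y)\<^sup>2" if "R n y = y" for n y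
    using that unfolding R_def by (rule form_le)
  have above: "- e n * (norm y)\<^sup>2 \<le> inner (X y) y" if "R n y = 0" for n y
    using that unfolding R_def by (rule form_ge)
  have R: "orth_projection (R n)" "R n (X y) = X (R n y)" for n y
    unfolding R_def by (rule proj, rule commute)
  have "R n (neg_projection X x) = R n x" "(\<lambda>n. R n x) \<longlonglongrightarrow> neg_projection X x"
    by (rule neg_projection_limit[where R = R and eps = e];
        (fact X R inc e below above))+
  then show "E (- inverse (real (Suc n))) (neg_projection X x) = E (- inverse (real (Suc n))) x"
    and "(\<lambda>n. E (- inverse (real (Suc n))) x) \<longlonglongrightarrow> neg_projection X x"
    by (simp_all only: R_def e_def)
qed

lemma measure_Iio_0_neg_projection: "measure (M x) {..<0} = (norm (neg_projection X x))\<^sup>2"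
proof -
  let ?e = "\<lambda>n. inverse (real (Suc n))"
  have "(\<lambda>n. E (- ?e n) x) \<longlonglongrightarrow> neg_projection X x"
    by (rule cutoff_tendsto)
  then have "(\<lambda>n. (norm (E (- ?e n) x))\<^sup>2) \<longlonglongrightarrow> (norm (neg_projection X x))\<^sup>2"
    by (intro tendsto_intros)
  then show ?thesis using measure_Iio_0[of x] LIMSEQ_unique by blast
qed

end

lemma spectral_resolution_spectral_family:
  assumes X: "selfadjoint X"
  shows "spectral_resolution (spectral_family X) X"
proof -
  have "is_spectral_family X (spectral_family X)"
    by (rule is_spectral_family_spectral_family[OF X])
  then show ?thesis
    unfolding is_spectral_family_iff spectral_resolution_def spectral_resolution_axioms_def
    using selfadjoint_cinner_self[OF X] X by (metis of_real_eq_iff)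
qed

section \<open>The functional calculus for the negative half-line and for the sign\<close>

lemma fun_calculus_eqI:
  assumes B: "selfadjoint B"
    and form: "\<And>x. inner (B x) x = (LINT t|spectral_measure (spectral_family X) x. f t)"
  shows "fun_calculus f X = B"
  unfolding fun_calculus_def
proof (rule the_equality)
  show *: "bounded_clinear B \<and> (\<forall>x. cinner (B x) x =
      (LINT t|spectral_measure (spectral_family X) x. complex_of_real (f t)))"
    using B form by (simp add: selfadjoint_bounded_clinear selfadjoint_cinner_self)
  show "C = B" if "bounded_clinear C \<and> (\<forall>x. cinner (C x) x =
      (LINT t|spectral_measure (spectral_family X) x. complex_of_real (f t)))" for C
    using that * by (intro bounded_clinear_eqI_form) simp_all
qed

lemma
  assumes X: "selfadjoint X"
  shows fun_calculus_neg: "fun_calculus (indicator {..<0}) X = neg_projection X"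
    and sign_op_eq: "sign_op X = (\<lambda>x. x - 2 *\<^sub>R neg_projection X x)"
proof -
  interpret spectral_resolution "spectral_family X" X
    by (rule spectral_resolution_spectral_family[OF X])
  note No = orth_projection_neg_projection[OF X]
  show "fun_calculus (indicator {..<0}) X = neg_projection X"
    by (rule fun_calculus_eqI)
      (simp_all add: orth_projection_selfadjoint[OF No] orth_projection_form[OF No]
        measure_Iio_0_neg_projection)
  show "sign_op X = (\<lambda>x. x - 2 *\<^sub>R neg_projection X x)"
    unfolding sign_op_def
  proof (rule fun_calculus_eqI)
    show "selfadjoint (\<lambda>x. x - 2 *\<^sub>R neg_projection X x)"
      by (intro selfadjoint_sub selfadjoint_ident selfadjoint_scaleR orth_projection_selfadjoint No)
    fix x
    interpret finite_measure "M x" by (rule finite_measure_M)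
    have "(LINT t|M x. (if 0 \<le> t then 1 else - 1)) = (LINT t|M x. (1::real) - 2 * indicator {..<0::real} t)"
      by (intro Bochner_Integration.integral_cong) (auto simp: indicator_def)
    also have "\<dots> = (LINT t|M x. 1) - (LINT t|M x. 2 * indicator {..<0::real} t)"
      by (intro Bochner_Integration.integral_diff) (simp_all add: emeasure_eq_measure)
    also have "\<dots> = (norm x)\<^sup>2 - 2 * (norm (neg_projection X x))\<^sup>2"
      by (simp add: measure_UNIV measure_Iio_0_neg_projection)
    finally show "inner (x - 2 *\<^sub>R neg_projection X x) x = (LINT t|M x. (if 0 \<le> t then 1 else - 1))"
      by (simp add: inner_diff_left orth_projection_form[OF No] power2_norm_eq_inner)
  qed
qed

lemma neg_index_eq: "selfadjoint X \<Longrightarrow> \<nu>\<^sub>- X = cdim (range (neg_projection X))"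
  by (simp add: neg_index_def spectral_subspace_def fun_calculus_neg)

section \<open>Negative indices\<close>

lemma bounded_clinear_linear:
  assumes "bounded_clinear f"
  shows "Vector_Spaces.linear scaleC scaleC f"
  by unfold_locales
    (simp_all add: bounded_clinear_maps[OF assms] bounded_clinear_scaleC[OF assms])

lemma subspace_range: "bounded_clinear f \<Longrightarrow> complex_vector.subspace (range f)"
  unfolding complex_vector.subspace_def
  by (auto simp flip: bounded_clinear_map_add bounded_clinear_scaleC)
    (metis bounded_clinear_map_0 rangeI)

lemma finite_basis_exists:
  assumes "finite B" "S \<subseteq> complex_vector.span B"
  shows "\<exists>C. finite C \<and> C \<subseteq> S \<and> complex_vector.independent C \<and>
    S \<subseteq> complex_vector.span C \<and> cdim S = enat (card C)"
proof -
  obtain C where C: "C \<subseteq> S" "complex_vector.independent C" "S \<subseteq> complex_vector.span C"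
      "card C = complex_vector.dim S"
    using complex_vector.basis_exists[of S] by blast
  moreover have "finite C"
    using complex_vector.independent_span_bound[OF assms(1) C(2)] C(1) assms(2) by blast
  moreover have "cdim S = enat (card C)"
    using assms C(4) unfolding cdim_def by auto
  ultimately show ?thesis by blast
qed

lemma cdim_finiteD:
  assumes "cdim S = enat k"
  obtains C where "finite C" "C \<subseteq> S" "complex_vector.independent C"
    "S \<subseteq> complex_vector.span C" "card C = k"
proof -
  obtain B where "finite B" "S \<subseteq> complex_vector.span B"
    using assms by (auto simp: cdim_def split: if_splits)
  from finite_basis_exists[OF this] show thesis
    using that assms by auto
qed

lemma cdim_eqI:
  assumes "finite C" "C \<subseteq> S" "complex_vector.independent C" "S \<subseteq> complex_vector.span C"
  shows "cdim S = enat (card C)"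
  using assms complex_vector.basis_card_eq_dim[of C S] by (auto simp: cdim_def)

lemma card_le_cdim:
  assumes "C \<subseteq> S" "complex_vector.independent C"
  shows "enat (card C) \<le> cdim S"
proof (cases "cdim S")
  case (enat k)
  then obtain B where "finite B" "S \<subseteq> complex_vector.span B" "card B = k"
    by (auto elim: cdim_finiteD)
  then show ?thesis
    using complex_vector.independent_span_bound[OF _ assms(2), of B] assms(1) enat by auto
qed simp

lemma independent_image:
  assumes f: "bounded_clinear f" and V: "complex_vector.subspace V"
    and C: "C \<subseteq> V" "complex_vector.independent C"
    and inj: "\<And>v. v \<in> V \<Longrightarrow> f v = 0 \<Longrightarrow> v = 0"
  shows "complex_vector.independent (f ` C)" and "inj_on f C"
proof -
  interpret f: Vector_Spaces.linear scaleC scaleC f by (rule bounded_clinear_linear[OF f])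
  have "inj_on f V"
    unfolding inj_on_def
    by (metis bounded_clinear_map_diff[OF f] complex_vector.subspace_diff[OF V] inj right_minus_eq)
  moreover have "complex_vector.span C \<subseteq> V" by (rule complex_vector.span_minimal[OF C(1) V])
  ultimately show "complex_vector.independent (f ` C)" "inj_on f C"
    using C f.independent_injective_image[OF C(2)] by (auto intro: inj_on_subset)
qed

lemma cdim_le_if_injective:
  assumes f: "bounded_clinear f" and V: "complex_vector.subspace V"
    and inj: "\<And>v. v \<in> V \<Longrightarrow> f v = 0 \<Longrightarrow> v = 0" and W: "f ` V \<subseteq> W"
  shows "cdim V \<le> cdim W"
proof (cases "cdim W")
  case (enat k)
  then obtain B where B: "finite B" "W \<subseteq> complex_vector.span B"
    by (auto elim: cdim_finiteD)
  obtain C where C: "C \<subseteq> V" "complex_vector.independent C" "V \<subseteq> complex_vector.span C"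
      "card C = complex_vector.dim V"
    using complex_vector.basis_exists[of V] by blast
  note fC = independent_image[OF f V C(1,2) inj]
  have "f ` C \<subseteq> W" using C(1) W by blast
  then have "finite (f ` C)"
    using complex_vector.independent_span_bound[OF B(1) fC(1)] B(2) by blast
  then have "finite C" using fC(2) by (simp add: finite_image_iff)
  then have "cdim V = enat (card (f ` C))"
    using C fC(2) by (simp add: cdim_eqI card_image)
  then show ?thesis using card_le_cdim[OF \<open>f ` C \<subseteq> W\<close> fC(1)] by simp
qed simp

lemma cdim_mono: "complex_vector.subspace V \<Longrightarrow> V \<subseteq> W \<Longrightarrow> cdim V \<le> cdim W"
  by (rule cdim_le_if_injective[OF bounded_clinear_ident]) auto

text \<open>Inertia: if the negative projection killed \<open>f v\<close>, the form there would be
  nonnegative. Hence its composition with \<open>f\<close> is injective on \<open>V\<close>.\<close>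

lemma cdim_le_neg_index:
  assumes Y: "selfadjoint Y" and f: "bounded_clinear f" and V: "complex_vector.subspace V"
    and neg: "\<And>v. v \<in> V \<Longrightarrow> v \<noteq> 0 \<Longrightarrow> inner (Y (f v)) (f v) < 0"
  shows "cdim V \<le> \<nu>\<^sub>- Y"
  unfolding neg_index_eq[OF Y]
proof (rule cdim_le_if_injective[OF bounded_clinear_compose[OF _ f] V])
  show "bounded_clinear (neg_projection Y)"
    by (rule orth_projection_bounded_clinear[OF orth_projection_neg_projection[OF Y]])
  show "v = 0" if "v \<in> V" "neg_projection Y (f v) = 0" for v
    using neg[OF that(1)] neg_projection_nonneg[OF Y that(2)] by fastforce
qed auto

text \<open>The opposite estimate: \<open>f\<close> is injective on the negative subspace of
  \<open>X\<close>, so any map that detects negative vectors bounds the index by its rank.\<close>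

lemma neg_index_le_cdim:
  assumes X: "selfadjoint X" and f: "bounded_clinear f"
    and neg: "\<And>z. inner (X z) z < 0 \<Longrightarrow> f z \<noteq> 0"
  shows "\<nu>\<^sub>- X \<le> cdim (range f)"
  unfolding neg_index_eq[OF X]
proof (rule cdim_le_if_injective[OF f])
  note No = orth_projection_neg_projection[OF X]
  show "complex_vector.subspace (range (neg_projection X))"
    by (rule subspace_range[OF orth_projection_bounded_clinear[OF No]])
  show "v = 0" if "v \<in> range (neg_projection X)" "f v = 0" for v
    using that neg neg_projection_neg[OF X] orth_projection_idem[OF No] by blast
qed auto

lemma neg_index_comparison:
  assumes X: "selfadjoint X" and Y: "selfadjoint Y" and K: "bounded_clinear K"
    and neg: "\<And>z. inner (X z) z < 0 \<Longrightarrow> inner (Y (K z)) (K z) < 0"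
  shows "\<nu>\<^sub>- X \<le> \<nu>\<^sub>- Y"
proof -
  note No = orth_projection_neg_projection[OF Y]
  have "\<nu>\<^sub>- X \<le> cdim (range (\<lambda>z. neg_projection Y (K z)))"
  proof (rule neg_index_le_cdim[OF X bounded_clinear_compose[OF _ K]])
    show "neg_projection Y (K z) \<noteq> 0" if "inner (X z) z < 0" for z
      using neg[OF that] neg_projection_nonneg[OF Y, of "K z"] by force
  qed (rule orth_projection_bounded_clinear[OF No])
  also have "\<dots> \<le> cdim (range (neg_projection Y))"
    by (rule cdim_mono[OF subspace_range[OF
            bounded_clinear_compose[OF orth_projection_bounded_clinear[OF No] K]]]) auto
  finally show ?thesis by (simp add: neg_index_eq[OF Y])
qed

text \<open>Negativity at all \<open>f p + a z\<close> other than the trivial pair makes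
  \<open>f\<close> injective on \<open>W\<close> and \<open>z\<close> independent of
  \<open>f W\<close>, giving a negative subspace of dimension k + 1. The map \<open>f\<close> allows
  \<open>W\<close> to live in a different space than \<open>z\<close>.\<close>

lemma Suc_le_neg_index:
  assumes Y: "selfadjoint Y" and f: "bounded_clinear f" and W: "complex_vector.subspace W"
    and k: "cdim W = enat k"
    and neg: "\<And>p a. p \<in> W \<Longrightarrow> p \<noteq> 0 \<or> a \<noteq> 0 \<Longrightarrow>
      inner (Y (f p + a *\<^sub>C z)) (f p + a *\<^sub>C z) < 0"
  shows "enat (Suc k) \<le> \<nu>\<^sub>- Y"
proof -
  obtain C where C: "finite C" "C \<subseteq> W" "complex_vector.independent C"
      "W \<subseteq> complex_vector.span C" "card C = k"
    using cdim_finiteD[OF k] by blast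
  interpret f: Vector_Spaces.linear scaleC scaleC f by (rule bounded_clinear_linear[OF f])
  have spanC: "complex_vector.span C = W"
    using C(2,4) complex_vector.span_minimal[OF C(2) W] by blast
  have inj: "v = 0" if "v \<in> W" "f v = 0" for v
    using neg[OF that(1), of 0] that(2) by (metis add.right_neutral complex_vector.scale_zero_left
        inner_zero_right less_irrefl)
  note fC = independent_image[OF f W C(2,3) inj]
  have z: "z \<notin> complex_vector.span (f ` C)"
  proof
    assume "z \<in> complex_vector.span (f ` C)"
    then obtain p where "p \<in> W" "z = f p" by (auto simp: f.span_image spanC)
    \<comment> \<open>With \<open>a = -1\<close> the vector \<open>f p - z\<close> is 0, whose form
      is not negative.\<close>
    then show False using neg[of p "-1"] by simp
  qed
  let ?B = "insert z (f ` C)"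
  have B: "complex_vector.independent ?B" "card ?B = Suc k"
  proof -
    show "complex_vector.independent ?B"
      by (rule complex_vector.independent_insertI[OF z fC(1)])
    have "z \<notin> f ` C" using z complex_vector.span_base[of z "f ` C"] by argo
    then show "card ?B = Suc k" using C(1,5) fC(2) by (simp add: card_image)
  qed
  have "enat (Suc k) \<le> cdim (complex_vector.span ?B)"
    using card_le_cdim[OF complex_vector.span_superset B(1)] B(2) by simp
  also have "\<dots> \<le> \<nu>\<^sub>- Y"
  proof (rule cdim_le_neg_index[OF Y bounded_clinear_ident])
    fix v assume v: "v \<in> complex_vector.span ?B" "v \<noteq> 0"
    obtain a where "v - a *\<^sub>C z \<in> complex_vector.span (f ` C)"
      using v(1) complex_vector.span_breakdown_eq by blast
    then obtain p where p: "p \<in> W" "v - a *\<^sub>C z = f p" by (auto simp: f.span_image spanC)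
    then have v_eq: "v = f p + a *\<^sub>C z" by (simp add: algebra_simps)
    have "p \<noteq> 0 \<or> a \<noteq> 0" using v(2) v_eq bounded_clinear_map_0[OF f] by auto
    then show "inner (Y v) v < 0" using neg[OF p(1)] v_eq by simp
  qed simp
  finally show ?thesis .
qed

lemma independent_Un:
  assumes "finite C'" "complex_vector.independent C" "complex_vector.independent C'"
    and "complex_vector.span C \<inter> complex_vector.span C' \<subseteq> {0}"
  shows "complex_vector.independent (C \<union> C')"
  using assms
proof (induction C')
  case (insert c C')
  have mono: "complex_vector.span C' \<subseteq> complex_vector.span (insert c C')"
    by (rule complex_vector.span_mono) auto
  have c: "c \<notin> complex_vector.span C'" "complex_vector.independent C'"
    using insert.prems(2) insert.hyps(2) by (simp_all add: complex_vector.independent_insert)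
  have IH: "complex_vector.independent (C \<union> C')"
    using insert.IH[OF insert.prems(1) c(2)] insert.prems(3) mono by blast
  have "c \<notin> complex_vector.span (C \<union> C')"
  proof
    assume "c \<in> complex_vector.span (C \<union> C')"
    then obtain u v where uv: "u \<in> complex_vector.span C" "v \<in> complex_vector.span C'" "c = u + v"
      by (auto simp: complex_vector.span_Un)
    have "u = c - v" using uv(3) by simp
    also have "\<dots> \<in> complex_vector.span (insert c C')"
      using uv(2) mono complex_vector.span_base[of c "insert c C'"]
      by (intro complex_vector.span_diff) auto
    finally have "u = 0" using uv(1) insert.prems(3) by blast
    then show False using c(1) uv by simp
  qed
  then show ?case using complex_vector.independent_insertI[OF _ IH] by simp
qed simp

lemma cdim_range_orthogonal_sum:
  assumes P: "orth_projection P" and Q: "orth_projection Q" and PQ: "\<And>x. P (Q x) = 0"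
  shows "cdim (range (\<lambda>x. P x + Q x)) = cdim (range P) + cdim (range Q)"
proof -
  have QP: "Q (P x) = 0" for x
  proof -
    have "inner (Q (P x)) y = 0" for y
      using PQ[of y] by (metis P Q inner_zero_right orth_projection_selfadjoint selfadjoint_inner)
    then show ?thesis by (metis inner_eq_zero_iff)
  qed
  note idem = orth_projection_idem[OF P] orth_projection_idem[OF Q]
  note maps = orth_projection_maps[OF P] orth_projection_maps[OF Q]
  note cl = orth_projection_bounded_clinear[OF P] orth_projection_bounded_clinear[OF Q]
  let ?R = "range (\<lambda>x. P x + Q x)"
  have sub: "range P \<subseteq> ?R" "range Q \<subseteq> ?R"
  proof -
    have "P x \<in> ?R" "Q x \<in> ?R" for x
      by (rule range_eqI[of _ _ "P x"], simp add: idem QP)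
        (rule range_eqI[of _ _ "Q x"], simp add: idem PQ)
    then show "range P \<subseteq> ?R" "range Q \<subseteq> ?R" by blast+
  qed
  have le: "cdim (range P) \<le> cdim ?R" "cdim (range Q) \<le> cdim ?R"
    by (intro cdim_mono subspace_range cl sub)+
  show ?thesis
  proof (cases "cdim (range P) = \<infinity> \<or> cdim (range Q) = \<infinity>")
    case True
    then show ?thesis using le by auto
  next
    case False
    then obtain C C' where C: "finite C" "C \<subseteq> range P" "complex_vector.independent C"
        "range P \<subseteq> complex_vector.span C" "cdim (range P) = enat (card C)"
      and C': "finite C'" "C' \<subseteq> range Q" "complex_vector.independent C'"
        "range Q \<subseteq> complex_vector.span C'" "cdim (range Q) = enat (card C')"
      by (metis cdim_finiteD not_infinity_eq)
    have span: "complex_vector.span C \<subseteq> range P" "complex_vector.span C' \<subseteq> range Q"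
      by (intro complex_vector.span_minimal C C' subspace_range cl)+
    have int: "complex_vector.span C \<inter> complex_vector.span C' \<subseteq> {0}"
    proof
      fix v assume "v \<in> complex_vector.span C \<inter> complex_vector.span C'"
      then have "P v = v" "Q v = v" using span by (auto simp: idem)
      then show "v \<in> {0}" using PQ[of v] by simp
    qed
    have "C \<inter> C' = {}"
    proof -
      have "C \<inter> C' \<subseteq> {0}" using int complex_vector.span_superset[of C] complex_vector.span_superset[of C'] by blast
      moreover have "0 \<notin> C" using C(3) complex_vector.dependent_zero by blast
      ultimately show ?thesis by blast
    qed
    then have card: "card (C \<union> C') = card C + card C'"
      using C(1) C'(1) by (simp add: card_Un_disjoint)
    have "cdim ?R = enat (card (C \<union> C'))"
    proof (rule cdim_eqI)
      show "?R \<subseteq> complex_vector.span (C \<union> C')"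
      proof (rule image_subsetI)
        fix x
        have "P x \<in> complex_vector.span (C \<union> C')"
          using C(4) complex_vector.span_mono[of C "C \<union> C'"] by blast
        moreover have "Q x \<in> complex_vector.span (C \<union> C')"
          using C'(4) complex_vector.span_mono[of C' "C \<union> C'"] by blast
        ultimately show "P x + Q x \<in> complex_vector.span (C \<union> C')"
          by (rule complex_vector.span_add)
      qed
    qed (use C C' sub independent_Un[OF C'(1) C(3) C'(3) int] in auto)
    then show ?thesis using C(5) C'(5) card by simp
  qed
qed

lemma subspace_eqI_cdim:
  assumes S: "complex_vector.subspace S" and ST: "S \<subseteq> T"
    and fin: "cdim S = enat k" and le: "cdim T \<le> enat k"
  shows "S = T"
proof (rule ccontr)
  assume "S \<noteq> T"
  then obtain v where v: "v \<in> T" "v \<notin> S" using ST by blast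
  obtain C where C: "finite C" "C \<subseteq> S" "complex_vector.independent C" "card C = k"
    using cdim_finiteD[OF fin] by blast
  have "complex_vector.span C \<subseteq> S" by (rule complex_vector.span_minimal[OF C(2) S])
  then have v': "v \<notin> complex_vector.span C" using v(2) by blast
  then have "complex_vector.independent (insert v C)"
    by (rule complex_vector.independent_insertI[OF _ C(3)])
  then have "enat (card (insert v C)) \<le> cdim T"
    by (rule card_le_cdim[rotated]) (use v C ST in auto)
  moreover have "v \<notin> C" using v' complex_vector.span_base[of v C] by argo
  ultimately show False using le C(1,4) by simp (metis enat_ord_simps(1) not_less_eq_eq order_refl order_trans)
qed

text \<open>
  The cut-offs \<open>E(-1/n)\<close> have increasing finite-dimensional ranges exhausting the negative
  subspace, so they are eventually equal to its projection.
\<close>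

lemma neg_projection_coercive:
  assumes X: "selfadjoint X" and fin: "\<nu>\<^sub>- X = enat k"
  shows "\<exists>\<epsilon>>0. \<forall>x. neg_projection X x = x \<longrightarrow> inner (X x) x \<le> - \<epsilon> * (norm x)\<^sup>2"
proof -
  interpret spectral_resolution "spectral_family X" X
    by (rule spectral_resolution_spectral_family[OF X])
  let ?N = "neg_projection X"
  define e where "e n = inverse (real (Suc n))" for n
  define R where "R n = spectral_family X (- e n)" for n
  have R: "orth_projection (R n)" for n unfolding R_def by (rule proj)
  have RN: "R n (?N x) = R n x" for n x
    unfolding R_def e_def by (rule cutoff_neg_projection)
  have inc: "R n (R m x) = R n x" "R m (R n x) = R n x" if "n \<le> m" for m n x
    unfolding R_def e_def using that by (simp_all add: mult le_imp_inverse_le)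
  have lim: "(\<lambda>n. R n x) \<longlonglongrightarrow> ?N x" for x
    unfolding R_def e_def by (rule cutoff_tendsto)
  have sub: "complex_vector.subspace (range (R n))" for n
    by (rule subspace_range[OF orth_projection_bounded_clinear[OF R]])
  have NR: "?N (R n x) = R n x" for n x
    by (rule orth_projection_absorb[OF R orth_projection_neg_projection[OF X] RN])
  have "cdim (range (R n)) \<le> enat k" for n
  proof -
    have "R n x \<in> range ?N" for x by (rule range_eqI[of _ _ "R n x"]) (simp add: NR)
    then have "range (R n) \<subseteq> range ?N" by blast
    then show ?thesis
      using cdim_mono[OF sub] fin unfolding neg_index_eq[OF X] by metis
  qed
  then have "\<exists>d\<le>k. cdim (range (R n)) = enat d" for n
    by (metis enat_ile enat_ord_simps(1))
  then obtain d where d: "\<And>n. d n \<le> k" "\<And>n. cdim (range (R n)) = enat (d n)"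
    by metis
  define D where "D = Max (range d)"
  have fin_d: "finite (range d)" using d(1) by (intro finite_subset[of "range d" "{..k}"]) auto
  have "D \<in> range d" unfolding D_def by (rule Max_in[OF fin_d]) simp
  then obtain n0 where n0: "d n0 = D" by auto
  have max: "d m \<le> d n0" for m
    unfolding n0 D_def by (rule Max_ge[OF fin_d]) simp
  have stable: "R m x = R n0 x" if "n0 \<le> m" for m x
  proof -
    have "range (R n0) = range (R m)"
    proof (rule subspace_eqI_cdim[OF sub _ d(2)])
      have "R n0 x \<in> range (R m)" for x
        by (rule range_eqI[of _ _ "R n0 x"]) (simp add: inc(2)[OF that])
      then show "range (R n0) \<subseteq> range (R m)" by blast
      show "cdim (range (R m)) \<le> enat (d n0)" by (simp add: d(2) max)
    qed
    then have "R m x \<in> range (R n0)" by blast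
    then have "R n0 (R m x) = R m x" by (auto simp: orth_projection_idem[OF R])
    then show ?thesis by (simp add: inc(1)[OF that])
  qed
  have "?N x = R n0 x" for x
  proof (rule LIMSEQ_unique[OF lim])
    show "(\<lambda>n. R n x) \<longlonglongrightarrow> R n0 x"
      by (rule tendsto_eventually) (unfold eventually_sequentially, use stable in blast)
  qed
  then have "inner (X x) x \<le> - e n0 * (norm x)\<^sup>2" if "?N x = x" for x
    using that unfolding R_def by (intro form_le) simp
  moreover have "0 < e n0" by (simp add: e_def)
  ultimately show ?thesis by blast
qed

section \<open>Square roots of the modulus\<close>

lemma form_scaleC:
  assumes "bounded_clinear A"
  shows "inner (A (c *\<^sub>C x)) (c *\<^sub>C x) = (cmod c)\<^sup>2 * inner (A x) x"
proof -
  have "cinner (A (c *\<^sub>C x)) (c *\<^sub>C x) = (c * cnj c) * cinner (A x) x"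
    by (simp add: bounded_clinear_scaleC[OF assms] cinner_scaleC_left cinner_scaleC_right)
  also have "\<dots> = complex_of_real ((cmod c)\<^sup>2) * cinner (A x) x"
    by (simp only: complex_norm_square)
  finally have "Re (cinner (A (c *\<^sub>C x)) (c *\<^sub>C x)) = (cmod c)\<^sup>2 * Re (cinner (A x) x)"
    by simp
  then show ?thesis by (simp only: Re_cinner)
qed

text \<open>Membership in the bicommutant of \<open>T\<close>. Any two members commute, which yields
  at once the commutations between the roots and projections of 1 + T and 1 - T.\<close>

definition bicommutes :: "('a::complex_hilbert \<Rightarrow> 'a) \<Rightarrow> ('a \<Rightarrow> 'a) \<Rightarrow> bool"
  where "bicommutes T A \<longleftrightarrow> bounded_linear A \<and>
    (\<forall>Z. bounded_linear Z \<longrightarrow> (\<forall>x. Z (T x) = T (Z x)) \<longrightarrow> (\<forall>x. Z (A x) = A (Z x)))"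

lemma bicommutesD:
  "bicommutes T A \<Longrightarrow> bounded_linear Z \<Longrightarrow> (\<And>x. Z (T x) = T (Z x)) \<Longrightarrow> Z (A x) = A (Z x)"
  by (simp add: bicommutes_def)

lemma bicommutes_self: "bounded_linear T \<Longrightarrow> bicommutes T T"
  by (simp add: bicommutes_def)

lemma bicommutes_commute:
  assumes A: "bicommutes T A" and B: "bicommutes T B" and T: "bounded_linear T"
  shows "A (B x) = B (A x)"
proof -
  have "A (T x) = T (A x)" for x by (rule bicommutesD[OF A T, symmetric]) simp
  then show ?thesis by (intro bicommutesD[OF B]) (use A in \<open>simp_all add: bicommutes_def\<close>)
qed

lemma
  assumes "selfadjoint X" "bicommutes T X"
  shows bicommutes_neg_projection: "bicommutes T (neg_projection X)"
    and bicommutes_sqrt_abs: "bicommutes T (sqrt_op (abs_op X))"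
proof -
  note N = orth_projection_bounded_linear[OF orth_projection_neg_projection[OF assms(1)]]
  note A = positive_abs_op[OF assms(1)]
  note D = selfadjoint_bounded_linear[OF positive_selfadjoint[OF positive_sqrt_op[OF A]]]
  show "bicommutes T (neg_projection X)"
    unfolding bicommutes_def
    using N neg_projection_commute[OF assms(1)] bicommutesD[OF assms(2)] by blast
  show "bicommutes T (sqrt_op (abs_op X))"
    unfolding bicommutes_def
    using D sqrt_op_commute[OF A] abs_op_commute[OF assms(1)] bicommutesD[OF assms(2)] by blast
qed

locale root_of_modulus =
  fixes X :: "'a::complex_hilbert \<Rightarrow> 'a"
  assumes X: "selfadjoint X"
begin

abbreviation "N \<equiv> neg_projection X"
abbreviation "D \<equiv> sqrt_op (abs_op X)"

lemma N: "orth_projection N" by (rule orth_projection_neg_projection[OF X])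

lemma positive_D: "positive D" by (rule positive_sqrt_op[OF positive_abs_op[OF X]])

lemma D: "selfadjoint D" by (rule positive_selfadjoint[OF positive_D])

lemmas N_maps = orth_projection_maps[OF N]
lemmas D_maps = bounded_clinear_maps[OF selfadjoint_bounded_clinear[OF D]]
lemmas X_maps = bounded_clinear_maps[OF selfadjoint_bounded_clinear[OF X]]
lemmas N_idem = orth_projection_idem[OF N]

lemma DD: "D (D x) = abs_op X x" by (rule sqrt_op_sqrt_op[OF positive_abs_op[OF X]])

lemma
  assumes Z: "bounded_linear Z" "\<And>x. Z (X x) = X (Z x)"
  shows N_commute: "Z (N x) = N (Z x)" and D_commute: "Z (D x) = D (Z x)"
proof -
  have "bicommutes X N" "bicommutes X D"
    using bicommutes_self[OF selfadjoint_bounded_linear[OF X]]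
    by (simp_all add: bicommutes_neg_projection bicommutes_sqrt_abs X)
  then show "Z (N x) = N (Z x)" "Z (D x) = D (Z x)" using Z by (simp_all add: bicommutesD)
qed

lemma XN: "X (N x) = N (X x)"
  by (rule N_commute[OF selfadjoint_bounded_linear[OF X] refl])

lemma ND: "N (D x) = D (N x)"
  by (rule D_commute[OF orth_projection_bounded_linear[OF N] XN[symmetric]])

lemma abs_op_eq: "abs_op X x = X x - 2 *\<^sub>R X (N x)"
proof -
  have A: "bounded_clinear (abs_op X)"
    by (rule selfadjoint_bounded_clinear[OF selfadjoint_abs_op[OF X]])
  have "abs_op X x = abs_op X (N x) + abs_op X (x - N x)"
    by (simp add: bounded_clinear_maps[OF A])
  also have "\<dots> = - X (N x) + X (x - N x)"
    using abs_op_neg_projection[OF X N_idem] abs_op_neg_projection_0[OF X, of "x - N x"]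
    by (simp add: N_maps N_idem)
  also have "\<dots> = X x - 2 *\<^sub>R X (N x)" by (simp add: X_maps scaleR_2)
  finally show ?thesis .
qed

text \<open>\<open>X = D J D\<close> with \<open>J = 1 - 2 N\<close>.\<close>

lemma X_eq: "X x = D (D x - 2 *\<^sub>R N (D x))"
  by (simp add: D_maps ND DD abs_op_eq X_maps N_idem scaleR_2)

lemma form_eq: "inner (X x) x = (norm (D x))\<^sup>2 - 2 * (norm (N (D x)))\<^sup>2"
  by (simp add: X_eq[of x] selfadjoint_inner[OF D] inner_diff_left power2_norm_eq_inner
      orth_projection_form[OF N])

lemma N_closure_range:
  assumes "w \<in> closure (range D)"
  shows "N w \<in> closure (range D)"
  unfolding closure_range_iff[OF D]
proof (intro allI impI)
  fix z assume "D z = 0"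
  then have "D (N z) = 0" by (simp add: N_maps flip: ND)
  then show "inner (N w) z = 0"
    using assms unfolding closure_range_iff[OF D]
    by (simp add: selfadjoint_inner[OF orth_projection_selfadjoint[OF N]])
qed

end


section \<open>Factorisation through the root\<close>

context root_of_modulus
begin

text \<open>
  If \<open>\<parallel>S x\<parallel>\<close> is not dominated by \<open>\<parallel>D x\<parallel>\<close> off the negative subspace, then \<open>x\<close> enlarges that
  subspace to one on which \<open>Y = X - S\<^sup>* S\<close> is negative.
\<close>

lemma dominated_by_root:
  assumes k: "\<nu>\<^sub>- X = enat k" and Y: "selfadjoint Y" "\<nu>\<^sub>- Y \<le> enat k"
    and S: "bounded_clinear (S :: 'a \<Rightarrow> 'b::complex_hilbert)"
    and form: "\<And>x. inner (Y x) x = inner (X x) x - (norm (S x))\<^sup>2"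
  shows "\<exists>c. \<forall>x. norm (S x) \<le> c * norm (D x)"
proof -
  obtain \<epsilon> where \<epsilon>: "\<epsilon> > 0" "\<And>x. N x = x \<Longrightarrow> inner (X x) x \<le> - \<epsilon> * (norm x)\<^sup>2"
    using neg_projection_coercive[OF X k] by blast
  obtain K where K: "\<And>x. norm (S x) \<le> norm x * K" "K \<ge> 0"
    using bounded_linear.nonneg_bounded[OF bounded_clinear_bounded_linear[OF S]] by blast
  note S_maps = bounded_clinear_maps[OF S]
  \<comment> \<open>On the range of \<open>N\<close> the spectral gap gives sqrt \<epsilon> ||p||
    \<le> ||D p||, and \<open>K\<close> bounds \<open>S\<close>.\<close>
  define C where "C = K / sqrt \<epsilon>"
  have C: "C \<ge> 0" using \<epsilon>(1) K(2) by (simp add: C_def)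
  have on_N: "norm (S p) \<le> C * norm (D p)" if p: "N p = p" for p
  proof -
    have "N (D p) = D p" by (simp add: ND p)
    then have "\<epsilon> * (norm p)\<^sup>2 \<le> (norm (D p))\<^sup>2"
      using \<epsilon>(2)[OF p] form_eq[of p] by simp
    then have "(sqrt \<epsilon> * norm p)\<^sup>2 \<le> (norm (D p))\<^sup>2"
      using \<epsilon>(1) by (simp add: power_mult_distrib)
    then have "sqrt \<epsilon> * norm p \<le> norm (D p)" by (rule power2_le_imp_le) simp
    then have "norm p \<le> norm (D p) / sqrt \<epsilon>"
      using \<epsilon>(1) by (simp add: pos_le_divide_eq mult.commute)
    then have "norm p * K \<le> norm (D p) / sqrt \<epsilon> * K" by (rule mult_right_mono[OF _ K(2)])
    then show ?thesis using K(1)[of p] by (simp add: C_def mult.commute)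
  qed
  have off_N: "norm (S x) \<le> (1 + C) * norm (D x)" if x: "N x = 0" for x
  proof -
    \<comment> \<open>Otherwise the form of \<open>Y\<close> would be negative on the negative
      subspace of \<open>X\<close> enlarged by \<open>x\<close>, of dimension k + 1.\<close>
    have "\<exists>p a. N p = p \<and> (p \<noteq> 0 \<or> a \<noteq> 0) \<and> 0 \<le> inner (Y (p + a *\<^sub>C x)) (p + a *\<^sub>C x)"
    proof (rule ccontr)
      assume neg: "\<not> ?thesis"
      have "enat (Suc k) \<le> \<nu>\<^sub>- Y"
      proof (rule Suc_le_neg_index[OF Y(1) bounded_clinear_ident])
        show "complex_vector.subspace (range N)"
          by (rule subspace_range[OF orth_projection_bounded_clinear[OF N]])
        show "cdim (range N) = enat k" using k by (simp add: neg_index_eq[OF X])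
        show "inner (Y (p + a *\<^sub>C x)) (p + a *\<^sub>C x) < 0" if "p \<in> range N" "p \<noteq> 0 \<or> a \<noteq> 0" for p a
          using neg that N_idem by (metis imageE not_le)
      qed
      then have "enat (Suc k) \<le> enat k" using Y(2) by (rule order_trans)
      then show False by simp
    qed
    then obtain p a where p: "N p = p" "p \<noteq> 0 \<or> a \<noteq> 0"
      and nonneg: "0 \<le> inner (Y (p + a *\<^sub>C x)) (p + a *\<^sub>C x)" by blast
    have a: "a \<noteq> 0"
    proof
      assume "a = 0"
      then have "inner (X p) p < 0" using p neg_projection_neg[OF X] by simp
      moreover have "0 \<le> inner (X p) p - (norm (S p))\<^sup>2" using nonneg \<open>a = 0\<close> by (simp add: form)
      ultimately show False by (smt (verit) zero_le_power2)
    qed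
    define q where "q = (1 / a) *\<^sub>C p"
    have Nq: "N q = q"
      by (simp add: q_def bounded_clinear_scaleC[OF orth_projection_bounded_clinear[OF N]] p)
    have "p + a *\<^sub>C x = a *\<^sub>C (q + x)" using a by (simp add: q_def scaleC_add_right scaleC_scaleC)
    then have "0 \<le> (cmod a)\<^sup>2 * inner (Y (q + x)) (q + x)"
      using nonneg by (simp add: form_scaleC[OF selfadjoint_bounded_clinear[OF Y(1)]])
    then have "0 \<le> inner (Y (q + x)) (q + x)" using a by (simp add: zero_le_mult_iff)
    then have le: "(norm (S (q + x)))\<^sup>2 \<le> (norm (D (q + x)))\<^sup>2 - 2 * (norm (N (D (q + x))))\<^sup>2"
      unfolding form form_eq by simp
    have ND': "N (D (q + x)) = D q" by (simp add: ND N_maps Nq x)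
    have "(norm (D (q + x)))\<^sup>2 = (norm (D q))\<^sup>2 + (norm (D x))\<^sup>2"
      using orth_projection_pythagoras[OF N, of "D (q + x)"] unfolding ND' by (simp add: D_maps)
    \<comment> \<open>\<open>D q\<close> is exactly the negative component of
      \<open>D (q + x)\<close>, so the form of \<open>X\<close> there is ||D x||^2 - ||D q||^2.
      Hence ||D x|| bounds both \<open>S (q + x)\<close> and \<open>D q\<close>, and the latter
      bounds \<open>S q\<close> by the estimate on the range of \<open>N\<close>.\<close>
    then have le': "(norm (S (q + x)))\<^sup>2 + (norm (D q))\<^sup>2 \<le> (norm (D x))\<^sup>2"
      using le unfolding ND' by simp
    then have "(norm (S (q + x)))\<^sup>2 \<le> (norm (D x))\<^sup>2" by (smt (verit) zero_le_power2)
    then have 1: "norm (S (q + x)) \<le> norm (D x)" by (rule power2_le_imp_le) simp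
    have "(norm (D q))\<^sup>2 \<le> (norm (D x))\<^sup>2" using le' by (smt (verit) zero_le_power2)
    then have 2: "norm (D q) \<le> norm (D x)" by (rule power2_le_imp_le) simp
    have "norm (S x) \<le> norm (S (q + x)) + norm (S q)"
      using norm_triangle_ineq4[of "S (q + x)" "S q"] by (simp add: S_maps)
    also have "\<dots> \<le> norm (D x) + C * norm (D x)"
      using 1 on_N[OF Nq] mult_left_mono[OF 2 C] by linarith
    finally show ?thesis by (simp add: distrib_right)
  qed
  have "norm (S x) \<le> (1 + 2 * C) * norm (D x)" for x
  proof -
    have "norm (S x) \<le> norm (S (N x)) + norm (S (x - N x))"
      using norm_triangle_ineq[of "S (N x)" "S (x - N x)"] by (simp add: S_maps)
    also have "\<dots> \<le> C * norm (D (N x)) + (1 + C) * norm (D (x - N x))"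
      by (intro add_mono on_N off_N) (simp_all add: N_maps N_idem)
    also have "\<dots> \<le> C * norm (D x) + (1 + C) * norm (D x)"
    proof (intro add_mono mult_left_mono)
      show "norm (D (N x)) \<le> norm (D x)"
        unfolding ND[symmetric] by (rule orth_projection_norm_le[OF N])
      show "norm (D (x - N x)) \<le> norm (D x)"
        using orth_projection_norm_le[OF orth_projection_complement[OF N], of "D x"]
        by (simp add: D_maps ND)
    qed (use C in simp_all)
    finally show ?thesis by (simp add: algebra_simps)
  qed
  then show ?thesis by blast
qed

end

text \<open>Representing x \<mapsto> <S x, y> through \<open>D\<close> for each \<open>y\<close>
  produces the adjoint \<open>W\<close> of the factor first, with values normalised to lie in the
  closure of ran D. This normalisation fixes \<open>V\<close> on ker D, where \<open>V D = S\<close>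
  says nothing.\<close>

lemma factor_through_range:
  assumes D: "selfadjoint D" and S: "bounded_clinear S" and c: "\<And>x. norm (S x) \<le> c * norm (D x)"
  shows "\<exists>V. bounded_clinear V \<and> (\<forall>x. V (D x) = S x) \<and> (\<forall>y. cadjoint V y \<in> closure (range D))"
proof -
  interpret D: bounded_linear D by (rule selfadjoint_bounded_linear[OF D])
  interpret S: bounded_linear S by (rule bounded_clinear_bounded_linear[OF S])
  have "\<exists>w. w \<in> closure (range D) \<and> (\<forall>x. inner w (D x) = inner (S x) y)" for y
  proof -
    have "\<exists>w\<in>closure (range D). \<forall>x. inner w (D x) = inner (S x) y"
    proof (rule functional_through_range[where c = "c * norm y"])
      show "linear (\<lambda>x. inner (S x) y)"
        by (rule linearI) (simp_all add: S.add S.scaleR inner_add_left)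
      have "\<bar>inner (S x) y\<bar> \<le> norm (S x) * norm y" for x by (rule Cauchy_Schwarz_ineq2)
      also have "norm (S x) * norm y \<le> c * norm (D x) * norm y" for x
        by (intro mult_right_mono c) simp
      finally show "\<bar>inner (S x) y\<bar> \<le> c * norm y * norm (D x)" for x by (simp add: mult_ac)
    qed (rule D.linear_axioms)
    then show ?thesis by blast
  qed
  then obtain W where W: "\<And>y. W y \<in> closure (range D)" "\<And>x y. inner (W y) (D x) = inner (S x) y"
    by metis
  have eqI: "W y = w" if "w \<in> closure (range D)" "\<And>x. inner w (D x) = inner (S x) y" for w y
    by (rule inner_closure_eqI[OF W(1) that(1)]) (simp add: W(2) that(2))
  note cl = closure_range_iff[OF D]
  have "bounded_linear W"
  proof (rule bounded_linear_intro[where K = "\<bar>c\<bar>"])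
    show "W (x + y) = W x + W y" for x y
      by (rule eqI) (use W in \<open>simp_all add: cl inner_add_left inner_add_right\<close>)
    show "W (r *\<^sub>R y) = r *\<^sub>R W y" for r y
      by (rule eqI) (use W in \<open>simp_all add: cl\<close>)
    show "norm (W y) \<le> norm y * \<bar>c\<bar>" for y
    proof (cases "W y = 0")
      case False
      \<comment> \<open>The estimate is available on ran D only; it extends to the closure by
        continuity and is then tested at \<open>W y\<close> itself.\<close>
      have "closed {u. inner (W y) u \<le> \<bar>c\<bar> * norm y * norm u}"
        by (intro closed_Collect_le continuous_intros)
      moreover have "inner (W y) (D x) \<le> \<bar>c\<bar> * norm y * norm (D x)" for x
      proof -
        have "inner (S x) y \<le> norm (S x) * norm y" by (rule norm_cauchy_schwarz)
        also have "\<dots> \<le> c * norm (D x) * norm y" by (intro mult_right_mono c) simp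
        also have "\<dots> \<le> \<bar>c\<bar> * norm (D x) * norm y" by (intro mult_right_mono) simp_all
        finally show ?thesis by (simp add: W(2) mult_ac)
      qed
      ultimately have "closure (range D) \<subseteq> {u. inner (W y) u \<le> \<bar>c\<bar> * norm y * norm u}"
        by (intro closure_minimal) auto
      then have "inner (W y) (W y) \<le> \<bar>c\<bar> * norm y * norm (W y)" using W(1) by blast
      then have "norm (W y) * norm (W y) \<le> \<bar>c\<bar> * norm y * norm (W y)"
        by (simp only: power2_norm_eq_inner[symmetric] power2_eq_square)
      then show ?thesis using False by (simp add: mult.commute)
    qed simp
  qed
  moreover have "W (\<i> *\<^sub>C y) = \<i> *\<^sub>C W y" for y
  proof (rule eqI)
    show "\<i> *\<^sub>C W y \<in> closure (range D)"
      unfolding cl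
    proof (intro allI impI)
      fix z assume "D z = 0"
      then have "D (\<i> *\<^sub>C z) = 0"
        by (simp add: bounded_clinear_scaleC[OF selfadjoint_bounded_clinear[OF D]])
      then have "inner (W y) (\<i> *\<^sub>C z) = 0" using W(1) by (simp add: cl)
      then show "inner (\<i> *\<^sub>C W y) z = 0" by (simp add: inner_ii_right)
    qed
    fix x
    have "inner (\<i> *\<^sub>C W y) (D x) = - inner (W y) (D (\<i> *\<^sub>C x))"
      by (simp add: bounded_clinear_scaleC[OF selfadjoint_bounded_clinear[OF D]] inner_ii_right)
    then show "inner (\<i> *\<^sub>C W y) (D x) = inner (S x) (\<i> *\<^sub>C y)"
      by (simp add: W(2) bounded_clinear_scaleC[OF S] inner_ii_right)
  qed
  ultimately have Wcl: "bounded_clinear W" by (rule bounded_clinearI_ii)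
  define V where "V = cadjoint W"
  have Vcl: "bounded_clinear V" unfolding V_def by (rule bounded_clinear_cadjoint[OF Wcl])
  have "inner (V x) y = inner x (W y)" for x y
    using inner_cadjoint[OF Wcl, of y x] by (simp add: V_def inner_commute)
  then have adj: "cadjoint V = W" and inner_V: "inner (V x) y = inner (W y) x" for x y
    by (auto intro: cadjoint_eqI_inner[OF Vcl Wcl] simp: inner_commute)
  have "V (D x) = S x" for x
  proof -
    have "inner (V (D x) - S x) y = 0" for y
      by (simp add: inner_diff_left inner_V W(2))
    from this[of "V (D x) - S x"] show ?thesis by simp
  qed
  with Vcl adj W(1) show ?thesis by auto
qed

text \<open>By \<open>adj\<close>, \<open>V\<close> vanishes on ker D, so it extends the quotient
  and its closed graph contains the closure. Conversely, splitting a vector along the closed range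
  and the kernel and approximating the first component from ran D reaches every point of the
  graph.\<close>

lemma is_clos_mp_quotientI:
  assumes D: "selfadjoint D" and V: "bounded_clinear V" and VD: "\<And>x. V (D x) = S x"
    and adj: "\<And>y. cadjoint V y \<in> closure (range D)"
  shows "is_clos_mp_quotient S D V"
proof -
  interpret V: bounded_linear V by (rule bounded_clinear_bounded_linear[OF V])
  note D_maps = bounded_clinear_maps[OF selfadjoint_bounded_clinear[OF D]]
  have V0: "V z = 0" if "D z = 0" for z
  proof -
    have "inner (V z) (V z) = inner z (cadjoint V (V z))" by (rule inner_cadjoint[OF V])
    also have "\<dots> = 0"
      using range_orthogonal_kernel[OF D adj that] by (simp add: inner_commute)
    finally show ?thesis by simp
  qed
  let ?G = "{(u, S x) | u x. (u, x) \<in> mp_inverse_graph D}"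
  have "graph_of V = closure ?G"
  proof (rule antisym)
    have "closed {z. snd z = V (fst z)}"
      by (intro closed_Collect_eq continuous_intros
          continuous_on_compose2[OF linear_continuous_on[OF V.bounded_linear_axioms, of UNIV]]) auto
    moreover have "graph_of V = {z. snd z = V (fst z)}"
      by (auto simp: graph_of_def)
    ultimately have "closed (graph_of V)" by simp
    moreover have "?G \<subseteq> graph_of V"
      by (auto simp: mp_inverse_graph_def graph_of_def V.add VD V0)
    ultimately show "closure ?G \<subseteq> graph_of V" by (rule closure_minimal[rotated])
  next
    show "graph_of V \<subseteq> closure ?G"
    proof
      fix g assume "g \<in> graph_of V"
      then obtain u where g: "g = (u, V u)" by (auto simp: graph_of_def)
      obtain w where w: "w \<in> closure (range D)" "D w = D u"
        using range_kernel_decomposition[OF D] by blast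
      define z where "z = u - w"
      have Dz: "D z = 0" by (simp add: z_def D_maps w(2))
      obtain a where a: "\<And>n. a n \<in> range D" "a \<longlonglongrightarrow> w"
        using w(1) by (auto simp: closure_sequential)
      \<comment> \<open>The Moore-Penrose inverse takes the preimage orthogonal to the kernel, so
        arbitrary preimages are replaced by their components in the closed range.\<close>
      have "\<exists>x. x \<in> closure (range D) \<and> D x = a n" for n
      proof -
        obtain x where "a n = D x" using a(1) by blast
        then show ?thesis using range_kernel_decomposition[OF D, of x] by auto
      qed
      then obtain x where x: "\<And>n. x n \<in> closure (range D)" "\<And>n. D (x n) = a n" by metis
      have orth: "cinner (x n) v = 0" if "D v = 0" for n v
      proof -
        have "D (\<i> *\<^sub>C v) = 0"
          using that by (simp add: bounded_clinear_scaleC[OF selfadjoint_bounded_clinear[OF D]])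
        then have "inner (x n) v = 0" "inner (x n) (\<i> *\<^sub>C v) = 0"
          using range_orthogonal_kernel[OF D x(1)] that by blast+
        then show ?thesis by (simp add: cinner_eq_Complex inner_ii_right complex_eq_iff)
      qed
      have "(D (x n) + z, S (x n)) \<in> ?G" for n
        unfolding mp_inverse_graph_def using orth Dz by blast
      moreover have "(\<lambda>n. (D (x n) + z, S (x n))) \<longlonglongrightarrow> (w + z, V w)"
        unfolding x(2) VD[symmetric] by (intro tendsto_Pair tendsto_add a tendsto_const V.tendsto)
      moreover have "(w + z, V w) = g"
        using V0[OF Dz] by (simp add: g z_def V.diff)
      ultimately show "g \<in> closure ?G"
        unfolding closure_sequential by (metis (no_types, lifting))
    qed
  qed
  with V show ?thesis by (simp add: is_clos_mp_quotient_def)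
qed

context root_of_modulus
begin

text \<open>
  \<open>J - V\<^sup>* V\<close> and \<open>1 - V J V\<^sup>*\<close> are the Schur complements of \<open>[[J, V\<^sup>*], [V, 1]]\<close>: completing
  the square in either variable turns negativity of \<open>1 - V J V\<^sup>*\<close> into an additional negative square
  of \<open>J - V\<^sup>* V\<close>.
\<close>

lemma sandwiched_sign_le:
  assumes k: "\<nu>\<^sub>- X = enat k" and Y: "selfadjoint Y" "\<nu>\<^sub>- Y \<le> enat k"
    and V: "bounded_clinear V" and adj: "\<And>y. cadjoint V y \<in> closure (range D)"
    and form: "\<And>x. inner (Y x) x = inner (X x) x - (norm (V (D x)))\<^sup>2"
  shows "(norm (cadjoint V y))\<^sup>2 - 2 * (norm (N (cadjoint V y)))\<^sup>2 \<le> (norm y)\<^sup>2"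
proof (rule ccontr)
  define w where "w = cadjoint V y"
  \<comment> \<open>\<open>f = J w\<close> is the critical point: h u - 2 <u, a w> = h (u - a f) -
    |a|^2 h w for the form \<open>h\<close> of \<open>J\<close>. As only vectors in ran D are
    admissible, \<open>f\<close> is approximated by \<open>D g\<close> with squared error below the
    excess \<open>\<delta>\<close>.\<close>
  define f where "f = w - 2 *\<^sub>R N w"
  define \<delta> where "\<delta> = (norm w)\<^sup>2 - 2 * (norm (N w))\<^sup>2 - (norm y)\<^sup>2"
  assume "\<not> ?thesis"
  then have \<delta>: "\<delta> > 0" by (simp add: \<delta>_def w_def)
  have w: "w \<in> closure (range D)" unfolding w_def by (rule adj)
  have "f \<in> closure (range D)"
    using w N_closure_range[OF w] unfolding f_def closure_range_iff[OF D]
    by (simp add: inner_diff_left)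
  then obtain u where "u \<in> range D" "dist u f < sqrt \<delta>"
    using \<delta> unfolding closure_approachable by (metis real_sqrt_gt_zero)
  then obtain g where g: "norm (D g - f) < sqrt \<delta>" by (auto simp: dist_norm)
  define e where "e = D g - f"
  have e: "(norm e)\<^sup>2 < \<delta>"
  proof -
    have "(norm e)\<^sup>2 < (sqrt \<delta>)\<^sup>2" using g by (intro power_strict_mono) (simp_all add: e_def)
    then show ?thesis using \<delta> by simp
  qed
  define h where "h v = inner v v - 2 * inner (N v) v" for v
  have h_N: "h v \<le> (norm (v - N v))\<^sup>2" for v
    using orth_projection_pythagoras[OF N, of v] orth_projection_form[OF N, of v]
    by (simp add: h_def flip: power2_norm_eq_inner)
  have sym: "inner (N u) v = inner u (N v)" for u v
    by (rule selfadjoint_inner[OF orth_projection_selfadjoint[OF N]])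
  have h_w: "h w = \<delta> + (norm y)\<^sup>2"
    by (simp add: h_def \<delta>_def orth_projection_form[OF N] power2_norm_eq_inner)
  note scal = bounded_clinear_scaleC[OF orth_projection_bounded_clinear[OF N]]
  have "enat (Suc k) \<le> \<nu>\<^sub>- Y"
  proof (rule Suc_le_neg_index[OF Y(1) bounded_clinear_ident])
    show "complex_vector.subspace (range N)"
      by (rule subspace_range[OF orth_projection_bounded_clinear[OF N]])
    show "cdim (range N) = enat k" using k by (simp add: neg_index_eq[OF X])
    fix p and a :: complex
    assume "p \<in> range N" and pa: "p \<noteq> 0 \<or> a \<noteq> 0"
    then have p: "N p = p" by (auto simp: N_idem)
    show "inner (Y (p + a *\<^sub>C g)) (p + a *\<^sub>C g) < 0"
    proof (cases "a = 0")
      case True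
      then show ?thesis
        using pa neg_projection_neg[OF X p] unfolding form by (smt (verit) complex_vector.scale_zero_left
            add.right_neutral zero_le_power2)
    next
      case False
      define u where "u = D (p + a *\<^sub>C g)"
      define r where "r = D p + a *\<^sub>C e"
      have u: "u = r + a *\<^sub>C f"
        by (simp add: u_def r_def e_def D_maps
            bounded_clinear_scaleC[OF selfadjoint_bounded_clinear[OF D]] scaleC_diff_right)
      have Nf: "f - 2 *\<^sub>R N f = w"
        by (simp add: f_def N_maps N_idem scaleR_2)
      have af: "a *\<^sub>C f = a *\<^sub>C w - 2 *\<^sub>R N (a *\<^sub>C w)"
        by (simp add: f_def scal scaleC_diff_right scaleR_2 scaleC_add_right)
      have ww: "inner (a *\<^sub>C w) (a *\<^sub>C w) - 2 * inner (N (a *\<^sub>C w)) (a *\<^sub>C w)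
          = (cmod a)\<^sup>2 * h w"
        using form_scaleC[OF orth_projection_bounded_clinear[OF N], of a w]
          form_scaleC[OF bounded_clinear_ident, of a w]
        by (simp add: h_def right_diff_distrib)
      have hu: "h u - 2 * inner u (a *\<^sub>C w) = h r - (cmod a)\<^sup>2 * h w"
      proof -
        define b where "b = a *\<^sub>C w"
        have hJ: "h v = inner (v - 2 *\<^sub>R N v) v" for v
          by (simp add: h_def inner_diff_left)
        have u': "u = r + (b - 2 *\<^sub>R N b)" unfolding u af b_def ..
        have Ju: "u - 2 *\<^sub>R N u = (r - 2 *\<^sub>R N r) + b"
          unfolding u' by (simp add: N_maps N_idem scaleR_2)
        have "h u = inner (r - 2 *\<^sub>R N r) u + inner b u"
          unfolding hJ[of u] Ju by (rule inner_add_left)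
        also have "inner (r - 2 *\<^sub>R N r) u = h r + inner (r - 2 *\<^sub>R N r) (b - 2 *\<^sub>R N b)"
          unfolding hJ[of r] u' by (rule inner_add_right)
        also have "inner (r - 2 *\<^sub>R N r) (b - 2 *\<^sub>R N b) = inner r b"
          by (simp add: inner_diff_left inner_diff_right sym N_idem)
        finally have "h u - 2 * inner u b = h r + inner b r - inner b u"
          by (simp add: inner_commute)
        also have "inner b u = inner b r + h b"
          unfolding u' hJ by (simp add: inner_add_right inner_commute)
        also have "h b = (cmod a)\<^sup>2 * h w"
          using ww unfolding b_def h_def .
        finally show ?thesis by (simp add: b_def)
      qed
      \<comment> \<open>Completing the square in the second variable, at \<open>a y\<close>, trades
        \<open>V u\<close> for a pairing with \<open>w\<close>.\<close>
      have Vu: "- (norm (V u))\<^sup>2 \<le> - 2 * inner u (a *\<^sub>C w) + (cmod a)\<^sup>2 * (norm y)\<^sup>2"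
      proof -
        have "0 \<le> inner (V u - a *\<^sub>C y) (V u - a *\<^sub>C y)" by (rule inner_ge_zero)
        also have "\<dots> = (norm (V u))\<^sup>2 - 2 * inner (V u) (a *\<^sub>C y) + (norm (a *\<^sub>C y))\<^sup>2"
          by (simp add: inner_diff_left inner_diff_right inner_commute power2_norm_eq_inner)
        also have "inner (V u) (a *\<^sub>C y) = inner u (a *\<^sub>C w)"
          by (simp add: inner_cadjoint[OF V] w_def
              bounded_clinear_scaleC[OF bounded_clinear_cadjoint[OF V]])
        also have "(norm (a *\<^sub>C y))\<^sup>2 = (cmod a)\<^sup>2 * (norm y)\<^sup>2"
          by (simp add: norm_scaleC power_mult_distrib)
        finally show ?thesis by simp
      qed
      \<comment> \<open>\<open>D p\<close> lies in the range of \<open>N\<close> and drops out, so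
        the whole negative subspace can be adjoined at no cost.\<close>
      have "r - N r = a *\<^sub>C (e - N e)"
        by (simp add: r_def N_maps ND p scal scaleC_diff_right)
      then have "(norm (r - N r))\<^sup>2 \<le> (cmod a)\<^sup>2 * (norm e)\<^sup>2"
        using orth_projection_norm_le[OF orth_projection_complement[OF N], of e]
        by (simp add: norm_scaleC power_mult_distrib mult_left_mono power_mono)
      also have "\<dots> < (cmod a)\<^sup>2 * \<delta>" using e False by simp
      finally have "h r < (cmod a)\<^sup>2 * \<delta>" using h_N[of r] by simp
      moreover have "inner (Y (p + a *\<^sub>C g)) (p + a *\<^sub>C g) = h u - (norm (V u))\<^sup>2"
        unfolding form form_eq
        by (simp add: u_def h_def orth_projection_form[OF N] power2_norm_eq_inner)
      ultimately show ?thesis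
        using hu Vu by (simp add: h_w distrib_left)
    qed
  qed
  then have "enat (Suc k) \<le> enat k" using Y(2) by (rule order_trans)
  then show False by simp
qed

end

section \<open>Block operators\<close>

lemma block_op_apply: "block_op A11 A12 A21 A22 (x, y) = (A11 x + A12 y, A21 x + A22 y)"
  by (simp add: block_op_def)

lemma bounded_clinear_block_op:
  assumes "bounded_clinear A11" "bounded_clinear A12" "bounded_clinear A21" "bounded_clinear A22"
  shows "bounded_clinear (block_op A11 A12 A21 A22)"
proof -
  have eq: "block_op A11 A12 A21 A22
      = (\<lambda>z. (A11 (fst z) + A12 (snd z), A21 (fst z) + A22 (snd z)))"
    by (simp add: block_op_def case_prod_unfold)
  note bl = assms[THEN bounded_clinear_bounded_linear]
  note comp = bounded_linear_compose[OF _ bounded_linear_fst] bounded_linear_compose[OF _ bounded_linear_snd]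
  have "bounded_linear (block_op A11 A12 A21 A22)"
    unfolding eq
    by (rule bounded_linear_Pair;
        rule bounded_linear_add[OF comp(1)[OF bl(1)] comp(2)[OF bl(2)]]
          bounded_linear_add[OF comp(1)[OF bl(3)] comp(2)[OF bl(4)]])
  then show ?thesis
    by (simp add: bounded_clinear_def eq scaleC_prod_def bounded_clinear_scaleC[OF assms(1)]
        bounded_clinear_scaleC[OF assms(2)] bounded_clinear_scaleC[OF assms(3)]
        bounded_clinear_scaleC[OF assms(4)] scaleC_add_right)
qed

lemma selfadjoint_block_op:
  assumes A11: "selfadjoint A11" and A21: "bounded_clinear A21" and A22: "selfadjoint A22"
  shows "selfadjoint (block_op A11 (cadjoint A21) A21 A22)"
  unfolding selfadjoint_iff
proof (intro conjI allI)
  show "bounded_clinear (block_op A11 (cadjoint A21) A21 A22)"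
    by (intro bounded_clinear_block_op selfadjoint_bounded_clinear bounded_clinear_cadjoint assms)
  have adj: "inner (cadjoint A21 y) x = inner y (A21 x)" for x y
    using inner_cadjoint[OF A21, of x y] by (simp add: inner_commute)
  fix z z' :: "'a \<times> 'b"
  obtain x y x' y' where "z = (x, y)" "z' = (x', y')" by (metis surj_pair)
  then show "inner (block_op A11 (cadjoint A21) A21 A22 z) z'
      = inner z (block_op A11 (cadjoint A21) A21 A22 z')"
    by (simp add: block_op_apply inner_add_left inner_add_right selfadjoint_inner[OF A11]
        selfadjoint_inner[OF A22] adj inner_cadjoint[OF A21])
qed

text \<open>Selfadjointness forces the upper right entry, so completions are the same as selfadjoint
  operators with prescribed first column.\<close>

lemma block_op_iff_first_column:
  assumes A: "selfadjoint A" and A11: "bounded_clinear A11" and A21: "bounded_clinear A21"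
  shows "(\<exists>A22. A = block_op A11 (cadjoint A21) A21 A22) \<longleftrightarrow> (\<forall>x. A (x, 0) = (A11 x, A21 x))"
proof
  note A_maps = bounded_clinear_maps[OF selfadjoint_bounded_clinear[OF A]]
  note adj_maps = bounded_clinear_maps[OF bounded_clinear_cadjoint[OF A21]]
  assume "\<exists>A22. A = block_op A11 (cadjoint A21) A21 A22"
  then obtain A22 where A_eq: "A = block_op A11 (cadjoint A21) A21 A22" by blast
  have "A (0, 0) = (0, 0)" using A_maps(4) by (simp add: zero_prod_def)
  then have "A22 0 = 0"
    by (simp add: A_eq block_op_apply bounded_clinear_map_0[OF A21])
  then show "\<forall>x. A (x, 0) = (A11 x, A21 x)"
    by (simp add: A_eq block_op_apply adj_maps)
next
  note A_maps = bounded_clinear_maps[OF selfadjoint_bounded_clinear[OF A]]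
  assume col: "\<forall>x. A (x, 0) = (A11 x, A21 x)"
  have "fst (A (0, y)) = cadjoint A21 y" for y
  proof -
    have "inner (fst (A (0, y))) x = inner (cadjoint A21 y) x" for x
    proof -
      have "inner (A (0, y)) (x, 0) = inner (0, y) (A (x, 0))" by (rule selfadjoint_inner[OF A])
      then have "inner (fst (A (0, y))) x = inner y (A21 x)"
        by (simp add: inner_prod_def col)
      then show ?thesis using inner_cadjoint[OF A21, of x y] by (simp add: inner_commute)
    qed
    then show ?thesis using vector_eq_rdot by blast
  qed
  then have "A (x, y) = block_op A11 (cadjoint A21) A21 (\<lambda>y. snd (A (0, y))) (x, y)" for x y
    using A_maps(1)[of "(x, 0)" "(0, y)"] by (simp add: block_op_apply col prod_eq_iff)
  then have "A z = block_op A11 (cadjoint A21) A21 (\<lambda>y. snd (A (0, y))) z" for z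
    by (metis surj_pair)
  then show "\<exists>A22. A = block_op A11 (cadjoint A21) A21 A22" by (intro exI ext)
qed

lemma completions_iff:
  assumes "bounded_clinear A11" "bounded_clinear A21"
  shows "A \<in> completions A11 A21 \<longleftrightarrow>
    selfadjoint A \<and> (\<forall>x. A (x, 0) = (A11 x, A21 x)) \<and> \<nu>\<^sub>- A = \<nu>\<^sub>- A11"
  using block_op_iff_first_column[OF _ assms] by (auto simp: completions_def)

lemma bounded_clinear_first_component: "bounded_clinear (\<lambda>x. (x, 0))"
proof -
  have "bounded_linear (\<lambda>x::'a. (x, 0::'b))"
    by (rule bounded_linear_Pair[OF bounded_linear_ident bounded_linear_zero])
  then show ?thesis by (simp add: bounded_clinear_def scaleC_prod_def)
qed

lemma neg_index_compression_le:
  assumes "selfadjoint A11" "selfadjoint A" "\<And>x. inner (A (x, 0)) (x, 0) = inner (A11 x) x"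
  shows "\<nu>\<^sub>- A11 \<le> \<nu>\<^sub>- A"
  by (rule neg_index_comparison[OF assms(1,2) bounded_clinear_first_component]) (simp add: assms(3))


section \<open>The factors of \<open>1 - T\<^sup>2\<close>\<close>

locale selfadjoint_operator =
  fixes T :: "'a::complex_hilbert \<Rightarrow> 'a"
  assumes T: "selfadjoint T"
begin

abbreviation "X \<equiv> \<lambda>x. x - T (T x)"
abbreviation "B \<equiv> \<lambda>x. x + T x"
abbreviation "C \<equiv> \<lambda>x. x - T x"

lemmas T_maps = bounded_clinear_maps[OF selfadjoint_bounded_clinear[OF T]]

sublocale X: root_of_modulus X
  by standard (intro selfadjoint_sub selfadjoint_ident selfadjoint_square T)

sublocale B: root_of_modulus B
  by standard (intro selfadjoint_add selfadjoint_ident T)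

sublocale C: root_of_modulus C
  by standard (intro selfadjoint_sub selfadjoint_ident T)

lemma bicommutes_factors: "bicommutes T B" "bicommutes T C"
  using selfadjoint_bounded_linear[OF B.X] selfadjoint_bounded_linear[OF C.X]
  by (auto simp: bicommutes_def linear_add linear_diff bounded_linear.linear)

lemmas bicommutes_T = bicommutes_self[OF selfadjoint_bounded_linear[OF T]]
lemmas bicommutes_B_N = bicommutes_neg_projection[OF B.X bicommutes_factors(1)]
lemmas bicommutes_C_N = bicommutes_neg_projection[OF C.X bicommutes_factors(2)]
lemmas bicommutes_B_D = bicommutes_sqrt_abs[OF B.X bicommutes_factors(1)]
lemmas bicommutes_C_D = bicommutes_sqrt_abs[OF C.X bicommutes_factors(2)]

lemmas factors_commute = bicommutes_commute[OF _ _ selfadjoint_bounded_linear[OF T]]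

lemma B_C: "B (C x) = X x"
  by (simp add: T_maps)

text \<open>The forms of 1 + T and 1 - T add up to twice the squared norm, so no nonzero vector is
  negative for both. Since the projections commute, their product maps into both negative
  subspaces.\<close>

lemma
  shows B_N_C_N: "B.N (C.N x) = 0" and C_N_B_N: "C.N (B.N x) = 0"
proof -
  note comm = factors_commute[OF bicommutes_B_N bicommutes_C_N]
  show 1: "B.N (C.N x) = 0"
  proof (rule ccontr)
    let ?y = "B.N (C.N x)"
    assume "?y \<noteq> 0"
    then have "inner (B ?y) ?y < 0"
      by (intro neg_projection_neg[OF B.X]) (simp_all add: B.N_idem)
    moreover have "inner (C ?y) ?y < 0"
      using \<open>?y \<noteq> 0\<close> by (intro neg_projection_neg[OF C.X]) (simp_all add: C.N_idem comm)
    ultimately have "2 * inner ?y ?y < 0" by (simp add: inner_add_left inner_diff_left)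
    then show False using inner_ge_zero[of ?y] by linarith
  qed
  show "C.N (B.N x) = 0" using 1 comm by simp
qed

lemma abs_op_X: "abs_op X = (\<lambda>x. abs_op B (abs_op C x))"
proof -
  have "abs_op (\<lambda>x. B (C x)) = (\<lambda>x. abs_op B (abs_op C x))"
    by (rule abs_op_compose[OF B.X C.X]) (simp add: T_maps)
  then show ?thesis by (simp only: B_C)
qed

lemma abs_commute: "abs_op B (abs_op C x) = abs_op C (abs_op B x)"
proof -
  have 1: "C (abs_op B x) = abs_op B (C x)" for x
    by (rule abs_op_commute[OF B.X selfadjoint_bounded_linear[OF C.X]]) (simp add: T_maps)
  show ?thesis
    by (rule abs_op_commute[OF C.X selfadjoint_bounded_linear[OF selfadjoint_abs_op[OF B.X]]])
      (rule 1[symmetric])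
qed

lemma D_eq: "X.D x = B.D (C.D x)"
proof -
  have "sqrt_op (\<lambda>x. abs_op B (abs_op C x)) = (\<lambda>x. B.D (C.D x))"
    by (rule sqrt_op_compose[OF positive_abs_op[OF B.X] positive_abs_op[OF C.X] abs_commute])
  then show ?thesis by (simp only: abs_op_X)
qed

text \<open>Comes from 1 - T^2 = 2 (1 + T) - (1 + T)^2 and passes negativity from \<open>B\<close>
  to \<open>X\<close>.\<close>

lemma X_form_B: "inner (X x) x = 2 * inner (B x) x - (norm (B x))\<^sup>2"
  by (simp add: power2_norm_eq_inner inner_add_left inner_add_right inner_diff_left
      inner_diff_right selfadjoint_inner[OF T])

lemma X_form_C: "inner (X x) x = 2 * inner (C x) x - (norm (C x))\<^sup>2"
  by (simp add: power2_norm_eq_inner inner_diff_left inner_diff_right selfadjoint_inner[OF T])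

lemma is_neg_projection_X: "is_neg_projection X (\<lambda>x. B.N x + C.N x)"
  unfolding is_neg_projection_def
proof (intro conjI allI impI)
  note B_comm = factors_commute[OF bicommutes_B_N bicommutes_T]
    and C_comm = factors_commute[OF bicommutes_C_N bicommutes_T]
  note maps = B.N_maps C.N_maps T_maps
  note N_simps = maps B.N_idem C.N_idem B_N_C_N C_N_B_N B_comm C_comm
  show "orth_projection (\<lambda>x. B.N x + C.N x)"
    unfolding orth_projection_def
  proof (intro conjI allI)
    show "selfadjoint (\<lambda>x. B.N x + C.N x)"
      by (intro selfadjoint_add orth_projection_selfadjoint B.N C.N)
  qed (simp add: N_simps)
  show "B.N (X x) + C.N (X x) = X (B.N x + C.N x)" for x by (simp add: N_simps)
  show "inner (X x) x < 0" if x: "B.N x + C.N x = x" "x \<noteq> 0" for x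
  proof -
    let ?b = "B.N x" and ?c = "C.N x"
    have orth: "inner (X ?b) ?c = 0" "inner (X ?c) ?b = 0"
    proof -
      have "X ?b = B.N (X ?b)" "X ?c = C.N (X ?c)" by (simp_all add: N_simps)
      then show "inner (X ?b) ?c = 0" "inner (X ?c) ?b = 0"
        using selfadjoint_inner[OF orth_projection_selfadjoint[OF B.N], of "X ?b" ?c]
          selfadjoint_inner[OF orth_projection_selfadjoint[OF C.N], of "X ?c" ?b]
        by (simp_all only: B_N_C_N C_N_B_N inner_zero_right)
    qed
    have "inner (X (?b + ?c)) (?b + ?c) = inner (X ?b) ?b + inner (X ?c) ?c"
      using orth by (simp only: X.X_maps inner_add_left inner_add_right)
    then have eq: "inner (X x) x = inner (X ?b) ?b + inner (X ?c) ?c"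
      by (simp only: x(1))
    have b: "?b \<noteq> 0 \<Longrightarrow> inner (X ?b) ?b < 0"
      using neg_projection_neg[OF B.X B.N_idem, of x] unfolding X_form_B
      by (smt (verit) zero_le_power2)
    have c: "?c \<noteq> 0 \<Longrightarrow> inner (X ?c) ?c < 0"
      using neg_projection_neg[OF C.X C.N_idem, of x] unfolding X_form_C
      by (smt (verit) zero_le_power2)
    have "?b \<noteq> 0 \<or> ?c \<noteq> 0" using x by auto
    moreover have "?b = 0 \<Longrightarrow> inner (X ?b) ?b = 0" "?c = 0 \<Longrightarrow> inner (X ?c) ?c = 0"
      by (simp_all only: inner_zero_right)
    ultimately show ?thesis using b c unfolding eq by (smt (verit))
  qed
  show "0 \<le> inner (X x) x" if x: "B.N x + C.N x = 0" for x
  proof -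
    have Bx: "B.N x = 0" using arg_cong[OF x, of B.N] by (simp add: N_simps)
    then have Cx: "C.N x = 0" using x by simp
    \<comment> \<open>Off both negative subspaces the moduli of the factors act as the factors
      themselves, and \<open>C x\<close> stays in the kernel of \<open>B.N\<close>; so |X| x = X x,
      whose form is nonnegative.\<close>
    have "abs_op C x = C x" by (rule abs_op_neg_projection_0[OF C.X Cx])
    moreover have "abs_op B (C x) = B (C x)"
      by (rule abs_op_neg_projection_0[OF B.X]) (simp add: N_simps Bx)
    ultimately have "abs_op X x = X x" by (simp add: abs_op_X T_maps)
    then show ?thesis using positive_form[OF positive_abs_op[OF X.X], of x] by simp
  qed
qed

lemma N_eq: "X.N x = B.N x + C.N x"
  by (simp add: neg_projection_eqI[OF X.X is_neg_projection_X])

lemma neg_index_split: "\<nu>\<^sub>- X = \<nu>\<^sub>- B + \<nu>\<^sub>- C"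
proof -
  have "X.N = (\<lambda>x. B.N x + C.N x)" by (rule ext) (rule N_eq)
  then show ?thesis
    unfolding neg_index_eq[OF X.X] neg_index_eq[OF B.X] neg_index_eq[OF C.X]
    using cdim_range_orthogonal_sum[OF B.N C.N B_N_C_N] by simp
qed

text \<open>\<open>J = J\<^sub>+ J\<^sub>-\<close> and \<open>C J\<^sub>-\<close> is the modulus of
  \<open>C\<close>, hence \<open>C J = \<bar>C\<bar> J\<^sub>+\<close>.\<close>

lemma C_J_eq: "C (w - 2 *\<^sub>R X.N w) = C.D (C.D (w - 2 *\<^sub>R B.N w))"
  by (simp only: C.DD C.abs_op_eq C.X_maps N_eq C.N_maps C_N_B_N) (simp add: scaleR_2 T_maps)

end


section \<open>The minimal completion\<close>

locale factored_column = selfadjoint_operator T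
  for T :: "'a::complex_hilbert \<Rightarrow> 'a" +
  fixes V :: "'a \<Rightarrow> 'b::complex_hilbert"
  assumes V: "bounded_clinear V" and adj_range: "\<And>y. cadjoint V y \<in> closure (range X.D)"
begin

abbreviation "J \<equiv> \<lambda>x. x - 2 *\<^sub>R X.N x"
abbreviation "V' \<equiv> cadjoint V"

definition A :: "'a \<times> 'b \<Rightarrow> 'a \<times> 'b"
  where "A = block_op B (\<lambda>y. X.D (V' y)) (\<lambda>x. V (X.D x)) (\<lambda>y. V (C (J (V' y))))"

lemma A_apply: "A (x, y) = (B x + X.D (V' y), V (X.D x) + V (C (J (V' y))))"
  by (simp add: A_def block_op_apply)

lemmas V_maps = bounded_clinear_maps[OF V] bounded_clinear_maps[OF bounded_clinear_cadjoint[OF V]]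

lemma inner_V: "inner (V x) y = inner x (V' y)" by (rule inner_cadjoint[OF V])

lemma bounded_clinear_column: "bounded_clinear (\<lambda>x. V (X.D x))"
  by (rule bounded_clinear_compose[OF V selfadjoint_bounded_clinear[OF X.D]])

lemma cadjoint_column: "cadjoint (\<lambda>x. V (X.D x)) = (\<lambda>y. X.D (V' y))"
  by (rule cadjoint_eqI_inner[OF bounded_clinear_column
        bounded_clinear_compose[OF selfadjoint_bounded_clinear[OF X.D] bounded_clinear_cadjoint[OF V]]])
    (simp add: inner_V selfadjoint_inner[OF X.D])

lemma selfadjoint_J: "selfadjoint J"
  by (intro selfadjoint_sub selfadjoint_ident selfadjoint_scaleR orth_projection_selfadjoint X.N)

lemma selfadjoint_C_J: "selfadjoint (\<lambda>x. C (J x))"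
proof (rule selfadjoint_compose[OF C.X selfadjoint_J])
  have "T (X.N x) = X.N (T x)" for x
    by (rule X.N_commute[OF selfadjoint_bounded_linear[OF T]]) (simp add: T_maps)
  then show "C (J x) = J (C x)" for x by (simp add: T_maps X.N_maps algebra_simps)
qed

lemma selfadjoint_A: "selfadjoint A"
  unfolding A_def cadjoint_column[symmetric]
proof (rule selfadjoint_block_op[OF B.X bounded_clinear_column])
  have "bounded_clinear (\<lambda>y. V (C (J (V' y))))"
    using bounded_clinear_compose[OF V bounded_clinear_compose[OF
          selfadjoint_bounded_clinear[OF selfadjoint_C_J] bounded_clinear_cadjoint[OF V]]] .
  moreover have "inner (V (C (J (V' y)))) y' = inner y (V (C (J (V' y'))))" for y y'
  proof -
    have "inner (V (C (J (V' y)))) y' = inner (V' y) (C (J (V' y')))"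
      by (simp only: inner_V selfadjoint_inner[OF selfadjoint_C_J])
    then show ?thesis by (simp only: inner_commute[of "V' y"] inner_V[symmetric] inner_commute[of y])
  qed
  ultimately show "selfadjoint (\<lambda>y. V (C (J (V' y))))" by (simp add: selfadjoint_iff)
qed

lemma A_first_column: "A (x, 0) = (B x, V (X.D x))"
  by (simp add: A_apply V_maps X.D_maps T_maps X.N_maps)

text \<open>
  \<open>A = L\<^sup>* J\<^sub>+ L\<close> with \<open>J\<^sub>+ = sign (1 + T)\<close>; the lower right entry is the one for which no further
  square is left over.
\<close>

definition L :: "'a \<times> 'b \<Rightarrow> 'a"
  where "L z = B.D (fst z) + (C.D (V' (snd z)) - 2 *\<^sub>R B.N (C.D (V' (snd z))))"

lemma bounded_clinear_L: "bounded_clinear L"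
proof -
  have 1: "bounded_clinear (\<lambda>z. A11 (fst z))" "bounded_clinear (\<lambda>z. A12 (snd z))"
    if "bounded_clinear A11" "bounded_clinear A12"
    for A11 :: "'a \<Rightarrow> 'a" and A12 :: "'b \<Rightarrow> 'a"
    using that by (auto simp: bounded_clinear_def scaleC_prod_def
        intro: bounded_linear_compose[OF _ bounded_linear_fst] bounded_linear_compose[OF _ bounded_linear_snd])
  note CV = bounded_clinear_compose[OF selfadjoint_bounded_clinear[OF C.D] bounded_clinear_cadjoint[OF V]]
  note NCV = bounded_clinear_compose[OF orth_projection_bounded_clinear[OF B.N] CV]
  show ?thesis
    unfolding L_def
    by (rule bounded_clinear_add[OF 1(1)[OF selfadjoint_bounded_clinear[OF B.D] CV]
          1(2)[OF selfadjoint_bounded_clinear[OF B.D]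
            bounded_clinear_sub[OF CV bounded_clinear_scaleR[OF NCV]]]])
qed

lemma L_sum: "L (z + z') = L z + L z'" and L_scaleC: "L (c *\<^sub>C z) = c *\<^sub>C L z"
  by (simp_all add: bounded_clinear_map_add[OF bounded_clinear_L]
      bounded_clinear_scaleC[OF bounded_clinear_L])

text \<open>Since the square of \<open>J\<^sub>+\<close> is 1, expanding the form of
  \<open>J\<^sub>+\<close> at \<open>D\<^sub>+ x + J\<^sub>+ u\<close> with
  \<open>u = D\<^sub>- V\<^sup>* y\<close> gives one term per block: \<open>J\<^sub>+\<close> with
  two roots is \<open>B\<close>, the cross term is \<open>D\<^sub>+ D\<^sub>- = D\<close>, and the
  last is \<open>D\<^sub>- J\<^sub>+ D\<^sub>- = C J\<close>.\<close>

lemma form_A: "inner (A z) z = (norm (L z))\<^sup>2 - 2 * (norm (B.N (L z)))\<^sup>2"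
proof -
  obtain x y where z: "z = (x, y)" by (metis surj_pair)
  define w where "w = V' y"
  define u where "u = C.D w"
  have Lz: "L z = B.D x + (u - 2 *\<^sub>R B.N u)"
    by (simp add: L_def z w_def u_def)
  have sym: "inner (B.N a) b = inner a (B.N b)" for a b
    by (rule selfadjoint_inner[OF orth_projection_selfadjoint[OF B.N]])
  define J' where "J' v = v - 2 *\<^sub>R B.N v" for v
  have J'_sym: "inner (J' a) b = inner a (J' b)" for a b
    by (simp add: J'_def inner_diff_left inner_diff_right sym)
  have J'_J': "J' (J' a) = a" for a
    by (simp add: J'_def B.N_maps B.N_idem scaleR_2)
  have J'_add: "J' (a + b) = J' a + J' b" for a b
    by (simp add: J'_def B.N_maps algebra_simps)
  have 0: "(norm (L z))\<^sup>2 - 2 * (norm (B.N (L z)))\<^sup>2 = inner (J' (L z)) (L z)"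
    by (simp add: J'_def inner_diff_left power2_norm_eq_inner orth_projection_form[OF B.N])
  have 1: "L z = B.D x + J' u" by (simp add: Lz J'_def)
  have 2: "inner (J' (B.D x + J' u)) (B.D x + J' u)
      = inner (J' (B.D x)) (B.D x) + 2 * inner (B.D x) u + inner (J' u) u"
    by (simp add: J'_add J'_J' inner_add_left inner_add_right)
      (simp add: J'_sym J'_J' inner_commute)
  have 3: "inner (J' (B.D x)) (B.D x) = inner (B x) x"
    by (simp add: B.form_eq J'_def inner_diff_left orth_projection_form[OF B.N] power2_norm_eq_inner)
  have 4: "inner (B.D x) u = inner (X.D x) w"
    using factors_commute[OF bicommutes_B_D bicommutes_C_D, of x]
    by (simp add: u_def D_eq flip: selfadjoint_inner[OF C.D])
  have 5: "inner (J' u) u = inner (C (J w)) w"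
  proof -
    have "C (J w) = C.D (C.D (J' w))" unfolding J'_def by (rule C_J_eq)
    moreover have "C.D (J' w) = J' u"
      using factors_commute[OF bicommutes_B_N bicommutes_C_D, of w] by (simp add: J'_def u_def C.D_maps)
    ultimately show ?thesis by (simp add: selfadjoint_inner[OF C.D] u_def)
  qed
  have *: "(norm (L z))\<^sup>2 - 2 * (norm (B.N (L z)))\<^sup>2
      = inner (B x) x + 2 * inner (X.D x) w + inner (C (J w)) w"
    by (simp only: 0) (simp only: 1 2 3 4 5)
  have "inner (A z) z = inner (B x + X.D w) x + inner (V (X.D x) + V (C (J w))) y"
    by (simp only: z A_apply inner_Pair w_def)
  also have "\<dots> = inner (B x) x + inner (X.D w) x + (inner (V (X.D x)) y + inner (V (C (J w))) y)"
    by (simp only: inner_add_left[of "B x"] inner_add_left[of "V (X.D x)"])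
  also have "\<dots> = inner (B x) x + 2 * inner (X.D x) w + inner (C (J w)) w"
    by (simp only: inner_V w_def[symmetric] selfadjoint_inner[OF X.D, of w] inner_commute[of w])
  finally show ?thesis using * by simp
qed

text \<open>\<open>J\<^sub>+ D\<^sub>- V\<^sup>* y\<close> is in the closure of ran
  \<open>D\<^sub>+\<close>: for z in ker \<open>D\<^sub>+\<close> also \<open>J\<^sub>+ z\<close> is
  there, so \<open>D\<^sub>- J\<^sub>+ z\<close> is in ker \<open>D\<close>, to which
  \<open>V\<^sup>* y\<close> is orthogonal.\<close>

lemma L_approximates_0:
  assumes "0 < e"
  shows "\<exists>x. norm (L (x, y)) < e"
proof -
  define u where "u = C.D (V' y) - 2 *\<^sub>R B.N (C.D (V' y))"
  have "- u \<in> closure (range B.D)"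
    unfolding closure_range_iff[OF B.D]
  proof (intro allI impI)
    fix z assume z: "B.D z = 0"
    define v where "v = C.D (z - 2 *\<^sub>R B.N z)"
    have "inner u z = inner (V' y) v"
      by (simp add: u_def v_def inner_diff_left inner_diff_right selfadjoint_inner[OF C.D]
          selfadjoint_inner[OF orth_projection_selfadjoint[OF B.N]] C.D_maps)
    also have "\<dots> = 0"
    proof -
      have 0: "B.D (z - 2 *\<^sub>R B.N z) = 0" by (simp add: B.D_maps B.N_maps z flip: B.ND)
      have "X.D v = C.D (C.D (B.D (z - 2 *\<^sub>R B.N z)))"
        unfolding v_def D_eq by (simp only: factors_commute[OF bicommutes_B_D bicommutes_C_D])
      then have "X.D v = 0" by (simp only: 0 C.D_maps(4))
      then show ?thesis using range_orthogonal_kernel[OF X.D adj_range] by blast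
    qed
    finally show "inner (- u) z = 0" by simp
  qed
  then obtain v where "v \<in> range B.D" "dist v (- u) < e"
    using assms unfolding closure_approachable by metis
  then obtain x where "norm (B.D x - - u) < e" by (auto simp: dist_norm)
  then have "norm (B.D x + u) < e" by (simp only: diff_minus_eq_add)
  then show ?thesis by (intro exI[of _ x]) (simp add: L_def u_def)
qed

lemma completions_eq:
  assumes k: "\<nu>\<^sub>- B = enat k"
  shows "F \<in> completions B (\<lambda>x. V (X.D x)) \<longleftrightarrow>
    selfadjoint F \<and> (\<forall>x. F (x, 0) = (B x, V (X.D x))) \<and> op_le A F"
proof -
  have "op_le A F \<longleftrightarrow> \<nu>\<^sub>- F = \<nu>\<^sub>- B"
    if F: "selfadjoint F" and col: "\<And>x. F (x, 0) = (B x, V (X.D x))"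
  proof
    assume le: "op_le A F"
    show "\<nu>\<^sub>- F = \<nu>\<^sub>- B"
    proof (rule antisym)
      \<comment> \<open>Where \<open>F\<close> is negative so is \<open>A\<close>, and then
        \<open>L z\<close> has a nonzero component in the negative subspace of
        \<open>B\<close>.\<close>
      have "\<nu>\<^sub>- F \<le> cdim (range (\<lambda>z. B.N (L z)))"
      proof (rule neg_index_le_cdim[OF F
            bounded_clinear_compose[OF orth_projection_bounded_clinear[OF B.N] bounded_clinear_L]])
        fix z assume "inner (F z) z < 0"
        then have "inner (A z) z < 0" using le unfolding op_le_iff by (meson order_le_less_trans)
        then show "B.N (L z) \<noteq> 0" unfolding form_A by auto
      qed
      also have "\<dots> \<le> cdim (range B.N)"
        by (rule cdim_mono[OF subspace_range[OF
                bounded_clinear_compose[OF orth_projection_bounded_clinear[OF B.N] bounded_clinear_L]]])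
          auto
      finally show "\<nu>\<^sub>- F \<le> \<nu>\<^sub>- B" by (simp only: neg_index_eq[OF B.X])
      show "\<nu>\<^sub>- B \<le> \<nu>\<^sub>- F"
        by (rule neg_index_compression_le[OF B.X F]) (simp add: col inner_Pair)
    qed
  next
    assume nu: "\<nu>\<^sub>- F = \<nu>\<^sub>- B"
    define G where "G z = F z - A z" for z
    have G: "selfadjoint G" unfolding G_def by (rule selfadjoint_sub[OF F selfadjoint_A])
    note G_maps = bounded_clinear_maps[OF selfadjoint_bounded_clinear[OF G]]
    have G_col: "G (x, 0) = 0" for x by (simp add: G_def col A_first_column)
    \<comment> \<open>\<open>G\<close> vanishes on the first component and is selfadjoint, so its
      form depends on \<open>y\<close> alone and stays put while \<open>x\<close> is used to shrink
      \<open>L\<close>.\<close>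
    have G_form: "inner (G (x, y)) (x, y) = inner (G (0, y)) (0, y)" for x y
    proof -
      have "G (x, y) = G (0, y)"
        using G_maps(1)[of "(x, 0)" "(0, y)"] by (simp add: G_col)
      moreover have "inner (G (0, y)) (x, 0) = 0"
        using selfadjoint_inner[OF G, of "(0, y)" "(x, 0)"] by (simp add: G_col)
      ultimately show ?thesis
        using inner_add_right[of "G (0, y)" "(x, 0)" "(0, y)"] by simp
    qed
    have "0 \<le> inner (G (0, y)) (0, y)" for y
    proof (rule ccontr)
      define \<delta> where "\<delta> = - inner (G (0, y)) (0, y)"
      assume "\<not> ?thesis"
      then have \<delta>: "0 < \<delta>" by (simp add: \<delta>_def)
      \<comment> \<open>Beyond the negative subspace of \<open>B\<close>, the form of
        \<open>A\<close> along \<open>a z\<close> then contributes less than |a|^2 \<delta>, whereas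
        \<open>G\<close> contributes exactly - |a|^2 \<delta>.\<close>
      then obtain x where x: "norm (L (x, y)) < sqrt \<delta>" using L_approximates_0 by force
      define z where "z = (x, y)"
      have Lz: "(norm (L z))\<^sup>2 < \<delta>"
      proof -
        have "(norm (L z))\<^sup>2 < (sqrt \<delta>)\<^sup>2"
          using x by (intro power_strict_mono) (simp_all add: z_def)
        then show ?thesis using \<delta> by simp
      qed
      have "enat (Suc k) \<le> \<nu>\<^sub>- F"
      proof (rule Suc_le_neg_index[OF F bounded_clinear_first_component])
        show "complex_vector.subspace (range B.N)"
          by (rule subspace_range[OF orth_projection_bounded_clinear[OF B.N]])
        show "cdim (range B.N) = enat k" using k by (simp only: neg_index_eq[OF B.X])
        fix p and a :: complex
        assume "p \<in> range B.N" and pa: "p \<noteq> 0 \<or> a \<noteq> 0"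
        then have p: "B.N p = p" by (auto simp: B.N_idem)
        show "inner (F ((p, 0) + a *\<^sub>C z)) ((p, 0) + a *\<^sub>C z) < 0"
        proof (cases "a = 0")
          case True
          have "inner (B p) p < 0" using neg_projection_neg[OF B.X p] pa True by simp
          then show ?thesis using True by (simp add: col inner_Pair)
        next
          case False
          define v where "v = (p, 0) + a *\<^sub>C z"
          have "inner (G v) v = inner (G (a *\<^sub>C (0, y))) (a *\<^sub>C (0, y))"
            using G_form[of "p + a *\<^sub>C x" "a *\<^sub>C y"]
            by (simp add: v_def z_def scaleC_prod_def)
          also have "\<dots> = - (cmod a)\<^sup>2 * \<delta>"
            by (simp add: form_scaleC[OF selfadjoint_bounded_clinear[OF G]] \<delta>_def)
          finally have Gv: "inner (G v) v = - (cmod a)\<^sup>2 * \<delta>" .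
          have "L (p, 0) = B.D p"
            by (simp add: L_def V_maps C.D_maps B.N_maps)
          then have Lv: "L v = B.D p + a *\<^sub>C L z" by (simp add: v_def L_sum L_scaleC)
          have "L v - B.N (L v) = a *\<^sub>C (L z - B.N (L z))"
            by (simp add: Lv B.N_maps B.ND p scaleC_diff_right
                bounded_clinear_scaleC[OF orth_projection_bounded_clinear[OF B.N]])
          then have "(norm (L v - B.N (L v)))\<^sup>2 \<le> (cmod a)\<^sup>2 * (norm (L z))\<^sup>2"
            using orth_projection_norm_le[OF orth_projection_complement[OF B.N], of "L z"]
            by (simp add: norm_scaleC power_mult_distrib mult_left_mono power_mono)
          also have "\<dots> < (cmod a)\<^sup>2 * \<delta>" using Lz False by simp
          finally have "inner (A v) v < (cmod a)\<^sup>2 * \<delta>"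
            unfolding form_A using orth_projection_pythagoras[OF B.N, of "L v"]
            by (smt (verit) zero_le_power2)
          moreover have "inner (F v) v = inner (A v) v + inner (G v) v"
            by (simp add: G_def inner_diff_left)
          ultimately show ?thesis using Gv by (simp add: v_def)
        qed
      qed
      then show False by (simp add: nu k)
    qed
    then have "0 \<le> inner (G (x, y)) (x, y)" for x y
      by (subst G_form)
    then have "0 \<le> inner (G z) z" for z by (metis surj_pair)
    then show "op_le A F" by (simp add: op_le_iff G_def inner_diff_left)
  qed
  then show ?thesis
    unfolding completions_iff[OF selfadjoint_bounded_clinear[OF B.X] bounded_clinear_column]
    by blast
qed

lemma
  assumes k: "\<nu>\<^sub>- B = enat k"
  shows is_minimal_completion_A: "is_minimal_completion B (\<lambda>x. V (X.D x)) A"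
    and minimal_completion_eq: "minimal_completion B (\<lambda>x. V (X.D x)) = A"
proof -
  show *: "is_minimal_completion B (\<lambda>x. V (X.D x)) A"
    by (simp add: is_minimal_completion_def completions_eq[OF k] selfadjoint_A A_first_column)
      (simp add: op_le_iff)
  show "minimal_completion B (\<lambda>x. V (X.D x)) = A"
    unfolding minimal_completion_def
  proof (rule the_equality)
    show "is_minimal_completion B (\<lambda>x. V (X.D x)) A" by (rule *)
    fix F assume "is_minimal_completion B (\<lambda>x. V (X.D x)) F"
    with * show "F = A"
      unfolding is_minimal_completion_def
      by (intro op_le_antisym) (auto simp: completions_eq[OF k])
  qed
qed

end

section \<open>Extremal extensions\<close>

context factored_column
begin

definition A_minus :: "'a \<times> 'b \<Rightarrow> 'a \<times> 'b"
  where "A_minus = block_op C (\<lambda>y. - X.D (V' y)) (\<lambda>x. - V (X.D x)) (\<lambda>y. V (B (J (V' y))))"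

lemma cadjoint_minus: "cadjoint (\<lambda>x. - V x) = (\<lambda>y. - V' y)"
  by (rule cadjoint_eqI_inner)
    (simp_all add: bounded_clinear_minus V bounded_clinear_cadjoint inner_V)

text \<open>\<open>X\<close> is even in \<open>T\<close>, so \<open>D\<close> and \<open>J\<close>
  are unchanged while \<open>B\<close> and \<open>C\<close> are interchanged; the sign of
  \<open>V\<close> accounts for the sign of the column.\<close>

lemma factored_column_minus: "factored_column (\<lambda>x. - T x) (\<lambda>x. - V x)"
proof
  show "selfadjoint (\<lambda>x. - T x)" by (rule selfadjoint_minus[OF T])
  show "bounded_clinear (\<lambda>x. - V x)" by (rule bounded_clinear_minus[OF V])
  have eq: "(\<lambda>x. x - - T (- T x)) = X" by (simp add: T_maps)
  show "cadjoint (\<lambda>x. - V x) y \<in> closure (range (sqrt_op (abs_op (\<lambda>x. x - - T (- T x)))))" for y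
    unfolding eq cadjoint_minus using adj_range[of y] unfolding closure_range_iff[OF X.D] by simp
qed

lemma
  shows selfadjoint_A_minus: "selfadjoint A_minus"
    and A_minus_first_column: "A_minus (x, 0) = (C x, - V (X.D x))"
    and completions_minus_eq: "\<nu>\<^sub>- C = enat k \<Longrightarrow> F \<in> completions C (\<lambda>x. - V (X.D x)) \<longleftrightarrow>
      selfadjoint F \<and> (\<forall>x. F (x, 0) = (C x, - V (X.D x))) \<and> op_le A_minus F"
    and is_minimal_completion_A_minus:
      "\<nu>\<^sub>- C = enat k \<Longrightarrow> is_minimal_completion C (\<lambda>x. - V (X.D x)) A_minus"
    and minimal_completion_minus_eq:
      "\<nu>\<^sub>- C = enat k \<Longrightarrow> minimal_completion C (\<lambda>x. - V (X.D x)) = A_minus"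
proof -
  interpret m: factored_column "\<lambda>x. - T x" "\<lambda>x. - V x" by (rule factored_column_minus)
  have X_eq: "(\<lambda>x. x - - T (- T x)) = X" and B_eq: "(\<lambda>x. x + - T x) = C"
    by (simp_all add: T_maps)
  have A_eq: "m.A = A_minus"
    unfolding m.A_def A_minus_def X_eq B_eq cadjoint_minus
    by (simp add: X.D_maps X.N_maps V_maps T_maps algebra_simps)
  note eqs = X_eq B_eq A_eq
  show "selfadjoint A_minus" by (rule m.selfadjoint_A[unfolded eqs])
  show "A_minus (x, 0) = (C x, - V (X.D x))"
    using m.A_first_column[of x] unfolding eqs by simp
  assume k: "\<nu>\<^sub>- C = enat k"
  note k' = k[folded B_eq]
  show "F \<in> completions C (\<lambda>x. - V (X.D x)) \<longleftrightarrow>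
      selfadjoint F \<and> (\<forall>x. F (x, 0) = (C x, - V (X.D x))) \<and> op_le A_minus F"
    using m.completions_eq[OF k', of F] unfolding eqs by simp
  show "is_minimal_completion C (\<lambda>x. - V (X.D x)) A_minus"
    using m.is_minimal_completion_A[OF k'] unfolding eqs .
  show "minimal_completion C (\<lambda>x. - V (X.D x)) = A_minus"
    using m.minimal_completion_eq[OF k'] unfolding eqs .
qed

definition T_lower :: "'a \<times> 'b \<Rightarrow> 'a \<times> 'b" where "T_lower z = A z - z"

definition T_upper :: "'a \<times> 'b \<Rightarrow> 'a \<times> 'b" where "T_upper z = z - A_minus z"

lemma selfadjoint_T_lower: "selfadjoint T_lower"
  unfolding T_lower_def by (intro selfadjoint_sub selfadjoint_A selfadjoint_ident)

lemma selfadjoint_T_upper: "selfadjoint T_upper"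
  unfolding T_upper_def by (intro selfadjoint_sub selfadjoint_A_minus selfadjoint_ident)

lemma T_lower_first_column: "T_lower (x, 0) = (T x, V (X.D x))"
  by (simp add: T_lower_def A_first_column)

lemma T_upper_first_column: "T_upper (x, 0) = (T x, V (X.D x))"
  by (simp add: T_upper_def A_minus_first_column)

lemma T_lower_eq: "T_lower = block_op T (\<lambda>y. X.D (V' y)) (\<lambda>x. V (X.D x))
    (\<lambda>y. - y + V (J (V' y) - T (J (V' y))))"
proof
  fix z show "T_lower z = block_op T (\<lambda>y. X.D (V' y)) (\<lambda>x. V (X.D x))
      (\<lambda>y. - y + V (J (V' y) - T (J (V' y)))) z"
    by (cases z) (simp add: T_lower_def A_apply block_op_apply)
qed

lemma T_upper_eq: "T_upper = block_op T (\<lambda>y. X.D (V' y)) (\<lambda>x. V (X.D x))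
    (\<lambda>y. y - V (J (V' y) + T (J (V' y))))"
proof
  fix z show "T_upper z = block_op T (\<lambda>y. X.D (V' y)) (\<lambda>x. V (X.D x))
      (\<lambda>y. y - V (J (V' y) + T (J (V' y)))) z"
    by (cases z) (simp add: T_upper_def A_minus_def block_op_apply)
qed

lemma op_le_T_lower_T_upper:
  assumes J_le: "\<And>y. (norm (V' y))\<^sup>2 - 2 * (norm (X.N (V' y)))\<^sup>2 \<le> (norm y)\<^sup>2"
  shows "op_le T_lower T_upper"
  unfolding op_le_iff
proof
  fix z :: "'a \<times> 'b"
  obtain x y where z: "z = (x, y)" by (metis surj_pair)
  have J_form: "inner (V (J (V' y))) y = (norm (V' y))\<^sup>2 - 2 * (norm (X.N (V' y)))\<^sup>2"
    by (simp add: inner_V inner_diff_left orth_projection_form[OF X.N] power2_norm_eq_inner)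
  have "inner (T_upper z) z - inner (T_lower z) z = inner (T_upper z - T_lower z) z"
    by (simp add: inner_diff_left)
  also have "T_upper z - T_lower z = (0, 2 *\<^sub>R (y - V (J (V' y))))"
    by (simp add: z T_lower_eq T_upper_eq block_op_apply V_maps scaleR_2 algebra_simps)
  also have "inner \<dots> z = 2 * ((norm y)\<^sup>2 - inner (V (J (V' y))) y)"
    by (simp add: z inner_Pair inner_diff_left power2_norm_eq_inner)
  finally show "inner (T_lower z) z \<le> inner (T_upper z) z"
    using J_le[of y] unfolding J_form by simp
qed

text \<open>Both bounds have the same first column, so the nonnegative form of
  \<open>U - T_lower\<close> vanishes at \<open>(x, 0)\<close> and with it the operator. Thus order
  bounds alone force \<open>U\<close> to be an extension.\<close>

lemma first_column_between:
  assumes U: "selfadjoint U" and le: "op_le T_lower U" "op_le U T_upper"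
  shows "U (x, 0) = (T x, V (X.D x))"
proof -
  define G where "G z = U z - T_lower z" for z
  have "positive G"
    unfolding positive_def G_def
    using le(1) by (simp add: selfadjoint_sub U selfadjoint_T_lower op_le_iff inner_diff_left)
  moreover have "inner (G (x, 0)) (x, 0) = 0"
  proof (rule antisym)
    have "inner (U (x, 0)) (x, 0) \<le> inner (T_upper (x, 0)) (x, 0)"
      using le(2) by (simp only: op_le_iff)
    then show "inner (G (x, 0)) (x, 0) \<le> 0"
      by (simp only: G_def inner_diff_left T_upper_first_column T_lower_first_column)
    show "0 \<le> inner (G (x, 0)) (x, 0)" using \<open>positive G\<close> by (rule positive_form)
  qed
  ultimately have "G (x, 0) = 0" by (rule positive_eq_0_if_form_0)
  then show ?thesis by (simp add: G_def T_lower_first_column)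
qed

lemma finite_indices:
  assumes "\<nu>\<^sub>- X = enat \<kappa>"
  obtains k l where "\<nu>\<^sub>- B = enat k" "\<nu>\<^sub>- C = enat l"
  using assms that unfolding neg_index_split by (cases "\<nu>\<^sub>- B"; cases "\<nu>\<^sub>- C") auto

lemma Ext_iff:
  assumes \<kappa>: "\<nu>\<^sub>- X = enat \<kappa>"
  shows "U \<in> Ext (column_op T (\<lambda>x. V (X.D x))) (enat \<kappa>) \<longleftrightarrow>
    selfadjoint U \<and> op_le T_lower U \<and> op_le U T_upper"
proof -
  obtain k l where k: "\<nu>\<^sub>- B = enat k" and l: "\<nu>\<^sub>- C = enat l"
    using finite_indices[OF \<kappa>] .
  have "\<nu>\<^sub>- (\<lambda>z. z - U (U z)) = enat \<kappa> \<longleftrightarrow> op_le T_lower U \<and> op_le U T_upper"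
    if U: "selfadjoint U" and col: "\<And>x. U (x, 0) = (T x, V (X.D x))"
  proof -
    interpret U: selfadjoint_operator U by standard (rule U)
    have ge: "enat k \<le> \<nu>\<^sub>- U.B" "enat l \<le> \<nu>\<^sub>- U.C"
      unfolding k[symmetric] l[symmetric]
      by (rule neg_index_compression_le[OF B.X U.B.X], simp add: col inner_Pair,
          rule neg_index_compression_le[OF C.X U.C.X], simp add: col inner_Pair)
    \<comment> \<open>Compression bounds both indices below by \<open>k\<close> and
      \<open>l\<close>. As these are finite and add up to \<open>\<kappa>\<close>, the total is
      \<open>\<kappa>\<close> only if neither index exceeds its bound.\<close>
    have "enat k + enat l = enat \<kappa>" using \<kappa> unfolding neg_index_split k l .
    then have "\<nu>\<^sub>- U.X = enat \<kappa> \<longleftrightarrow> \<nu>\<^sub>- U.B = enat k \<and> \<nu>\<^sub>- U.C = enat l"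
      unfolding U.neg_index_split using ge
      by (cases "\<nu>\<^sub>- U.B"; cases "\<nu>\<^sub>- U.C") auto
    also have "\<nu>\<^sub>- U.B = enat k \<longleftrightarrow> U.B \<in> completions B (\<lambda>x. V (X.D x))"
      unfolding completions_iff[OF selfadjoint_bounded_clinear[OF B.X] bounded_clinear_column]
      using U.B.X k by (simp add: col)
    also have "\<dots> \<longleftrightarrow> op_le T_lower U"
      unfolding completions_eq[OF k] using U.B.X
      by (simp add: col op_le_iff T_lower_def inner_add_left inner_diff_left algebra_simps)
    also have "\<nu>\<^sub>- U.C = enat l \<longleftrightarrow> U.C \<in> completions C (\<lambda>x. - V (X.D x))"
      unfolding completions_iff[OF selfadjoint_bounded_clinear[OF C.X]
          bounded_clinear_minus[OF bounded_clinear_column]]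
      using U.C.X l by (simp add: col)
    also have "\<dots> \<longleftrightarrow> op_le U T_upper"
      unfolding completions_minus_eq[OF l] using U.C.X
      by (simp add: col op_le_iff T_upper_def inner_diff_left algebra_simps)
    finally show ?thesis .
  qed
  then show ?thesis
    using first_column_between[of U] unfolding Ext_def column_op_def by auto
qed

end

section \<open>From the given column to its factor, and the equivalence with the extremal
  extensions\<close>

lemma selfadjoint_gram: "bounded_clinear S \<Longrightarrow> selfadjoint (\<lambda>x. cadjoint S (S x))"
  by (simp add: selfadjoint_iff bounded_clinear_compose bounded_clinear_cadjoint)
    (metis inner_cadjoint inner_commute)

lemma bounded_clinear_column_op:
  assumes A: "bounded_clinear A" and S: "bounded_clinear S"
  shows "bounded_clinear (column_op A S)"
  using bounded_linear_Pair[OF A[THEN bounded_clinear_bounded_linear] S[THEN bounded_clinear_bounded_linear]]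
  by (simp add: bounded_clinear_def column_op_def scaleC_prod_def bounded_clinear_scaleC[OF A]
      bounded_clinear_scaleC[OF S])

theorem theorem5p2:
  fixes T11 :: "'a::complex_hilbert \<Rightarrow> 'a"
    and T21 :: "'a \<Rightarrow> 'b::complex_hilbert"
    and T1 :: "'a \<Rightarrow> 'a \<times> 'b"
    and J D :: "'a \<Rightarrow> 'a"
    and Tm TM :: "'a \<times> 'b \<Rightarrow> 'a \<times> 'b"
    and \<kappa> :: nat
  assumes T11: "selfadjoint T11"
    and T21: "bounded_clinear T21"
    and kappa: "\<nu>\<^sub>- (\<lambda>x. x - T11 (T11 x)) = enat \<kappa>"
  defines "T1 \<equiv> column_op T11 T21"
    and "J \<equiv> sign_op (\<lambda>x. x - T11 (T11 x))"
    and "D \<equiv> sqrt_op (abs_op (\<lambda>x. x - T11 (T11 x)))"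
    and "Tm \<equiv> T_min T11 T21"
    and "TM \<equiv> T_max T11 T21"
  shows
    "((\<exists>T. selfadjoint T \<and>
          (\<lambda>z. z + T z) \<in> completions (\<lambda>x. x + T11 x) T21 \<and>
          (\<lambda>z. z - T z) \<in> completions (\<lambda>x. x - T11 x) (\<lambda>x. - T21 x) \<and>
          \<nu>\<^sub>- (\<lambda>z. z - T (T z)) = enat \<kappa>)
        \<longleftrightarrow> \<nu>\<^sub>- (\<lambda>x. x - T11 (T11 x)) = \<nu>\<^sub>- (\<lambda>x. x - cadjoint T1 (T1 x))) \<and>
     (\<nu>\<^sub>- (\<lambda>x. x - T11 (T11 x)) = \<nu>\<^sub>- (\<lambda>x. x - cadjoint T1 (T1 x)) \<longrightarrow>
        ((\<exists>A. is_minimal_completion (\<lambda>x. x + T11 x) T21 A) \<and>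
         (\<exists>A. is_minimal_completion (\<lambda>x. x - T11 x) (\<lambda>x. - T21 x) A)) \<and>
        (Tm \<in> Ext T1 (enat \<kappa>) \<and> TM \<in> Ext T1 (enat \<kappa>)) \<and>
        (\<exists>V. is_clos_mp_quotient T21 D V \<and>
           Tm = block_op T11 (\<lambda>y. D (cadjoint V y)) (\<lambda>x. V (D x))
                  (\<lambda>y. - y + V (J (cadjoint V y) - T11 (J (cadjoint V y)))) \<and>
           TM = block_op T11 (\<lambda>y. D (cadjoint V y)) (\<lambda>x. V (D x))
                  (\<lambda>y. y - V (J (cadjoint V y) + T11 (J (cadjoint V y))))) \<and>
        (\<forall>T. T \<in> Ext T1 (enat \<kappa>) \<longleftrightarrow> selfadjoint T \<and> op_le Tm T \<and> op_le T TM) \<and>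
        (T_min (\<lambda>x. - T11 x) (\<lambda>x. - T21 x) = (\<lambda>z. - TM z) \<and>
         T_max (\<lambda>x. - T11 x) (\<lambda>x. - T21 x) = (\<lambda>z. - Tm z)))"
proof -
  interpret T: selfadjoint_operator T11 by standard (rule T11)
  let ?Y = "\<lambda>x. x - cadjoint T1 (T1 x)"
  have T1: "bounded_clinear T1"
    unfolding T1_def
    by (rule bounded_clinear_column_op[OF selfadjoint_bounded_clinear[OF T11] T21])
  have Y: "selfadjoint ?Y" by (intro selfadjoint_sub selfadjoint_ident selfadjoint_gram T1)
  have Y_form': "inner (?Y x) x = (norm x)\<^sup>2 - (norm (T1 x))\<^sup>2" for x
    using inner_cadjoint[OF T1, of x "T1 x"]
    by (simp add: inner_diff_left inner_diff_right power2_norm_eq_inner inner_commute)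
  have Y_form: "inner (?Y x) x = inner (T.X x) x - (norm (T21 x))\<^sup>2" for x
  proof -
    have "(norm (T1 x))\<^sup>2 = inner (T11 x) (T11 x) + (norm (T21 x))\<^sup>2"
      by (simp add: T1_def column_op_def power2_norm_eq_inner inner_Pair)
    then show ?thesis
      unfolding Y_form' by (simp add: inner_diff_left selfadjoint_inner[OF T11] power2_norm_eq_inner)
  qed
  \<comment> \<open>One inequality always holds because \<open>?Y\<close> lies below
    \<open>T.X\<close>; the index condition is the reverse one.\<close>
  have Y_ge: "\<nu>\<^sub>- T.X \<le> \<nu>\<^sub>- ?Y"
    by (rule neg_index_comparison[OF T.X.X Y bounded_clinear_ident])
      (unfold Y_form, smt (verit) zero_le_power2)
  \<comment> \<open>For any extension \<open>U\<close> of \<open>T1\<close>, \<open>?Y\<close> is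
    the compression of 1 - U^2 to the first component, since the form of 1 - U^2 there is ||x||^2 -
    ||T1 x||^2.\<close>
  have cond: "\<nu>\<^sub>- T.X = \<nu>\<^sub>- ?Y"
    if U: "selfadjoint U" "(\<lambda>z. z + U z) \<in> completions T.B T21" "\<nu>\<^sub>- (\<lambda>z. z - U (U z)) = enat \<kappa>"
    for U
  proof (rule antisym[OF Y_ge])
    interpret U: selfadjoint_operator U by standard (rule U(1))
    have col: "U (x, 0) = T1 x" for x
      using U(2) unfolding completions_iff[OF selfadjoint_bounded_clinear[OF T.B.X] T21]
      by (simp add: T1_def column_op_def prod_eq_iff)
    have "inner (U.X (x, 0)) (x, 0) = inner (?Y x) x" for x
      unfolding Y_form'
      by (simp add: inner_diff_left selfadjoint_inner[OF U(1)] col power2_norm_eq_inner inner_Pair)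
    then have "\<nu>\<^sub>- ?Y \<le> \<nu>\<^sub>- U.X" by (rule neg_index_compression_le[OF Y U.X.X])
    then show "\<nu>\<^sub>- ?Y \<le> \<nu>\<^sub>- T.X" using U(3) kappa by simp
  qed
  show ?thesis
  proof (cases "\<nu>\<^sub>- T.X = \<nu>\<^sub>- ?Y")
    case False
    then show ?thesis using cond by blast
  next
    case eq: True
    then have Y_le: "\<nu>\<^sub>- ?Y \<le> enat \<kappa>" using kappa by simp
    obtain c where "\<And>x. norm (T21 x) \<le> c * norm (T.X.D x)"
      using T.X.dominated_by_root[OF kappa Y Y_le T21 Y_form] by blast
    from factor_through_range[OF T.X.D T21 this]
    obtain V where V: "bounded_clinear V" and VD: "\<And>x. V (T.X.D x) = T21 x"
      and adj: "\<And>y. cadjoint V y \<in> closure (range T.X.D)" by blast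
    interpret V: factored_column T11 V by standard (fact V adj)+
    have quotient: "is_clos_mp_quotient T21 D V"
      unfolding D_def by (rule is_clos_mp_quotientI[OF T.X.D V VD adj])
    have J_le: "(norm (cadjoint V y))\<^sup>2 - 2 * (norm (T.X.N (cadjoint V y)))\<^sup>2 \<le> (norm y)\<^sup>2" for y
      by (rule T.X.sandwiched_sign_le[OF kappa Y Y_le V adj]) (unfold VD, rule Y_form)
    have J_eq: "J = (\<lambda>x. x - 2 *\<^sub>R T.X.N x)" unfolding J_def by (rule sign_op_eq[OF T.X.X])
    obtain k l where k: "\<nu>\<^sub>- T.B = enat k" and l: "\<nu>\<^sub>- T.C = enat l"
      using V.finite_indices[OF kappa] .
    have column: "(\<lambda>x. V (T.X.D x)) = T21" by (simp add: VD)
    note minimal = V.is_minimal_completion_A[OF k, unfolded VD]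
      V.is_minimal_completion_A_minus[OF l, unfolded VD]
    have Tm: "Tm = V.T_lower"
      unfolding Tm_def T_min_def V.T_lower_def V.minimal_completion_eq[OF k, unfolded VD] ..
    have TM: "TM = V.T_upper"
      unfolding TM_def T_max_def V.T_upper_def V.minimal_completion_minus_eq[OF l, unfolded VD] ..
    have Ext: "U \<in> Ext T1 (enat \<kappa>) \<longleftrightarrow> selfadjoint U \<and> op_le Tm U \<and> op_le U TM" for U
      using V.Ext_iff[OF kappa, of U] unfolding VD Tm TM T1_def .
    have "op_le Tm TM" unfolding Tm TM by (rule V.op_le_T_lower_T_upper[OF J_le])
    then have Tm_TM_Ext: "Tm \<in> Ext T1 (enat \<kappa>)" "TM \<in> Ext T1 (enat \<kappa>)"
      unfolding Ext by (simp_all add: Tm TM V.selfadjoint_T_lower V.selfadjoint_T_upper op_le_iff)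
    have blocks: "Tm = block_op T11 (\<lambda>y. D (cadjoint V y)) (\<lambda>x. V (D x))
          (\<lambda>y. - y + V (J (cadjoint V y) - T11 (J (cadjoint V y))))"
        "TM = block_op T11 (\<lambda>y. D (cadjoint V y)) (\<lambda>x. V (D x))
          (\<lambda>y. y - V (J (cadjoint V y) + T11 (J (cadjoint V y))))"
      unfolding J_eq D_def Tm TM by (rule V.T_lower_eq, rule V.T_upper_eq)
    \<comment> \<open>Changing the sign of both entries turns each of the two completion problems
      into the other, so the claims hold by unfolding.\<close>
    have neg: "T_min (\<lambda>x. - T11 x) (\<lambda>x. - T21 x) = (\<lambda>z. - TM z)"
        "T_max (\<lambda>x. - T11 x) (\<lambda>x. - T21 x) = (\<lambda>z. - Tm z)"
      by (simp_all add: T_min_def T_max_def Tm_def TM_def)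
    have solution: "\<exists>U. selfadjoint U \<and> (\<lambda>z. z + U z) \<in> completions T.B T21 \<and>
        (\<lambda>z. z - U z) \<in> completions T.C (\<lambda>x. - T21 x) \<and> \<nu>\<^sub>- (\<lambda>z. z - U (U z)) = enat \<kappa>"
    \<comment> \<open>\<open>Tm\<close> is the witness: \<open>1 + Tm\<close> is the minimal
      completion itself, and \<open>Tm \<le> TM\<close> says that \<open>1 - Tm\<close> lies above
      the minimal completion of the other problem.\<close>
    proof (intro exI conjI)
      show "selfadjoint Tm" unfolding Tm by (rule V.selfadjoint_T_lower)
      show "\<nu>\<^sub>- (\<lambda>z. z - Tm (Tm z)) = enat \<kappa>" using Tm_TM_Ext(1) by (simp add: Ext_def)
      have "(\<lambda>z. z + Tm z) = V.A" by (simp add: Tm V.T_lower_def)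
      then show "(\<lambda>z. z + Tm z) \<in> completions T.B T21"
        using minimal(1) by (simp add: is_minimal_completion_def)
      have "selfadjoint (\<lambda>z. z - Tm z)"
        unfolding Tm by (intro selfadjoint_sub selfadjoint_ident V.selfadjoint_T_lower)
      moreover have "op_le V.A_minus (\<lambda>z. z - Tm z)"
        using \<open>op_le Tm TM\<close> unfolding Tm TM
        by (simp add: op_le_iff V.T_upper_def inner_diff_left algebra_simps)
      ultimately show "(\<lambda>z. z - Tm z) \<in> completions T.C (\<lambda>x. - T21 x)"
        using V.completions_minus_eq[OF l, of "\<lambda>z. z - Tm z"] unfolding VD
        by (simp add: Tm V.T_lower_first_column VD)
    qed
    have quotient_blocks: "\<exists>V. is_clos_mp_quotient T21 D V \<and>
        Tm = block_op T11 (\<lambda>y. D (cadjoint V y)) (\<lambda>x. V (D x))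
          (\<lambda>y. - y + V (J (cadjoint V y) - T11 (J (cadjoint V y)))) \<and>
        TM = block_op T11 (\<lambda>y. D (cadjoint V y)) (\<lambda>x. V (D x))
          (\<lambda>y. y - V (J (cadjoint V y) + T11 (J (cadjoint V y))))"
      by (intro exI[of _ V] conjI quotient blocks)
    have Ext_all: "\<forall>U. U \<in> Ext T1 (enat \<kappa>) \<longleftrightarrow> selfadjoint U \<and> op_le Tm U \<and> op_le U TM"
      using Ext by blast
    have exists_minimal: "\<exists>A. is_minimal_completion T.B T21 A"
        "\<exists>A. is_minimal_completion T.C (\<lambda>x. - T21 x) A"
      using minimal by blast+
    show ?thesis
      by (intro conjI impI iffI) (rule eq solution exists_minimal Tm_TM_Ext quotient_blocks Ext_all neg)+
  qed
qed

end
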